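(* (Kato's identity.) Let $(\mathcal{H},\mathcal{W}_{\sigma,T},\omega_{\sigma,T})$ be an $\omega_{\sigma,T}$-representation of the symplectic space $(W,\sigma)$, where $T:W\to W$ is linear with $T+T^{\sigma}$ an isomorphism, let $\mathcal{S}$ be its space of $\mathcal{C}^{\infty}$ vectors and $\mathrm{Op}_{\sigma,T}$ the $T$-Weyl calculus. (a) If $b\in\mathcal{S}(W)$ and $c\in\mathcal{S}^{*}(W)$, then $b*_{\sigma}c\in\mathcal{S}^{*}(W)$ and $$\mathrm{Op}_{\sigma,T}(b*_{\sigma}c)=\int_W b(\xi)\,\mathcal{U}_{\sigma,T}(\xi)\mathrm{Op}_{\sigma,T}(c)\,\mathcal{U}_{\sigma,T}(-\xi)\,\mathrm{d}^{\sigma}\xi=\int_W c(\xi)\,\mathcal{U}_{\sigma,T}(\xi)\mathrm{Op}_{\sigma,T}(b)\,\mathcal{U}_{\sigma,T}(-\xi)\,\mathrm{d}^{\sigma}\xi,$$ where the first integral is weakly absolutely convergent, while the second must be interpreted in the sense of distributions and represents the operator defined by $$\Big\langle\varphi,\Big(\int_W c(\xi)\,\mathcal{U}_{\sigma,T}(\xi)\mathrm{Op}_{\sigma,T}(b)\,\mathcal{U}_{\sigma,T}(-\xi)\,\mathrm{d}^{\sigma}\xi\Big)\psi\Big\rangle_{\mathcal{S},\mathcal{S}^{*}}=\Big\langle\overline{\langle\varphi,\mathcal{U}_{\sigma,T}(\cdot)\mathrm{Op}_{\sigma,T}(b)\,\mathcal{U}_{\sigma,T}(-\cdot)\psi\rangle}_{\mathcal{S},\mathcal{S}^{*}},c\Big\rangle^{\sigma}_{\mathcal{S}(W),\mathcal{S}^{*}(W)}$$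 for all $\varphi,\psi\in\mathcal{S}$. (b) Let $h\in\mathcal{C}^{\infty}_{\mathrm{pol}}(W)$. If $b\in L^p(W)$ and $c\in L^q(W)$, where $1\le p,q\le\infty$ and $p^{-1}+q^{-1}\ge1$, then $b*_{\sigma}c\in L^r(W)$ with $r^{-1}=p^{-1}+q^{-1}-1$, and $$\mathrm{Op}_{\sigma,T}\big(h(D_{\sigma})(b*_{\sigma}c)\big)=\int_W b(\xi)\,\mathcal{U}_{\sigma,T}(\xi)\mathrm{Op}_{\sigma,T}\big(h(D_{\sigma})c\big)\,\mathcal{U}_{\sigma,T}(-\xi)\,\mathrm{d}^{\sigma}\xi,$$ where the integral is weakly absolutely convergent.
   Context: $(W,\sigma)$ is a finite-dimensional real vector space with a non-degenerate antisymmetric bilinear form $\sigma$. For linear $T:W\to W$, $T^{\sigma}$ is defined by $\sigma(T^{\sigma}\xi,\eta)=\sigma(\xi,T\eta)$; standing assumption: $T+T^{\sigma}$ is an isomorphism. Put $\omega_{\sigma,T}(\xi,\eta)=\mathrm{e}^{\mathrm{i}\sigma(\xi,T\eta)}$. An $\omega_{\sigma,T}$-representation is a complex Hilbert space $\mathcal{H}$ with a strongly continuous map $\mathcal{W}_{\sigma,T}:W\to\mathcal{U}(\mathcal{H})$ such that $\mathcal{W}_{\sigma,T}(\xi)\mathcal{W}_{\sigma,T}(\eta)=\omega_{\sigma,T}(\xi,\eta)\mathcal{W}_{\sigma,T}(\xi+\eta)$ (irreducibility is not assumed). Put $\widetilde{\mathcal{W}}_{\sigma,T}(\xi)=\mathrm{e}^{\frac{\mathrm{i}}{2}\sigma(\xi,T\xi)}\mathcal{W}_{\sigma,T}(\xi)$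 and $\mathcal{U}_{\sigma,T}(\xi)=\widetilde{\mathcal{W}}_{\sigma,T}((T+T^{\sigma})^{-1}\xi)$. $\mathcal{S}=\mathcal{S}(\mathcal{H},\mathcal{W}_{\sigma,T})=\mathcal{S}(\mathcal{H},\widetilde{\mathcal{W}}_{\sigma,T})\subset\mathcal{H}$ is the space of $\mathcal{C}^{\infty}$ vectors (those $\varphi$ for which $\xi\mapsto\mathcal{W}_{\sigma,T}(\xi)\varphi$ is $\mathcal{C}^\infty$), a Fréchet space with seminorms $\|\phi_T(\xi_1)\cdots\phi_T(\xi_k)\varphi\|_{\mathcal{H}}$, where $\widetilde{\mathcal{W}}_{\sigma,T}(t\xi)=\mathrm{e}^{\mathrm{i}t\phi_T(\xi)}$, $\phi_T(\xi)$ self-adjoint; $\mathcal{S}^{*}$ is the space of continuous antilinear functionals on $\mathcal{S}$; $\mathcal{S}\subset\mathcal{H}\subset\mathcal{S}^*$ and $\langle\cdot,\cdot\rangle_{\mathcal{S},\mathcal{S}^*}$ is the antiduality (antilinear in the first variable) extending the scalar product; the unitaries $\mathcal{U}_{\sigma,T}(\xi)$ preserve $\mathcal{S}$ and extend to $\mathcal{S}^*$ by duality. A weakly absolutely convergent integral of operators $\mathcal{S}\to\mathcal{S}^*$ is one for which, for all $\varphi,\psi\in\mathcal{S}$, the matrix element $\langle\varphi,\cdot\,\psi\rangle$ of the integrand is absolutely integrable, the operator being defined by these integrals. $\mathcal{S}^*(W)$ is the space of continuous antilinear functionals on the Schwartz space $\mathcal{S}(W)$, with functions $u$ acting by $\langle\varphi,u\rangle^{\sigma}_{\mathcal{S}(W),\mathcal{S}^*(W)}=\int_W\overline{\varphi}\,u\,\mathrm{d}^{\sigma}\eta$.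 $\mathrm{d}^{\sigma}\xi$ is the unique Haar measure on $W$ such that $(\mathcal{F}_{\sigma}a)(\xi)=\int_W\mathrm{e}^{-\mathrm{i}\sigma(\xi,\eta)}a(\eta)\,\mathrm{d}^{\sigma}\eta$ is involutive and unitary on $L^2(W)$; $\mathcal{F}_\sigma$ extends to $\mathcal{S}^*(W)$. $L^p(W)$ is taken with respect to $\mathrm{d}^\sigma\xi$. Convolution: $(b*_{\sigma}c)(\xi)=\int_W b(\xi-\eta)c(\eta)\,\mathrm{d}^{\sigma}\eta$, understood for $b\in\mathcal{S}(W)$, $c\in\mathcal{S}^*(W)$ as $(b*_\sigma c)(\xi)=\langle\overline{b}(\xi-\cdot),c\rangle^{\sigma}$. $\mathcal{C}^{\infty}_{\mathrm{pol}}(W)$: smooth functions all of whose derivatives have at most polynomial growth; $h(D_{\sigma})=\mathcal{F}_{\sigma}\circ\mathrm{M}_h\circ\mathcal{F}_{\sigma}$ with $\mathrm{M}_h$ multiplication by $h$. For $a\in\mathcal{S}^{*}(W)$, $\mathrm{Op}_{\sigma,T}(a):\mathcal{S}\to\mathcal{S}^*$ is defined by $\langle\varphi,\mathrm{Op}_{\sigma,T}(a)\psi\rangle=\big\langle\overline{\langle\varphi,\mathcal{W}_{\sigma,T}(\cdot)\psi\rangle},\mathcal{F}_{\sigma}(a)\big\rangle^{\sigma}_{\mathcal{S}(W),\mathcal{S}^{*}(W)}$, i.e. $\mathrm{Op}_{\sigma,T}(a)=\int_W\mathcal{W}_{\sigma,T}(\xi)\mathcal{F}_{\sigma}(a)(\xi)\,\mathrm{d}^{\sigma}\xi$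 weakly. *)

theory Defs
  imports "HOL-Analysis.Analysis"
begin

section \<open>Complex Hilbert spaces and unitary operators\<close>

text \<open>The inner product is antilinear in the first and linear in the second variable.  As
  \<^class>\<open>banach\<close> does not exclude the trivial space, \<open>{0}\<close> is an instance.\<close>

class complex_hilbert = banach +
  fixes scaleC :: "complex \<Rightarrow> 'a \<Rightarrow> 'a"  (infixr "*\<^sub>C" 75)
    and cinner :: "'a \<Rightarrow> 'a \<Rightarrow> complex"
  assumes scaleR_scaleC: "r *\<^sub>R x = complex_of_real r *\<^sub>C x"
    and scaleC_add_right: "a *\<^sub>C (x + y) = a *\<^sub>C x + a *\<^sub>C y"
    and scaleC_add_left: "(a + b) *\<^sub>C x = a *\<^sub>C x + b *\<^sub>C x"
    and scaleC_scaleC: "a *\<^sub>C b *\<^sub>C x = (a * b) *\<^sub>C x"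
    and cinner_commute: "cinner x y = cnj (cinner y x)"
    and cinner_add_right: "cinner x (y + z) = cinner x y + cinner x z"
    and cinner_scaleC_right: "cinner x (a *\<^sub>C y) = a * cinner x y"
    and cinner_self: "cinner x x = complex_of_real ((norm x)\<^sup>2)"

instantiation complex :: complex_hilbert
begin

definition scaleC_complex :: "complex \<Rightarrow> complex \<Rightarrow> complex"
  where "scaleC_complex a x = a * x"

definition cinner_complex :: "complex \<Rightarrow> complex \<Rightarrow> complex"
  where "cinner_complex x y = cnj x * y"

instance
proof
  fix x :: complex
  show "cinner x x = complex_of_real ((norm x)\<^sup>2)"
    unfolding cinner_complex_def by (metis complex_norm_square mult.commute of_real_power)
qed (simp_all add: scaleC_complex_def cinner_complex_def scaleR_conv_of_real algebra_simps)

end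

definition clinear_map :: "('h::complex_hilbert \<Rightarrow> 'h) \<Rightarrow> bool"
  where "clinear_map A \<longleftrightarrow>
    (\<forall>x y. A (x + y) = A x + A y) \<and> (\<forall>a x. A (a *\<^sub>C x) = a *\<^sub>C A x)"

definition unitary_map :: "('h::complex_hilbert \<Rightarrow> 'h) \<Rightarrow> bool"
  where "unitary_map A \<longleftrightarrow>
    clinear_map A \<and> surj A \<and> (\<forall>x y. cinner (A x) (A y) = cinner x y)"

definition hilbert_adjoint :: "('h::complex_hilbert \<Rightarrow> 'h) \<Rightarrow> 'h \<Rightarrow> 'h"
  where "hilbert_adjoint A = (THE B. \<forall>x y. cinner (B x) y = cinner x (A y))"


section \<open>Smooth functions and locally convex topologies\<close>

text \<open>\<open>dir_derivs [u, v, \<dots>, w] f\<close> is the iterated directional derivative of \<open>f\<close> along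
  \<open>u, v, \<dots>, w\<close>, outermost first.  On a finite-dimensional domain \<open>f\<close> is infinitely often
  continuously differentiable iff all its iterated directional derivatives are (Frechet)
  differentiable everywhere.\<close>

definition dir_derivs ::
    "'w::real_normed_vector list \<Rightarrow> ('w \<Rightarrow> 'a::real_normed_vector) \<Rightarrow> 'w \<Rightarrow> 'a"
  where "dir_derivs vs f = foldr (\<lambda>v g x. frechet_derivative g (at x) v) vs f"

definition smooth :: "('w::euclidean_space \<Rightarrow> 'a::real_normed_vector) \<Rightarrow> bool"
  where "smooth f \<longleftrightarrow> (\<forall>vs x. dir_derivs vs f differentiable (at x))"

text \<open>The topology on \<open>V\<close> generated by the balls of a family \<open>P\<close> of seminorms.\<close>

definition seminorm_topology :: "'v::minus set \<Rightarrow> ('v \<Rightarrow> real) set \<Rightarrow> 'v topology"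
  where "seminorm_topology V P =
    topology_generated_by {{y \<in> V. p (y - x) < e} | p x e. p \<in> P \<and> x \<in> V \<and> 0 < e}"


section \<open>Schwartz functions and tempered distributions\<close>

definition schwartz :: "('w::euclidean_space \<Rightarrow> complex) set"
  where "schwartz = {f. smooth f \<and>
    (\<forall>N vs. bounded (range (\<lambda>x. (1 + norm x) ^ N *\<^sub>R dir_derivs vs f x)))}"

definition schwartz_seminorm :: "nat \<Rightarrow> 'w::euclidean_space list \<Rightarrow> ('w \<Rightarrow> complex) \<Rightarrow> real"
  where "schwartz_seminorm N vs f = (SUP x. (1 + norm x) ^ N * norm (dir_derivs vs f x))"

definition schwartz_topology :: "('w::euclidean_space \<Rightarrow> complex) topology"
  where "schwartz_topology =
    seminorm_topology schwartz {schwartz_seminorm N vs | N vs. True}"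

text \<open>Continuous antilinear functionals on the Schwartz space.  The antiduality pairing of
  \<open>\<phi>\<close> with \<open>u\<close> is \<open>u \<phi>\<close>; values of \<open>u\<close> outside of the Schwartz space carry no meaning.\<close>

definition tempered :: "(('w::euclidean_space \<Rightarrow> complex) \<Rightarrow> complex) set"
  where "tempered = {u.
    (\<forall>f\<in>schwartz. \<forall>g\<in>schwartz. u (\<lambda>x. f x + g x) = u f + u g) \<and>
    (\<forall>a. \<forall>f\<in>schwartz. u (\<lambda>x. a * f x) = cnj a * u f) \<and>
    continuous_map schwartz_topology euclidean u}"

definition Cpol :: "('w::euclidean_space \<Rightarrow> complex) set"
  where "Cpol = {h. smooth h \<and>
    (\<forall>vs. \<exists>C N. \<forall>x. norm (dir_derivs vs h x) \<le> C * (1 + norm x) ^ N)}"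


section \<open>Symplectic spaces and the symplectic Fourier transformation\<close>

definition symplectic_form :: "('w::euclidean_space \<Rightarrow> 'w \<Rightarrow> real) \<Rightarrow> bool"
  where "symplectic_form \<sigma> \<longleftrightarrow> bilinear \<sigma> \<and> (\<forall>x y. \<sigma> x y = - \<sigma> y x) \<and>
    (\<forall>x. (\<forall>y. \<sigma> x y = 0) \<longrightarrow> x = 0)"

definition symp_adjoint :: "('w::euclidean_space \<Rightarrow> 'w \<Rightarrow> real) \<Rightarrow> ('w \<Rightarrow> 'w) \<Rightarrow> 'w \<Rightarrow> 'w"
  where "symp_adjoint \<sigma> T = (THE T'. linear T' \<and> (\<forall>x y. \<sigma> (T' x) y = \<sigma> x (T y)))"

definition sym_part :: "('w::euclidean_space \<Rightarrow> 'w \<Rightarrow> real) \<Rightarrow> ('w \<Rightarrow> 'w) \<Rightarrow> 'w \<Rightarrow> 'w"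
  where "sym_part \<sigma> T x = T x + symp_adjoint \<sigma> T x"

definition haar_measure :: "'w::euclidean_space measure \<Rightarrow> bool"
  where "haar_measure \<mu> \<longleftrightarrow> sets \<mu> = sets borel \<and> emeasure \<mu> UNIV \<noteq> 0 \<and>
    (\<forall>K. compact K \<longrightarrow> emeasure \<mu> K < \<infinity>) \<and> (\<forall>x. distr \<mu> borel (\<lambda>y. x + y) = \<mu>)"

definition fourier_wrt ::
    "'w::euclidean_space measure \<Rightarrow> ('w \<Rightarrow> 'w \<Rightarrow> real) \<Rightarrow> ('w \<Rightarrow> complex) \<Rightarrow> 'w \<Rightarrow> complex"
  where "fourier_wrt \<mu> \<sigma> a x = (\<integral>y. exp (- \<i> * complex_of_real (\<sigma> x y)) * a y \<partial>\<mu>)"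

text \<open>The Haar measure for which the symplectic Fourier transformation is involutive and unitary.
  The integral does not converge on all of \<open>L\<^sup>2\<close>; there the transformation is the continuous
  extension from the dense subspace of Schwartz functions, so the requirement is imposed on that
  subspace.\<close>

definition dsigma :: "('w::euclidean_space \<Rightarrow> 'w \<Rightarrow> real) \<Rightarrow> 'w measure"
  where "dsigma \<sigma> = (THE \<mu>. haar_measure \<mu> \<and>
    (\<forall>a\<in>schwartz. fourier_wrt \<mu> \<sigma> (fourier_wrt \<mu> \<sigma> a) = a \<and>
      (\<integral>x. (norm (fourier_wrt \<mu> \<sigma> a x))\<^sup>2 \<partial>\<mu>) = (\<integral>x. (norm (a x))\<^sup>2 \<partial>\<mu>)))"

definition fourier :: "('w::euclidean_space \<Rightarrow> 'w \<Rightarrow> real) \<Rightarrow> ('w \<Rightarrow> complex) \<Rightarrow> 'w \<Rightarrow> complex"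
  where "fourier \<sigma> = fourier_wrt (dsigma \<sigma>) \<sigma>"

definition func_dist ::
    "('w::euclidean_space \<Rightarrow> 'w \<Rightarrow> real) \<Rightarrow> ('w \<Rightarrow> complex) \<Rightarrow> ('w \<Rightarrow> complex) \<Rightarrow> complex"
  where "func_dist \<sigma> u \<phi> = (\<integral>x. cnj (\<phi> x) * u x \<partial>dsigma \<sigma>)"

text \<open>A function belongs to \<open>S\<^sup>*(W)\<close> if its pairing with Schwartz functions converges absolutely
  and is a tempered distribution.\<close>

definition tempered_function ::
    "('w::euclidean_space \<Rightarrow> 'w \<Rightarrow> real) \<Rightarrow> ('w \<Rightarrow> complex) \<Rightarrow> bool"
  where "tempered_function \<sigma> u \<longleftrightarrow>
    (\<forall>\<phi>\<in>schwartz. integrable (dsigma \<sigma>) (\<lambda>x. cnj (\<phi> x) * u x)) \<and> func_dist \<sigma> u \<in> tempered"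

text \<open>On \<open>L\<^sup>2\<close> the symplectic Fourier transformation is unitary and involutive, hence self-adjoint,
  so its extension to distributions is its transpose for the antiduality; likewise, the transpose
  of multiplication by \<open>h\<close> is multiplication by its complex conjugate.\<close>

definition fourier_dist ::
    "('w::euclidean_space \<Rightarrow> 'w \<Rightarrow> real) \<Rightarrow> (('w \<Rightarrow> complex) \<Rightarrow> complex) \<Rightarrow> ('w \<Rightarrow> complex) \<Rightarrow> complex"
  where "fourier_dist \<sigma> u \<phi> = u (fourier \<sigma> \<phi>)"

definition mult_dist ::
    "('w::euclidean_space \<Rightarrow> complex) \<Rightarrow> (('w \<Rightarrow> complex) \<Rightarrow> complex) \<Rightarrow> ('w \<Rightarrow> complex) \<Rightarrow> complex"
  where "mult_dist h u \<phi> = u (\<lambda>x. cnj (h x) * \<phi> x)"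

definition fourier_multiplier ::
    "('w::euclidean_space \<Rightarrow> 'w \<Rightarrow> real) \<Rightarrow> ('w \<Rightarrow> complex) \<Rightarrow>
      (('w \<Rightarrow> complex) \<Rightarrow> complex) \<Rightarrow> ('w \<Rightarrow> complex) \<Rightarrow> complex"
  where "fourier_multiplier \<sigma> h u = fourier_dist \<sigma> (mult_dist h (fourier_dist \<sigma> u))"

definition conv ::
    "('w::euclidean_space \<Rightarrow> 'w \<Rightarrow> real) \<Rightarrow> ('w \<Rightarrow> complex) \<Rightarrow> ('w \<Rightarrow> complex) \<Rightarrow> 'w \<Rightarrow> complex"
  where "conv \<sigma> b c x = (\<integral>y. b (x - y) * c y \<partial>dsigma \<sigma>)"

definition conv_dist ::
    "('w::euclidean_space \<Rightarrow> complex) \<Rightarrow> (('w \<Rightarrow> complex) \<Rightarrow> complex) \<Rightarrow> 'w \<Rightarrow> complex"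
  where "conv_dist b c x = c (\<lambda>y. cnj (b (x - y)))"

definition Lspace ::
    "('w::euclidean_space \<Rightarrow> 'w \<Rightarrow> real) \<Rightarrow> ennreal \<Rightarrow> ('w \<Rightarrow> complex) set"
  where "Lspace \<sigma> p = {f \<in> borel_measurable (dsigma \<sigma>).
    if p = \<infinity> then \<exists>C. AE x in dsigma \<sigma>. norm (f x) \<le> C
    else integrable (dsigma \<sigma>) (\<lambda>x. norm (f x) powr enn2real p)}"


section \<open>Representations and their smooth vectors\<close>

definition omega_representation ::
    "('w::euclidean_space \<Rightarrow> 'w \<Rightarrow> real) \<Rightarrow> ('w \<Rightarrow> 'w) \<Rightarrow> ('w \<Rightarrow> 'h::complex_hilbert \<Rightarrow> 'h) \<Rightarrow> bool"
  where "omega_representation \<sigma> T W \<longleftrightarrow>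
    (\<forall>x. unitary_map (W x)) \<and> (\<forall>v. continuous_on UNIV (\<lambda>x. W x v)) \<and>
    (\<forall>x y v. W x (W y v) = exp (\<i> * complex_of_real (\<sigma> x (T y))) *\<^sub>C W (x + y) v)"

definition W_tilde ::
    "('w::euclidean_space \<Rightarrow> 'w \<Rightarrow> real) \<Rightarrow> ('w \<Rightarrow> 'w) \<Rightarrow> ('w \<Rightarrow> 'h::complex_hilbert \<Rightarrow> 'h) \<Rightarrow>
      'w \<Rightarrow> 'h \<Rightarrow> 'h"
  where "W_tilde \<sigma> T W x v = exp (\<i> / 2 * complex_of_real (\<sigma> x (T x))) *\<^sub>C W x v"

definition U_rep ::
    "('w::euclidean_space \<Rightarrow> 'w \<Rightarrow> real) \<Rightarrow> ('w \<Rightarrow> 'w) \<Rightarrow> ('w \<Rightarrow> 'h::complex_hilbert \<Rightarrow> 'h) \<Rightarrow>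
      'w \<Rightarrow> 'h \<Rightarrow> 'h"
  where "U_rep \<sigma> T W x = W_tilde \<sigma> T W (inv (sym_part \<sigma> T) x)"

definition smooth_vectors :: "('w::euclidean_space \<Rightarrow> 'h::complex_hilbert \<Rightarrow> 'h) \<Rightarrow> 'h set"
  where "smooth_vectors W = {v. smooth (\<lambda>x. W x v)}"

text \<open>The self-adjoint generator of the unitary group \<open>t \<mapsto> W_tilde (t x)\<close> (Stone's theorem);
  only its values on its domain, which contains the smooth vectors, are relevant.\<close>

definition field_op ::
    "('w::euclidean_space \<Rightarrow> 'w \<Rightarrow> real) \<Rightarrow> ('w \<Rightarrow> 'w) \<Rightarrow> ('w \<Rightarrow> 'h::complex_hilbert \<Rightarrow> 'h) \<Rightarrow>
      'w \<Rightarrow> 'h \<Rightarrow> 'h"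
  where "field_op \<sigma> T W x v =
    (- \<i>) *\<^sub>C vector_derivative (\<lambda>t. W_tilde \<sigma> T W (t *\<^sub>R x) v) (at 0)"

definition smooth_seminorm ::
    "('w::euclidean_space \<Rightarrow> 'w \<Rightarrow> real) \<Rightarrow> ('w \<Rightarrow> 'w) \<Rightarrow> ('w \<Rightarrow> 'h::complex_hilbert \<Rightarrow> 'h) \<Rightarrow>
      'w list \<Rightarrow> 'h \<Rightarrow> real"
  where "smooth_seminorm \<sigma> T W xs v = norm (foldr (field_op \<sigma> T W) xs v)"

definition smooth_topology ::
    "('w::euclidean_space \<Rightarrow> 'w \<Rightarrow> real) \<Rightarrow> ('w \<Rightarrow> 'w) \<Rightarrow> ('w \<Rightarrow> 'h::complex_hilbert \<Rightarrow> 'h) \<Rightarrow>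
      'h topology"
  where "smooth_topology \<sigma> T W =
    seminorm_topology (smooth_vectors W) (range (smooth_seminorm \<sigma> T W))"

text \<open>Continuous antilinear functionals on the smooth vectors; \<open>v\<close> in the Hilbert space is
  identified with \<open>\<lambda>\<phi>. cinner \<phi> v\<close>, and the pairing of \<open>\<phi>\<close> with \<open>f\<close> is \<open>f \<phi>\<close>.\<close>

definition smooth_antidual ::
    "('w::euclidean_space \<Rightarrow> 'w \<Rightarrow> real) \<Rightarrow> ('w \<Rightarrow> 'w) \<Rightarrow> ('w \<Rightarrow> 'h::complex_hilbert \<Rightarrow> 'h) \<Rightarrow>
      ('h \<Rightarrow> complex) set"
  where "smooth_antidual \<sigma> T W = {f.
    (\<forall>u\<in>smooth_vectors W. \<forall>v\<in>smooth_vectors W. f (u + v) = f u + f v) \<and>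
    (\<forall>a. \<forall>v\<in>smooth_vectors W. f (a *\<^sub>C v) = cnj a * f v) \<and>
    continuous_map (smooth_topology \<sigma> T W) euclidean f}"

text \<open>Linear operators from the smooth vectors to their antidual: \<open>A \<psi> \<phi>\<close> is the matrix element
  \<open>\<langle>\<phi>, A \<psi>\<rangle>\<close>.  Two operators are equal if their matrix elements agree for all smooth \<open>\<phi>\<close>, \<open>\<psi>\<close>.\<close>

definition smooth_operators ::
    "('w::euclidean_space \<Rightarrow> 'w \<Rightarrow> real) \<Rightarrow> ('w \<Rightarrow> 'w) \<Rightarrow> ('w \<Rightarrow> 'h::complex_hilbert \<Rightarrow> 'h) \<Rightarrow>
      ('h \<Rightarrow> 'h \<Rightarrow> complex) set"
  where "smooth_operators \<sigma> T W = {A.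
    (\<forall>\<psi>\<in>smooth_vectors W. A \<psi> \<in> smooth_antidual \<sigma> T W) \<and>
    (\<forall>\<psi>\<in>smooth_vectors W. \<forall>\<psi>'\<in>smooth_vectors W. \<forall>\<phi>\<in>smooth_vectors W.
      A (\<psi> + \<psi>') \<phi> = A \<psi> \<phi> + A \<psi>' \<phi>) \<and>
    (\<forall>a. \<forall>\<psi>\<in>smooth_vectors W. \<forall>\<phi>\<in>smooth_vectors W. A (a *\<^sub>C \<psi>) \<phi> = a * A \<psi> \<phi>)}"

text \<open>\<open>A\<close> is the weakly absolutely convergent integral of \<open>F\<close>.\<close>

definition has_weak_integral ::
    "('w::euclidean_space \<Rightarrow> 'w \<Rightarrow> real) \<Rightarrow> ('w \<Rightarrow> 'h::complex_hilbert \<Rightarrow> 'h) \<Rightarrow>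
      ('w \<Rightarrow> 'h \<Rightarrow> 'h \<Rightarrow> complex) \<Rightarrow> ('h \<Rightarrow> 'h \<Rightarrow> complex) \<Rightarrow> bool"
  where "has_weak_integral \<sigma> W F A \<longleftrightarrow>
    (\<forall>\<phi>\<in>smooth_vectors W. \<forall>\<psi>\<in>smooth_vectors W.
      integrable (dsigma \<sigma>) (\<lambda>x. F x \<psi> \<phi>) \<and> A \<psi> \<phi> = (\<integral>x. F x \<psi> \<phi> \<partial>dsigma \<sigma>))"

text \<open>\<open>A\<close> is the integral of \<open>c(x) F(x)\<close> in the sense of distributions, that is, the matrix elements
  of \<open>F\<close> are Schwartz functions and those of \<open>A\<close> are obtained by pairing them with \<open>c\<close>.\<close>

definition has_distributional_integral ::
    "('w::euclidean_space \<Rightarrow> 'h::complex_hilbert \<Rightarrow> 'h) \<Rightarrow> (('w \<Rightarrow> complex) \<Rightarrow> complex) \<Rightarrow>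
      ('w \<Rightarrow> 'h \<Rightarrow> 'h \<Rightarrow> complex) \<Rightarrow> ('h \<Rightarrow> 'h \<Rightarrow> complex) \<Rightarrow> bool"
  where "has_distributional_integral W c F A \<longleftrightarrow>
    (\<forall>\<phi>\<in>smooth_vectors W. \<forall>\<psi>\<in>smooth_vectors W.
      (\<lambda>x. cnj (F x \<psi> \<phi>)) \<in> schwartz \<and> A \<psi> \<phi> = c (\<lambda>x. cnj (F x \<psi> \<phi>)))"

definition dual_extension :: "('h::complex_hilbert \<Rightarrow> 'h) \<Rightarrow> ('h \<Rightarrow> complex) \<Rightarrow> 'h \<Rightarrow> complex"
  where "dual_extension V f \<phi> = f (hilbert_adjoint V \<phi>)"

text \<open>The translate \<open>U(x) A U(-x)\<close>.\<close>

definition translate_op ::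
    "('w::euclidean_space \<Rightarrow> 'w \<Rightarrow> real) \<Rightarrow> ('w \<Rightarrow> 'w) \<Rightarrow> ('w \<Rightarrow> 'h::complex_hilbert \<Rightarrow> 'h) \<Rightarrow>
      ('h \<Rightarrow> 'h \<Rightarrow> complex) \<Rightarrow> 'w \<Rightarrow> 'h \<Rightarrow> 'h \<Rightarrow> complex"
  where "translate_op \<sigma> T W A x \<psi> =
    dual_extension (U_rep \<sigma> T W x) (A (U_rep \<sigma> T W (- x) \<psi>))"

definition Op ::
    "('w::euclidean_space \<Rightarrow> 'w \<Rightarrow> real) \<Rightarrow> ('w \<Rightarrow> 'h::complex_hilbert \<Rightarrow> 'h) \<Rightarrow>
      (('w \<Rightarrow> complex) \<Rightarrow> complex) \<Rightarrow> 'h \<Rightarrow> 'h \<Rightarrow> complex"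
  where "Op \<sigma> W a \<psi> \<phi> = fourier_dist \<sigma> a (\<lambda>x. cnj (cinner \<phi> (W x \<psi>)))"

end

(*
Put S = T + T^sigma and beta(x,y) = sigma(x, S y).  The operators Wt(x) = exp(i sigma(x, T x)/2) W(x)
satisfy Wt(x) Wt(y) = exp(i beta(x,y)/2) Wt(x+y), whence U(x) W(y) U(-x) = exp(i sigma(x,y)) W(y).
For smooth vectors u, v let g(y) be the complex conjugate of <u, W(y) v> and G = F g its symplectic
Fourier transform.  The matrix element of Op(a) is the value of a at G, and conjugation by U(x)
multiplies g by a character, that is, it replaces G by the translate G(x + .).  Kato's identity thereby
becomes a statement about translates of one Schwartz function: in (a), a tempered distribution
commutes with the integral of G(x + .) against a Schwartz function; in (b), where the multiplier h only
replaces g by its product with the conjugate of h, it is Fubini's theorem, and Young's inequality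
provides the absolute convergence.

That g is a Schwartz function, with seminorms continuous in u, comes from the commutation relations:
differentiation of <u, Wt(.) v> and multiplication of it by a coordinate both give linear combinations
of such functions with u or v replaced by its image under a field operator.
*)
theory Submission
  imports Defs "HOL-Probability.Characteristic_Functions" "HOL-Probability.Sinc_Integral"
begin

text \<open>\<open>dsigma\<close> is a definite description, so the normalised measure has to be
  shown to exist and to be unique: every Haar measure is a multiple of Lebesgue measure, the twofold
  transform with respect to the latter is a constant C times the identity, and rescaling gives the
  density 1 / sqrt C. C is never computed; its positivity is enough.

  Matrix coefficients decay because a displacement by t y can be split off W(x + t y) on either
  side. The two formulas for the same derivative differ in the sign of the phase term; combined,
  they separate differentiation from multiplication by beta(x,y), and as S is bijective every
  coordinate is of the form beta(.,y).

  In (a) the obstacle is to pull the functional out of an integral of functions. It is controlled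
  only by finitely many seminorms, so the integral is replaced by finite sums that converge in each
  of them.

  In (b) Young's inequality is needed pointwise: the integral defining the convolution is bounded by
  D * s(x)^rho with s positive and integrable and rho = 1/r. This form treats all exponents alike, r
  infinite being rho = 0.\<close>

section \<open>Families of seminorms\<close>

text \<open>The index \<open>i\<close> lets one constant serve a family of quantities: with weighted derivatives of
  \<open>K v\<close> indexed by points, domination says at once that \<open>K v\<close> is a Schwartz function and that it
  depends continuously on \<open>v\<close>.\<close>

definition dominated :: "'v set \<Rightarrow> ('v \<Rightarrow> real) set \<Rightarrow> ('v \<Rightarrow> 'i \<Rightarrow> real) \<Rightarrow> bool"
  where "dominated V P q \<longleftrightarrow> (\<exists>C X. 0 \<le> C \<and> finite X \<and> X \<subseteq> P \<and>
    (\<forall>p\<in>X. \<forall>v\<in>V. 0 \<le> p v) \<and> (\<forall>v\<in>V. \<forall>i. q v i \<le> C * (\<Sum>p\<in>X. p v)))"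

lemma dominatedI:
  assumes "0 \<le> C" "finite X" "X \<subseteq> P" "\<And>p v. p \<in> X \<Longrightarrow> v \<in> V \<Longrightarrow> 0 \<le> p v"
    and "\<And>v i. v \<in> V \<Longrightarrow> q v i \<le> C * (\<Sum>p\<in>X. p v)"
  shows "dominated V P q"
  unfolding dominated_def using assms by (intro exI[of _ C] exI[of _ X]) simp

lemma dominatedE:
  assumes "dominated V P q"
  obtains C X where "0 \<le> C" "finite X" "X \<subseteq> P" "\<And>p v. p \<in> X \<Longrightarrow> v \<in> V \<Longrightarrow> 0 \<le> p v"
    "\<And>v i. v \<in> V \<Longrightarrow> q v i \<le> C * (\<Sum>p\<in>X. p v)"
  using assms unfolding dominated_def by metis

text \<open>The witness \<open>j\<close> may depend on \<open>v\<close> and \<open>i\<close>, so an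
  unindexed bound can be passed on to an indexed family, for instance to all points of the domain at
  once.\<close>

lemma dominated_mono:
  assumes "dominated V P q" "\<And>v i. v \<in> V \<Longrightarrow> \<exists>j. q' v i \<le> q v j"
  shows "dominated V P q'"
  using assms(1)
proof (rule dominatedE)
  fix C X assume X: "0 \<le> C" "finite X" "X \<subseteq> P" "\<And>p v. p \<in> X \<Longrightarrow> v \<in> V \<Longrightarrow> 0 \<le> p v"
    and le: "\<And>v i. v \<in> V \<Longrightarrow> q v i \<le> C * (\<Sum>p\<in>X. p v)"
  show ?thesis
  proof (rule dominatedI[OF X(1-3)])
    fix v i assume "v \<in> V"
    then show "q' v i \<le> C * (\<Sum>p\<in>X. p v)"
      using assms(2)[of v i] le[of v] by (meson order_trans)
  qed (rule X(4))
qed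

lemma dominated_base:
  assumes "p \<in> P" "\<And>v. v \<in> V \<Longrightarrow> 0 \<le> p v"
  shows "dominated V P (\<lambda>v i. p v)"
  by (rule dominatedI[of 1 "{p}"]) (use assms in auto)

lemma dominated_zero: "dominated V P (\<lambda>v i. 0)"
  by (rule dominatedI[of 0 "{}"]) auto

lemma dominated_add:
  assumes "dominated V P q" "dominated V P q'"
  shows "dominated V P (\<lambda>v i. q v i + q' v i)"
  using assms(1)
proof (rule dominatedE)
  fix C X assume X: "0 \<le> C" "finite X" "X \<subseteq> P" "\<And>p v. p \<in> X \<Longrightarrow> v \<in> V \<Longrightarrow> 0 \<le> p v"
    and le: "\<And>v i. v \<in> V \<Longrightarrow> q v i \<le> C * (\<Sum>p\<in>X. p v)"
  from assms(2) show ?thesis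
  proof (rule dominatedE)
    fix D Y assume Y: "0 \<le> D" "finite Y" "Y \<subseteq> P" "\<And>p v. p \<in> Y \<Longrightarrow> v \<in> V \<Longrightarrow> 0 \<le> p v"
      and le': "\<And>v i. v \<in> V \<Longrightarrow> q' v i \<le> D * (\<Sum>p\<in>Y. p v)"
    show ?thesis
    proof (rule dominatedI[of "C + D" "X \<union> Y"])
      fix v i assume v: "v \<in> V"
      have "(\<Sum>p\<in>X. p v) \<le> (\<Sum>p\<in>X \<union> Y. p v)" "(\<Sum>p\<in>Y. p v) \<le> (\<Sum>p\<in>X \<union> Y. p v)"
        using X Y v by (auto intro!: sum_mono2)
      then have "C * (\<Sum>p\<in>X. p v) + D * (\<Sum>p\<in>Y. p v) \<le> (C + D) * (\<Sum>p\<in>X \<union> Y. p v)"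
        using X(1) Y(1) by (simp add: distrib_right add_mono mult_left_mono)
      then show "q v i + q' v i \<le> (C + D) * (\<Sum>p\<in>X \<union> Y. p v)"
        using le[OF v, of i] le'[OF v, of i] by linarith
    qed (use X Y in auto)
  qed
qed

lemma dominated_cmult:
  assumes "dominated V P q" "0 \<le> c"
  shows "dominated V P (\<lambda>v i. c * q v i)"
  using assms(1)
proof (rule dominatedE)
  fix C X assume X: "0 \<le> C" "finite X" "X \<subseteq> P" "\<And>p v. p \<in> X \<Longrightarrow> v \<in> V \<Longrightarrow> 0 \<le> p v"
    and le: "\<And>v i. v \<in> V \<Longrightarrow> q v i \<le> C * (\<Sum>p\<in>X. p v)"
  show ?thesis
    by (rule dominatedI[of "c * C" X])
      (use X le assms(2) in \<open>auto simp: mult.assoc intro: mult_left_mono\<close>)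
qed

lemma dominated_sum:
  assumes "finite I" "\<And>k. k \<in> I \<Longrightarrow> dominated V P (q k)"
  shows "dominated V P (\<lambda>v i. \<Sum>k\<in>I. q k v i)"
  using assms
proof (induction I rule: finite_induct)
  case empty
  then show ?case using dominated_zero by simp
next
  case (insert k I)
  then have "dominated V P (\<lambda>v i. q k v i + (\<Sum>k\<in>I. q k v i))"
    by (intro dominated_add) simp_all
  then show ?case using insert by simp
qed

text \<open>Only finitely many seminorms of the target occur in a domination, so substituting a
  bound for each of them costs a finite sum. Continuity of a composition is obtained in this way
  without touching the topologies.\<close>

lemma dominated_compose:
  assumes "dominated V' P' q" "\<And>v. v \<in> V \<Longrightarrow> L v \<in> V'"
    and "\<And>p. p \<in> P' \<Longrightarrow> dominated V P (\<lambda>v (i::unit). p (L v))"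
  shows "dominated V P (\<lambda>v i. q (L v) i)"
  using assms(1)
proof (rule dominatedE)
  fix C X assume X: "0 \<le> C" "finite X" "X \<subseteq> P'" "\<And>p v. p \<in> X \<Longrightarrow> v \<in> V' \<Longrightarrow> 0 \<le> p v"
    and le: "\<And>v i. v \<in> V' \<Longrightarrow> q v i \<le> C * (\<Sum>p\<in>X. p v)"
  have "dominated V P (\<lambda>v (i::unit). C * (\<Sum>p\<in>X. p (L v)))"
    using X assms(3) by (intro dominated_cmult dominated_sum) auto
  then show ?thesis
    by (rule dominated_mono) (simp add: le assms(2))
qed

text \<open>The balls, with arbitrary centres, are only a subbasis. The triangle inequality
  recentres a ball at \<open>x\<close>; an intersection is handled by the union of the two finite
  sets of seminorms and the smaller radius.\<close>

lemma seminorm_topology_nhd: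
  assumes "openin (seminorm_topology V P) U" "x \<in> U" "x \<in> V"
    and tri: "\<And>p x y z. p \<in> P \<Longrightarrow> x \<in> V \<Longrightarrow> y \<in> V \<Longrightarrow> z \<in> V \<Longrightarrow> p (x - z) \<le> p (x - y) + p (y - z)"
  shows "\<exists>X e. finite X \<and> X \<subseteq> P \<and> 0 < e \<and> (\<forall>y\<in>V. (\<forall>p\<in>X. p (y - x) < e) \<longrightarrow> y \<in> U)"
proof -
  let ?S = "{{y \<in> V. p (y - x) < e} | p x e. p \<in> P \<and> x \<in> V \<and> 0 < e}"
  have "generate_topology_on ?S U"
    using assms(1) unfolding seminorm_topology_def by (rule openin_topology_generated_by)
  then have "x \<in> U \<longrightarrow> (\<exists>X e. finite X \<and> X \<subseteq> P \<and> 0 < e \<and> (\<forall>y\<in>V. (\<forall>p\<in>X. p (y - x) < e) \<longrightarrow> y \<in> U))"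
  proof induction
    case Empty
    then show ?case by simp
  next
    case (Int a b)
    show ?case
    proof
      assume "x \<in> a \<inter> b"
      with Int obtain X e Y d where X: "finite X" "X \<subseteq> P" "(0::real) < e" "\<forall>y\<in>V. (\<forall>p\<in>X. p (y - x) < e) \<longrightarrow> y \<in> a"
        and Y: "finite Y" "Y \<subseteq> P" "(0::real) < d" "\<forall>y\<in>V. (\<forall>p\<in>Y. p (y - x) < d) \<longrightarrow> y \<in> b"
        by auto
      show "\<exists>X e. finite X \<and> X \<subseteq> P \<and> 0 < e \<and> (\<forall>y\<in>V. (\<forall>p\<in>X. p (y - x) < e) \<longrightarrow> y \<in> a \<inter> b)"
        by (rule exI[of _ "X \<union> Y"], rule exI[of _ "min e d"]) (use X Y in auto)
    qed
  next
    case (UN K)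
    show ?case
    proof
      assume "x \<in> \<Union>K"
      then obtain k where k: "k \<in> K" "x \<in> k" by blast
      from UN.IH[OF k(1)] k(2) obtain X e where X: "finite X" "X \<subseteq> P" "(0::real) < e"
        "\<forall>y\<in>V. (\<forall>p\<in>X. p (y - x) < e) \<longrightarrow> y \<in> k" by auto
      show "\<exists>X e. finite X \<and> X \<subseteq> P \<and> 0 < e \<and> (\<forall>y\<in>V. (\<forall>p\<in>X. p (y - x) < e) \<longrightarrow> y \<in> \<Union>K)"
        by (rule exI[of _ X], rule exI[of _ e]) (use X k in auto)
    qed
  next
    case (Basis s)
    then obtain p z e where s: "s = {y \<in> V. p (y - z) < e}" "p \<in> P" "z \<in> V" "0 < e" by auto
    show ?case
    proof
      assume "x \<in> s"
      show "\<exists>X e. finite X \<and> X \<subseteq> P \<and> 0 < e \<and> (\<forall>y\<in>V. (\<forall>p\<in>X. p (y - x) < e) \<longrightarrow> y \<in> s)"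
      \<comment> \<open>What is left of the radius after the centre has moved from \<open>z\<close>
        to \<open>x\<close>.\<close>
      proof (intro exI[of _ "{p}"] exI[of _ "e - p (x - z)"] conjI ballI impI)
        fix y assume y: "y \<in> V" "\<forall>q\<in>{p}. q (y - x) < e - p (x - z)"
        then show "y \<in> s"
          using tri[OF s(2) y(1) assms(3) s(3)] s by auto
      qed (use \<open>x \<in> s\<close> s in auto)
    qed
  qed
  then show ?thesis using assms(2) by simp
qed

text \<open>A bound on \<open>f\<close> applied to differences gives continuity at every point. With
  no seminorm there would be no ball, and the topspace would be empty instead of \<open>V\<close>;
  hence the condition on \<open>P\<close>.\<close>

lemma continuous_map_seminorm_topology:
  fixes f :: "'v::minus \<Rightarrow> complex"
  assumes diff: "\<And>x y. x \<in> V \<Longrightarrow> y \<in> V \<Longrightarrow> x - y \<in> V" "\<And>x y. x \<in> V \<Longrightarrow> y \<in> V \<Longrightarrow> f (x - y) = f x - f y"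
    and zero: "\<And>p x. p \<in> P \<Longrightarrow> x \<in> V \<Longrightarrow> p (x - x) = 0" and "P \<noteq> {}"
    and dom: "dominated V P (\<lambda>v (i::unit). norm (f v))"
  shows "continuous_map (seminorm_topology V P) euclidean f"
proof -
  obtain C X where X: "0 \<le> C" "finite X" "X \<subseteq> P" "\<And>p v. p \<in> X \<Longrightarrow> v \<in> V \<Longrightarrow> 0 \<le> p v"
    and le: "\<And>v. v \<in> V \<Longrightarrow> norm (f v) \<le> C * (\<Sum>p\<in>X. p v)"
    using dom unfolding dominated_def by auto
  let ?S = "{{y \<in> V. p (y - x) < e} | p x e. p \<in> P \<and> x \<in> V \<and> 0 < e}"
  obtain p0 where p0: "p0 \<in> P" using assms by blast
  have ts: "topspace (seminorm_topology V P) = V"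
    unfolding seminorm_topology_def topology_generated_by_topspace
  proof (intro equalityI subsetI)
    fix x assume "x \<in> V"
    then have "x \<in> {y \<in> V. p0 (y - x) < 1}" "{y \<in> V. p0 (y - x) < 1} \<in> ?S"
      using zero[OF p0] p0 by (auto intro!: exI[of _ p0] exI[of _ x] exI[of _ "1::real"])
    then show "x \<in> \<Union>?S" by (rule UnionI[rotated])
  qed auto
  have ball: "openin (seminorm_topology V P) {y \<in> V. p (y - x) < e}" if "p \<in> P" "x \<in> V" "0 < e" for p x e
    unfolding seminorm_topology_def using that by (intro topology_generated_by_Basis) blast
  have "openin (seminorm_topology V P) {x \<in> V. f x \<in> U}" if U: "open U" for U
  proof (subst openin_subopen, safe)
    fix x assume x: "x \<in> V" "f x \<in> U"
    obtain e where e: "0 < e" "\<And>w. dist w (f x) < e \<Longrightarrow> w \<in> U"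
      using U x(2) unfolding open_dist by blast
    \<comment> \<open>The summand 1 keeps the denominator positive when \<open>C\<close> or
      \<open>X\<close> is trivial and makes the final inequality strict.\<close>
    define d where "d = e / (C * card X + 1)"
    have Cp: "0 < C * card X + 1" using X(1) by (simp add: add_nonneg_pos)
    have d: "0 < d" unfolding d_def using Cp e by simp
    \<comment> \<open>Including \<open>p0\<close> keeps the family non-empty even for empty
      \<open>X\<close>, so that the intersection stays inside \<open>V\<close>.\<close>
    let ?N = "\<Inter>p\<in>insert p0 X. {y \<in> V. p (y - x) < d}"
    show "\<exists>N. openin (seminorm_topology V P) N \<and> x \<in> N \<and> N \<subseteq> {x \<in> V. f x \<in> U}"
    proof (intro exI[of _ ?N] conjI)
      show "openin (seminorm_topology V P) ?N"
        using X p0 x d by (intro openin_INT2) (auto intro!: ball)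
      have "p (x - x) < d" if "p \<in> P" for p using zero[OF that x(1)] d by simp
      then show "x \<in> ?N" using X p0 x by auto
      show "?N \<subseteq> {x \<in> V. f x \<in> U}"
      proof
        fix y assume y: "y \<in> ?N"
        then have yV: "y \<in> V" by auto
        have "norm (f y - f x) \<le> C * (\<Sum>p\<in>X. p (y - x))"
          using le[OF diff(1)[OF yV x(1)]] diff(2)[OF yV x(1)] by simp
        also have "\<dots> \<le> C * (\<Sum>p\<in>X. d)"
          using y X(1) by (intro mult_left_mono sum_mono) (auto intro: less_imp_le)
        also have "\<dots> = e * ((C * card X) / (C * card X + 1))" by (simp add: d_def)
        also have "\<dots> < e" using e(1) Cp by (simp add: field_simps)
        finally have "dist (f y) (f x) < e" by (simp add: dist_norm)
        then show "y \<in> {x \<in> V. f x \<in> U}" using e yV by auto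
      qed
    qed
  qed
  then show ?thesis
    unfolding continuous_map_def ts by simp
qed

section \<open>Calculus of directional derivatives\<close>

abbreviation dderiv :: "'w::real_normed_vector \<Rightarrow> ('w \<Rightarrow> 'a::real_normed_vector) \<Rightarrow> 'w \<Rightarrow> 'a"
  where "dderiv v f \<equiv> (\<lambda>x. frechet_derivative f (at x) v)"

lemma dir_derivs_Nil [simp]: "dir_derivs [] f = f"
  by (simp add: dir_derivs_def)

lemma dir_derivs_Cons: "dir_derivs (v # vs) f = dderiv v (dir_derivs vs f)"
  by (simp add: dir_derivs_def)

lemma dir_derivs_append: "dir_derivs (vs @ ws) f = dir_derivs vs (dir_derivs ws f)"
  by (simp add: dir_derivs_def)

text \<open>Lists are read outermost first, so the last direction acts on \<open>f\<close> itself.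
  Inductions in which differentiation changes the function therefore peel off the last
  entry.\<close>

lemma dir_derivs_snoc: "dir_derivs (vs @ [v]) f = dir_derivs vs (dderiv v f)"
  by (simp add: dir_derivs_append dir_derivs_Cons)

lemma dderiv_eqI: "(\<And>x. (f has_derivative f' x) (at x)) \<Longrightarrow> dderiv v f = (\<lambda>x. f' x v)"
  by (metis frechet_derivative_at)

lemma smooth_differentiable: "smooth f \<Longrightarrow> f differentiable (at x)"
  unfolding smooth_def by (metis dir_derivs_Nil)

lemma smooth_has_derivative: "smooth f \<Longrightarrow> (f has_derivative frechet_derivative f (at x)) (at x)"
  using smooth_differentiable frechet_derivative_works by blast

lemma smooth_dir_derivs: "smooth f \<Longrightarrow> smooth (dir_derivs vs f)"
  unfolding smooth_def by (simp flip: dir_derivs_append)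

lemma smooth_dderiv: "smooth f \<Longrightarrow> smooth (dderiv v f)"
  using smooth_dir_derivs[of f "[v]"] by (simp add: dir_derivs_Cons)

lemma smooth_continuous: "smooth f \<Longrightarrow> continuous_on A f"
  by (meson continuous_at_imp_continuous_on differentiable_imp_continuous_within smooth_differentiable)

lemma smooth_measurable: "smooth f \<Longrightarrow> f \<in> borel_measurable borel"
  by (intro borel_measurable_continuous_onI smooth_continuous)

text \<open>Coinduction: a class of differentiable functions that no directional derivative leaves
  consists of smooth functions, and no formula for iterated derivatives is required.\<close>

lemma smooth_coinduct:
  assumes "f \<in> \<C>" "\<And>g x. g \<in> \<C> \<Longrightarrow> g differentiable (at x)" "\<And>g v. g \<in> \<C> \<Longrightarrow> dderiv v g \<in> \<C>"
  shows "smooth f"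
proof -
  have "dir_derivs vs f \<in> \<C>" for vs
    by (induction vs) (use assms in \<open>auto simp: dir_derivs_Cons\<close>)
  then show ?thesis unfolding smooth_def using assms by blast
qed

lemma smooth_iff_dderiv:
  "smooth f \<longleftrightarrow> (\<forall>x. f differentiable (at x)) \<and> (\<forall>v. smooth (dderiv v f))"
proof
  assume *: "(\<forall>x. f differentiable (at x)) \<and> (\<forall>v. smooth (dderiv v f))"
  show "smooth f"
    unfolding smooth_def
  proof (intro allI)
    fix vs x show "dir_derivs vs f differentiable (at x)"
    proof (cases vs rule: rev_cases)
      case Nil then show ?thesis using * by simp
    next
      case (snoc ys y)
      then show ?thesis using * unfolding smooth_def by (simp add: dir_derivs_snoc)
    qed
  qed
qed (auto simp: smooth_differentiable smooth_dderiv)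

lemma dderiv_add:
  "(\<And>x. f differentiable (at x)) \<Longrightarrow> (\<And>x. g differentiable (at x)) \<Longrightarrow>
    dderiv v (\<lambda>x. f x + g x) = (\<lambda>x. dderiv v f x + dderiv v g x)"
  by (intro dderiv_eqI) (auto intro!: derivative_eq_intros simp: frechet_derivative_works[symmetric])

lemma dir_derivs_add:
  assumes "smooth f" "smooth g"
  shows "dir_derivs vs (\<lambda>x. f x + g x) = (\<lambda>x. dir_derivs vs f x + dir_derivs vs g x)"
  by (induction vs)
    (use assms in \<open>auto simp: dir_derivs_Cons dderiv_add smooth_dir_derivs smooth_differentiable\<close>)

lemma smooth_add:
  assumes "smooth f" "smooth g" shows "smooth (\<lambda>x. f x + g x)"
  unfolding smooth_def dir_derivs_add[OF assms]
  using assms by (auto intro!: differentiable_add simp: smooth_def)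

lemma dderiv_bounded_linear:
  assumes "bounded_linear A" "\<And>x. f differentiable (at x)"
  shows "dderiv v (\<lambda>x. A (f x)) = (\<lambda>x. A (dderiv v f x))"
  by (intro dderiv_eqI bounded_linear.has_derivative[OF assms(1)])
    (use assms frechet_derivative_works in blast)

lemma dir_derivs_bounded_linear:
  assumes "bounded_linear A" "smooth f"
  shows "dir_derivs vs (\<lambda>x. A (f x)) = (\<lambda>x. A (dir_derivs vs f x))"
proof (induction vs)
  case (Cons v vs)
  then show ?case
    using dderiv_bounded_linear[OF assms(1), of "dir_derivs vs f" v] assms(2)
    by (simp add: dir_derivs_Cons smooth_dir_derivs smooth_differentiable)
qed simp

lemma smooth_bounded_linear:
  assumes "bounded_linear A" "smooth f"
  shows "smooth (\<lambda>x. A (f x))"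
  unfolding smooth_def dir_derivs_bounded_linear[OF assms]
proof (intro allI)
  fix vs x
  show "(\<lambda>x. A (dir_derivs vs f x)) differentiable (at x)"
    using bounded_linear.has_derivative[OF assms(1) smooth_has_derivative[OF smooth_dir_derivs[OF assms(2)]]]
    unfolding differentiable_def by blast
qed

lemma smooth_const: "smooth (\<lambda>_. c)"
proof -
  have *: "dderiv v (\<lambda>_::'a. c) = (\<lambda>_. 0)" for v and c :: 'b
    by (intro dderiv_eqI) (auto intro!: derivative_eq_intros)
  show ?thesis by (rule smooth_coinduct[where \<C> = "range (\<lambda>c _. c)"]) (auto simp: *)
qed

lemma smooth_linear:
  fixes A :: "'w::euclidean_space \<Rightarrow> 'a::real_normed_vector"
  assumes "linear A" shows "smooth A"
proof -
  have bl: "bounded_linear A" using assms by (simp add: linear_conv_bounded_linear)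
  then have "dderiv v A = (\<lambda>x. A v)" for v
    by (intro dderiv_eqI bounded_linear_imp_has_derivative)
  then show ?thesis
    using bl by (subst smooth_iff_dderiv) (auto simp: smooth_const bounded_linear_imp_differentiable)
qed

text \<open>Product and chain rule produce sums, which leave a class of products. Differentiability
  and closure under \<open>dderiv\<close> pass from a class to its finite sums.\<close>

inductive_set sums_of :: "('w \<Rightarrow> 'a::plus) set \<Rightarrow> ('w \<Rightarrow> 'a) set" for \<C> where
  base: "f \<in> \<C> \<Longrightarrow> f \<in> sums_of \<C>"
| add: "f \<in> sums_of \<C> \<Longrightarrow> g \<in> sums_of \<C> \<Longrightarrow> (\<lambda>x. f x + g x) \<in> sums_of \<C>"

lemma smooth_coinduct_sums:
  assumes "f \<in> \<C>" "\<And>g x. g \<in> \<C> \<Longrightarrow> g differentiable (at x)"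
    and "\<And>g v. g \<in> \<C> \<Longrightarrow> dderiv v g \<in> sums_of \<C>"
  shows "smooth f"
proof (rule smooth_coinduct[where \<C> = "sums_of \<C>"])
  show "f \<in> sums_of \<C>" by (rule sums_of.base) fact
  show diff: "g differentiable (at x)" if "g \<in> sums_of \<C>" for g x
    using that by induction (auto intro: assms)
  show "dderiv v g \<in> sums_of \<C>" if "g \<in> sums_of \<C>" for g v
    using that
  proof induction
    case (add f g)
    then show ?case using diff by (simp add: dderiv_add sums_of.add)
  qed (rule assms)
qed

context bounded_bilinear
begin

lemma dderiv_prod:
  assumes "\<And>x. f differentiable (at x)" "\<And>x. g differentiable (at x)"
  shows "dderiv v (\<lambda>x. prod (f x) (g x)) = (\<lambda>x. prod (f x) (dderiv v g x) + prod (dderiv v f x) (g x))"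
  by (intro dderiv_eqI FDERIV) (use assms frechet_derivative_works in blast)+

lemma smooth_prod:
  fixes f :: "'e::euclidean_space \<Rightarrow> 'a"
  assumes "smooth f" "smooth g"
  shows "smooth (\<lambda>x. prod (f x) (g x))"
proof (rule smooth_coinduct_sums[where \<C> = "{\<lambda>x. prod (f x) (g x) | f g. smooth f \<and> smooth g}"])
  have mem: "(\<lambda>x. prod (f x) (g x)) \<in> {\<lambda>x. prod (f x) (g x) | f g. smooth f \<and> smooth g}"
    if "smooth f" "smooth g" for f :: "'e \<Rightarrow> 'a" and g
    using that by blast
  fix h :: "'e \<Rightarrow> 'c" and v assume "h \<in> {\<lambda>x. prod (f x) (g x) | f g. smooth f \<and> smooth g}"
  then obtain f g where h: "h = (\<lambda>x. prod (f x) (g x))" and "smooth f" "smooth g" by blast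
  then have *: "dderiv v h = (\<lambda>x. prod (f x) (dderiv v g x) + prod (dderiv v f x) (g x))" for v
    by (simp add: dderiv_prod smooth_differentiable)
  show "dderiv v h \<in> sums_of {\<lambda>x. prod (f x) (g x) | f g. smooth f \<and> smooth g}"
    unfolding * using mem[OF \<open>smooth f\<close> smooth_dderiv[OF \<open>smooth g\<close>]]
      mem[OF smooth_dderiv[OF \<open>smooth f\<close>] \<open>smooth g\<close>] by (intro sums_of.add sums_of.base)
  fix x show "h differentiable (at x)"
    unfolding h differentiable_def
    using FDERIV[OF smooth_has_derivative[OF \<open>smooth f\<close>] smooth_has_derivative[OF \<open>smooth g\<close>]] by fast
qed (use assms in blast)

end

lemmas smooth_mult = bounded_bilinear.smooth_prod[OF bounded_bilinear_mult]
lemmas dderiv_mult = bounded_bilinear.dderiv_prod[OF bounded_bilinear_mult]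

lemma has_derivative_translate:
  assumes "(f has_derivative D) (at (a + x))"
  shows "((\<lambda>y. f (a + y)) has_derivative D) (at x)"
proof -
  have "((\<lambda>y. a + y) has_derivative (\<lambda>h. h)) (at x)" by (auto intro!: derivative_eq_intros)
  from has_derivative_compose[OF this assms] show ?thesis .
qed

lemma dderiv_translate:
  assumes "\<And>x. f differentiable (at x)"
  shows "dderiv v (\<lambda>y. f (a + y)) = (\<lambda>y. dderiv v f (a + y))"
  by (intro dderiv_eqI has_derivative_translate frechet_derivative_works[THEN iffD1] assms)

lemma dir_derivs_translate:
  assumes "smooth f"
  shows "dir_derivs vs (\<lambda>y. f (a + y)) = (\<lambda>y. dir_derivs vs f (a + y))"
  by (induction vs)
    (use assms in \<open>auto simp: dir_derivs_Cons dderiv_translate smooth_dir_derivs smooth_differentiable\<close>)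

lemma smooth_translate:
  assumes "smooth f" shows "smooth (\<lambda>y. f (a + y))"
  unfolding smooth_def dir_derivs_translate[OF assms]
proof (intro allI)
  fix vs x
  show "(\<lambda>y. dir_derivs vs f (a + y)) differentiable (at x)"
    using has_derivative_translate[OF smooth_has_derivative[OF smooth_dir_derivs[OF assms]]]
    unfolding differentiable_def by blast
qed

section \<open>Schwartz functions\<close>

lemma dominated_le:
  assumes "dominated V P q" "\<And>v i. v \<in> V \<Longrightarrow> q' v i \<le> q v i"
  shows "dominated V P q'"
  by (rule dominated_mono[OF assms(1)]) (use assms(2) in blast)

definition schwartz_valued ::
    "'v set \<Rightarrow> ('v \<Rightarrow> real) set \<Rightarrow> ('v \<Rightarrow> 'w::euclidean_space \<Rightarrow> complex) \<Rightarrow> bool"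
  where "schwartz_valued V P K \<longleftrightarrow> (\<forall>v\<in>V. smooth (K v)) \<and>
    (\<forall>N vs. dominated V P (\<lambda>v x. (1 + norm x) ^ N * norm (dir_derivs vs (K v) x)))"

abbreviation schwartz_seminorms :: "(('w::euclidean_space \<Rightarrow> complex) \<Rightarrow> real) set"
  where "schwartz_seminorms \<equiv> {schwartz_seminorm N vs | N vs. True}"

lemma schwartz_smooth: "f \<in> schwartz \<Longrightarrow> smooth f"
  by (simp add: schwartz_def)

lemma schwartz_seminorm_ge:
  assumes "f \<in> schwartz"
  shows "(1 + norm x) ^ N * norm (dir_derivs vs f x) \<le> schwartz_seminorm N vs f"
proof -
  have "bounded (range (\<lambda>x. (1 + norm x) ^ N *\<^sub>R dir_derivs vs f x))"
    using assms by (simp add: schwartz_def)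
  then obtain B where "\<And>x. norm ((1 + norm x) ^ N *\<^sub>R dir_derivs vs f x) \<le> B"
    unfolding bounded_iff by auto
  then have "bdd_above (range (\<lambda>x. (1 + norm x) ^ N * norm (dir_derivs vs f x)))"
    by (intro bdd_aboveI[of _ B]) auto
  then show ?thesis
    unfolding schwartz_seminorm_def by (intro cSUP_upper) auto
qed

lemma schwartz_seminorm_le:
  "(\<And>x. (1 + norm x) ^ N * norm (dir_derivs vs f x) \<le> C) \<Longrightarrow> schwartz_seminorm N vs f \<le> C"
  unfolding schwartz_seminorm_def by (intro cSUP_least) auto

lemma schwartz_seminorm_nonneg: "f \<in> schwartz \<Longrightarrow> 0 \<le> schwartz_seminorm N vs f"
  by (rule order_trans[OF _ schwartz_seminorm_ge[of f 0]]) auto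

lemma schwartzI:
  assumes "smooth f" "\<And>N vs. \<exists>C. \<forall>x. (1 + norm x) ^ N * norm (dir_derivs vs f x) \<le> C"
  shows "f \<in> schwartz"
  unfolding schwartz_def bounded_iff using assms by auto

lemma schwartz_valued_smooth: "schwartz_valued V P K \<Longrightarrow> v \<in> V \<Longrightarrow> smooth (K v)"
  by (simp add: schwartz_valued_def)

lemma schwartz_valued_dominated:
  "schwartz_valued V P K \<Longrightarrow> dominated V P (\<lambda>v x. (1 + norm x) ^ N * norm (dir_derivs vs (K v) x))"
  by (simp add: schwartz_valued_def)

lemma schwartz_valuedI:
  "(\<And>v. v \<in> V \<Longrightarrow> smooth (K v)) \<Longrightarrow>
   (\<And>N vs. dominated V P (\<lambda>v x. (1 + norm x) ^ N * norm (dir_derivs vs (K v) x))) \<Longrightarrow>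
   schwartz_valued V P K"
  by (simp add: schwartz_valued_def)

lemma schwartz_valued_mem:
  assumes "schwartz_valued V P K" "v \<in> V"
  shows "K v \<in> schwartz"
proof (rule schwartzI)
  fix N vs
  show "\<exists>C. \<forall>x. (1 + norm x) ^ N * norm (dir_derivs vs (K v) x) \<le> C"
    using schwartz_valued_dominated[OF assms(1), of N vs] assms(2) unfolding dominated_def by blast
qed (rule schwartz_valued_smooth[OF assms])

lemma schwartz_valued_seminorm:
  assumes "schwartz_valued V P K"
  shows "dominated V P (\<lambda>v (i::unit). schwartz_seminorm N vs (K v))"
  using schwartz_valued_dominated[OF assms, of N vs]
proof (rule dominatedE)
  fix C X assume X: "0 \<le> C" "finite X" "X \<subseteq> P" "\<And>p v. p \<in> X \<Longrightarrow> v \<in> V \<Longrightarrow> 0 \<le> p v"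
    and le: "\<And>v x. v \<in> V \<Longrightarrow> (1 + norm x) ^ N * norm (dir_derivs vs (K v) x) \<le> C * (\<Sum>p\<in>X. p v)"
  show ?thesis
    by (rule dominatedI[OF X(1-3)]) (auto intro: X(4) schwartz_seminorm_le le)
qed

text \<open>A single function is a family over a one-point parameter set with the constant seminorm
  1. Each closure property is thus proved once, for families, and specialised.\<close>

lemma schwartz_iff_valued: "f \<in> schwartz \<longleftrightarrow> schwartz_valued (UNIV :: unit set) {\<lambda>_. 1} (\<lambda>_. f)"
proof
  assume f: "f \<in> schwartz"
  show "schwartz_valued (UNIV :: unit set) {\<lambda>_. 1} (\<lambda>_. f)"
  proof (rule schwartz_valuedI)
    fix N vs
    show "dominated (UNIV :: unit set) {\<lambda>_. 1} (\<lambda>_ x. (1 + norm x) ^ N * norm (dir_derivs vs f x))"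
      by (rule dominatedI[of "schwartz_seminorm N vs f" "{\<lambda>_. 1}"])
        (auto simp: f schwartz_seminorm_nonneg schwartz_seminorm_ge)
  qed (rule schwartz_smooth[OF f])
next
  assume "schwartz_valued (UNIV :: unit set) {\<lambda>_. 1} (\<lambda>_. f)"
  then show "f \<in> schwartz" by (rule schwartz_valued_mem) simp
qed

lemma schwartz_valued_add:
  assumes "schwartz_valued V P K" "schwartz_valued V P L"
  shows "schwartz_valued V P (\<lambda>v x. K v x + L v x)"
proof (rule schwartz_valuedI)
  fix N vs
  show "dominated V P (\<lambda>v x. (1 + norm x) ^ N * norm (dir_derivs vs (\<lambda>x. K v x + L v x) x))"
    by (rule dominated_le[OF dominated_add[OF schwartz_valued_dominated[OF assms(1), of N vs]
        schwartz_valued_dominated[OF assms(2), of N vs]]])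
      (use assms in \<open>auto simp: dir_derivs_add schwartz_valued_smooth norm_triangle_ineq
        simp flip: distrib_left intro!: mult_left_mono\<close>)
qed (intro smooth_add schwartz_valued_smooth[OF assms(1)] schwartz_valued_smooth[OF assms(2)])

lemma schwartz_valued_bounded_linear:
  assumes "schwartz_valued V P K" "bounded_linear A"
  shows "schwartz_valued V P (\<lambda>v x. A (K v x))"
proof (rule schwartz_valuedI)
  fix N vs
  obtain B where B: "0 \<le> B" "\<And>z. norm (A z) \<le> norm z * B"
    using bounded_linear.nonneg_bounded[OF assms(2)] by blast
  show "dominated V P (\<lambda>v x. (1 + norm x) ^ N * norm (dir_derivs vs (\<lambda>x. A (K v x)) x))"
  proof (rule dominated_le[OF dominated_cmult[OF schwartz_valued_dominated[OF assms(1), of N vs] B(1)]])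
    fix v x assume "v \<in> V"
    then have "norm (dir_derivs vs (\<lambda>x. A (K v x)) x) \<le> norm (dir_derivs vs (K v) x) * B"
      using B assms by (simp add: dir_derivs_bounded_linear schwartz_valued_smooth)
    then show "(1 + norm x) ^ N * norm (dir_derivs vs (\<lambda>x. A (K v x)) x) \<le>
        B * ((1 + norm x) ^ N * norm (dir_derivs vs (K v) x))"
      using mult_left_mono[of "norm (dir_derivs vs (\<lambda>x. A (K v x)) x)" "norm (dir_derivs vs (K v) x) * B"
        "(1 + norm x) ^ N"] by (simp add: mult_ac)
  qed
qed (intro smooth_bounded_linear[OF assms(2)] schwartz_valued_smooth[OF assms(1)])

lemma schwartz_valued_dderiv:
  assumes "schwartz_valued V P K"
  shows "schwartz_valued V P (\<lambda>v. dderiv w (K v))"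
proof (rule schwartz_valuedI)
  fix N vs
  show "dominated V P (\<lambda>v x. (1 + norm x) ^ N * norm (dir_derivs vs (dderiv w (K v)) x))"
    using schwartz_valued_dominated[OF assms, of N "vs @ [w]"] by (simp add: dir_derivs_snoc)
qed (intro smooth_dderiv schwartz_valued_smooth[OF assms])

section \<open>Functions of polynomial growth as multipliers of Schwartz functions\<close>

definition poly_bounded :: "('w::real_normed_vector \<Rightarrow> complex) \<Rightarrow> bool"
  where "poly_bounded h \<longleftrightarrow> (\<exists>C N. 0 \<le> C \<and> (\<forall>x. norm (h x) \<le> C * (1 + norm x) ^ N))"

lemma poly_boundedI: "(\<And>x. norm (h x) \<le> C * (1 + norm x) ^ N) \<Longrightarrow> poly_bounded h"
  unfolding poly_bounded_def
  by (intro exI[of _ "\<bar>C\<bar>"] exI[of _ N]) (auto intro!: order_trans[OF _ mult_right_mono[of C "\<bar>C\<bar>"]])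

lemma poly_bounded_mult:
  assumes "poly_bounded g" "poly_bounded h"
  shows "poly_bounded (\<lambda>x. g x * h x)"
proof -
  from assms obtain C N D M where "0 \<le> C" and g: "\<And>x. norm (g x) \<le> C * (1 + norm x) ^ N"
    and h: "\<And>x. norm (h x) \<le> D * (1 + norm x) ^ M" unfolding poly_bounded_def by blast
  show ?thesis
  proof (rule poly_boundedI[of _ "C * D" "N + M"])
    fix x
    have "norm (g x * h x) \<le> (C * (1 + norm x) ^ N) * (D * (1 + norm x) ^ M)"
      unfolding norm_mult using \<open>0 \<le> C\<close> by (intro mult_mono g h) auto
    then show "norm (g x * h x) \<le> C * D * (1 + norm x) ^ (N + M)" by (simp add: power_add algebra_simps)
  qed
qed

lemma poly_bounded_add:
  assumes "poly_bounded g" "poly_bounded h"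
  shows "poly_bounded (\<lambda>x. g x + h x)"
proof -
  from assms obtain C N D M where "0 \<le> C" "0 \<le> D" and g: "\<And>x. norm (g x) \<le> C * (1 + norm x) ^ N"
    and h: "\<And>x. norm (h x) \<le> D * (1 + norm x) ^ M" unfolding poly_bounded_def by blast
  show ?thesis
  proof (rule poly_boundedI[of _ "C + D" "N + M"])
    fix x
    have "norm (g x) \<le> C * (1 + norm x) ^ (N + M)" "norm (h x) \<le> D * (1 + norm x) ^ (N + M)"
      by (rule order_trans[OF g], use \<open>0 \<le> C\<close> in \<open>auto intro!: mult_left_mono power_increasing\<close>)
        (rule order_trans[OF h], use \<open>0 \<le> D\<close> in \<open>auto intro!: mult_left_mono power_increasing\<close>)
    then show "norm (g x + h x) \<le> (C + D) * (1 + norm x) ^ (N + M)"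
      by (intro norm_triangle_le) (simp add: distrib_right)
  qed
qed

lemma poly_bounded_iff: "poly_bounded h \<longleftrightarrow> (\<exists>C N. \<forall>x. norm (h x) \<le> C * (1 + norm x) ^ N)"
proof
  assume "\<exists>C N. \<forall>x. norm (h x) \<le> C * (1 + norm x) ^ N"
  then obtain C N where "\<And>x. norm (h x) \<le> C * (1 + norm x) ^ N" by blast
  then show "poly_bounded h" by (rule poly_boundedI)
qed (auto simp: poly_bounded_def)

lemma Cpol_iff: "h \<in> Cpol \<longleftrightarrow> smooth h \<and> (\<forall>vs. poly_bounded (dir_derivs vs h))"
  unfolding Cpol_def poly_bounded_iff by simp

lemma Cpol_smooth: "h \<in> Cpol \<Longrightarrow> smooth h"
  by (simp add: Cpol_iff)

lemma Cpol_poly_bounded: "h \<in> Cpol \<Longrightarrow> poly_bounded h"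
  using Cpol_iff by (metis dir_derivs_Nil)

lemma Cpol_dderiv: "h \<in> Cpol \<Longrightarrow> dderiv v h \<in> Cpol"
  unfolding Cpol_iff by (simp add: smooth_dderiv flip: dir_derivs_snoc)

lemma Cpol_coinduct_sums:
  assumes "f \<in> \<C>" "\<And>g x. g \<in> \<C> \<Longrightarrow> g differentiable (at x)"
    and "\<And>g v. g \<in> \<C> \<Longrightarrow> dderiv v g \<in> sums_of \<C>" "\<And>g. g \<in> \<C> \<Longrightarrow> poly_bounded g"
  shows "f \<in> Cpol"
  unfolding Cpol_iff
proof (intro conjI allI)
  show "smooth f" using assms(1-3) by (rule smooth_coinduct_sums)
  have diff: "g differentiable (at x)" if "g \<in> sums_of \<C>" for g x
    using that by induction (auto intro: assms(2))
  have closed: "dderiv v g \<in> sums_of \<C>" if "g \<in> sums_of \<C>" for g v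
    using that
  proof induction
    case (add f g)
    then show ?case using diff by (simp add: dderiv_add sums_of.add)
  qed (rule assms(3))
  fix vs
  have "dir_derivs vs f \<in> sums_of \<C>"
    by (induction vs) (auto simp: dir_derivs_Cons closed sums_of.base[OF assms(1)])
  then show "poly_bounded (dir_derivs vs f)"
    by induction (auto intro: assms(4) poly_bounded_add)
qed

lemma Cpol_const: "(\<lambda>_. c) \<in> Cpol"
proof (rule Cpol_coinduct_sums[where \<C> = "range (\<lambda>c _. c)"])
  fix g v assume "g \<in> range (\<lambda>c (_::'a). c::complex)"
  then obtain c where g: "g = (\<lambda>_. c)" by blast
  have "dderiv v g = (\<lambda>_. 0)" unfolding g by (intro dderiv_eqI) (auto intro!: derivative_eq_intros)
  then show "dderiv v g \<in> sums_of (range (\<lambda>c _. c))" by (auto intro!: sums_of.base)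
  show "poly_bounded g" unfolding g by (rule poly_boundedI[of _ "norm c" 0]) simp
qed auto

lemma Cpol_linear:
  fixes l :: "'w::euclidean_space \<Rightarrow> complex"
  assumes "linear l" shows "l \<in> Cpol"
  unfolding Cpol_iff
proof (intro conjI allI)
  show "smooth l" by (rule smooth_linear) fact
  have bl: "bounded_linear l" using assms by (simp add: linear_conv_bounded_linear)
  have dd: "dderiv v l = (\<lambda>x. l v)" for v
    using bl by (intro dderiv_eqI bounded_linear_imp_has_derivative)
  fix vs
  show "poly_bounded (dir_derivs vs l)"
  proof (cases vs rule: rev_cases)
    case Nil
    obtain B where "\<And>x. norm (l x) \<le> norm x * B" "0 \<le> B" using bounded_linear.nonneg_bounded[OF bl] by blast
    then have "norm (l x) \<le> B * (1 + norm x) ^ 1" for x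
      by (simp add: distrib_left mult.commute add_increasing)
    then have "poly_bounded l" by (rule poly_boundedI)
    then show ?thesis using Nil by simp
  next
    case (snoc us u)
    have "(\<lambda>x::'w. l u) \<in> Cpol" by (rule Cpol_const)
    then show ?thesis using snoc by (simp add: dir_derivs_snoc dd Cpol_iff)
  qed
qed

lemma Cpol_add: "g \<in> Cpol \<Longrightarrow> h \<in> Cpol \<Longrightarrow> (\<lambda>x. g x + h x) \<in> Cpol"
  unfolding Cpol_iff by (simp add: dir_derivs_add smooth_add poly_bounded_add)

lemma Cpol_mult:
  fixes f g :: "'w::euclidean_space \<Rightarrow> complex"
  assumes "f \<in> Cpol" "g \<in> Cpol"
  shows "(\<lambda>x. f x * g x) \<in> Cpol"
proof -
  let ?C = "{\<lambda>x::'w. f x * g x | f g. f \<in> Cpol \<and> g \<in> Cpol}"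
  have mem: "(\<lambda>x. f x * g x) \<in> ?C" if "f \<in> Cpol" "g \<in> Cpol" for f g using that by blast
  show ?thesis
  proof (rule Cpol_coinduct_sums[where \<C> = ?C])
    fix h v x assume "h \<in> ?C"
    then obtain f g where h: "h = (\<lambda>x. f x * g x)" and f: "f \<in> Cpol" and g: "g \<in> Cpol" by blast
    have *: "dderiv v h = (\<lambda>x. f x * dderiv v g x + dderiv v f x * g x)" for v
      unfolding h using f g by (intro dderiv_mult smooth_differentiable Cpol_smooth)
    show "dderiv v h \<in> sums_of ?C"
      unfolding * using mem[OF f Cpol_dderiv[OF g]] mem[OF Cpol_dderiv[OF f] g]
      by (intro sums_of.add sums_of.base)
    show "h differentiable (at x)" unfolding h
      using f g by (intro differentiable_mult smooth_differentiable Cpol_smooth)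
    show "poly_bounded h" unfolding h using f g by (intro poly_bounded_mult Cpol_poly_bounded)
  qed (rule mem[OF assms])
qed

text \<open>Differentiation reproduces the exponential and changes only the factor of polynomial
  growth, so derivatives of every order keep this shape.\<close>

lemma dderiv_mult_exp:
  fixes Q :: "'w::euclidean_space \<Rightarrow> complex"
  assumes p: "p \<in> Cpol" and Q: "Q \<in> Cpol"
  shows "(\<lambda>x. p x * exp (Q x)) differentiable (at x)"
    and "\<exists>q\<in>Cpol. dderiv v (\<lambda>x. p x * exp (Q x)) = (\<lambda>x. q x * exp (Q x))"
proof -
  have d: "((\<lambda>x. p x * exp (Q x)) has_derivative
      (\<lambda>h. p x * (exp (Q x) * dderiv h Q x) + dderiv h p x * exp (Q x))) (at x)" for x
    by (intro has_derivative_mult smooth_has_derivative Cpol_smooth p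
        has_derivative_compose[OF smooth_has_derivative[OF Cpol_smooth[OF Q]] DERIV_exp[unfolded has_field_derivative_def]])
  then show "(\<lambda>x. p x * exp (Q x)) differentiable (at x)" unfolding differentiable_def by blast
  have "dderiv v (\<lambda>x. p x * exp (Q x)) = (\<lambda>x. p x * (exp (Q x) * dderiv v Q x) + dderiv v p x * exp (Q x))"
    using d by (rule dderiv_eqI)
  also have "\<dots> = (\<lambda>x. (p x * dderiv v Q x + dderiv v p x) * exp (Q x))"
    by (simp add: algebra_simps)
  finally have *: "dderiv v (\<lambda>x. p x * exp (Q x)) = (\<lambda>x. (p x * dderiv v Q x + dderiv v p x) * exp (Q x))" .
  show "\<exists>q\<in>Cpol. dderiv v (\<lambda>x. p x * exp (Q x)) = (\<lambda>x. q x * exp (Q x))"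
    by (rule bexI[of _ "\<lambda>x. p x * dderiv v Q x + dderiv v p x"]) (rule *, intro Cpol_add Cpol_mult Cpol_dderiv p Q)
qed

lemma dir_derivs_exp:
  fixes Q :: "'w::euclidean_space \<Rightarrow> complex"
  assumes Q: "Q \<in> Cpol"
  shows "\<exists>q\<in>Cpol. dir_derivs vs (\<lambda>x. exp (Q x)) = (\<lambda>x. q x * exp (Q x))"
proof (induction vs)
  case Nil
  show ?case by (rule bexI[OF _ Cpol_const[of 1]]) simp
next
  case (Cons v vs)
  then obtain q where "q \<in> Cpol" "dir_derivs vs (\<lambda>x. exp (Q x)) = (\<lambda>x. q x * exp (Q x))" by blast
  then show ?case using dderiv_mult_exp(2)[OF _ Q, of q v] by (simp add: dir_derivs_Cons)
qed

lemma smooth_exp: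
  fixes Q :: "'w::euclidean_space \<Rightarrow> complex"
  assumes Q: "Q \<in> Cpol"
  shows "smooth (\<lambda>x. exp (Q x))"
  unfolding smooth_def
proof (intro allI)
  fix vs x
  obtain q where "q \<in> Cpol" "dir_derivs vs (\<lambda>x. exp (Q x)) = (\<lambda>x. q x * exp (Q x))"
    using dir_derivs_exp[OF Q] by blast
  then show "dir_derivs vs (\<lambda>x. exp (Q x)) differentiable at x"
    using dderiv_mult_exp(1)[OF _ Q] by simp
qed

text \<open>The sign of the real part bounds the exponential by 1. The intended instances are
  phases, with \<open>Q\<close> imaginary.\<close>

lemma Cpol_exp:
  fixes Q :: "'w::euclidean_space \<Rightarrow> complex"
  assumes Q: "Q \<in> Cpol" "\<And>x. Re (Q x) \<le> 0"
  shows "(\<lambda>x. exp (Q x)) \<in> Cpol"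
  unfolding Cpol_iff
proof (intro conjI allI smooth_exp Q(1))
  fix vs
  obtain q where "q \<in> Cpol" and q: "dir_derivs vs (\<lambda>x. exp (Q x)) = (\<lambda>x. q x * exp (Q x))"
    using dir_derivs_exp[OF Q(1)] by blast
  have "poly_bounded (\<lambda>x. exp (Q x))" by (rule poly_boundedI[of _ 1 0]) (simp add: Q)
  then show "poly_bounded (dir_derivs vs (\<lambda>x. exp (Q x)))"
    unfolding q by (rule poly_bounded_mult[OF Cpol_poly_bounded[OF \<open>q \<in> Cpol\<close>]])
qed

lemma Cpol_cnj: "h \<in> Cpol \<Longrightarrow> (\<lambda>x. cnj (h x)) \<in> Cpol"
  unfolding Cpol_iff poly_bounded_def
  by (simp add: dir_derivs_bounded_linear[OF bounded_linear_cnj] smooth_bounded_linear[OF bounded_linear_cnj])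

lemma schwartz_Cpol: "f \<in> schwartz \<Longrightarrow> f \<in> Cpol"
  unfolding Cpol_iff
proof (intro conjI allI)
  fix vs assume "f \<in> schwartz"
  then have "norm (dir_derivs vs f x) \<le> schwartz_seminorm 0 vs f * (1 + norm x) ^ 0" for x
    using schwartz_seminorm_ge[of f x 0 vs] by simp
  then show "poly_bounded (dir_derivs vs f)" by (rule poly_boundedI)
qed (rule schwartz_smooth)

text \<open>Leibniz rule on the innermost derivative. It differentiates \<open>h\<close> or
  \<open>K\<close>, hence both are generalised in the induction. In the base case the growth of
  \<open>h\<close> is paid for by raising the weight from \<open>N\<close> to
  \<open>N + M\<close>.\<close>

lemma schwartz_valued_mult_Cpol:
  assumes "schwartz_valued V P K" "h \<in> Cpol"
  shows "schwartz_valued V P (\<lambda>v x. h x * K v x)"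
proof (rule schwartz_valuedI)
  fix N vs
  show "dominated V P (\<lambda>v x. (1 + norm x) ^ N * norm (dir_derivs vs (\<lambda>x. h x * K v x) x))"
    using assms
  proof (induction vs arbitrary: h K rule: rev_induct)
    case Nil
    obtain C M where C: "0 \<le> C" "\<And>x. norm (h x) \<le> C * (1 + norm x) ^ M"
      using Cpol_poly_bounded[OF Nil(2)] unfolding poly_bounded_def by blast
    have "dominated V P (\<lambda>v x. C * ((1 + norm x) ^ (N + M) * norm (dir_derivs [] (K v) x)))"
      by (intro dominated_cmult schwartz_valued_dominated Nil C)
    then show ?case
    proof (rule dominated_le)
      fix v x assume "v \<in> V"
      have "(1 + norm x) ^ N * (norm (h x) * norm (K v x)) \<le> (1 + norm x) ^ N * ((C * (1 + norm x) ^ M) * norm (K v x))"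
        using C by (intro mult_left_mono mult_right_mono) auto
      then show "(1 + norm x) ^ N * norm (dir_derivs [] (\<lambda>x. h x * K v x) x) \<le>
          C * ((1 + norm x) ^ (N + M) * norm (dir_derivs [] (K v) x))"
        by (simp add: norm_mult power_add algebra_simps)
    qed
  next
    case (snoc w vs)
    have *: "dominated V P (\<lambda>v x. (1 + norm x) ^ N * norm (dir_derivs vs (\<lambda>x. h x * dderiv w (K v) x) x) +
       (1 + norm x) ^ N * norm (dir_derivs vs (\<lambda>x. dderiv w h x * K v x) x))"
      using snoc.IH[OF schwartz_valued_dderiv[OF snoc.prems(1)] snoc.prems(2)]
        snoc.IH[OF snoc.prems(1) Cpol_dderiv[OF snoc.prems(2)]]
      by (rule dominated_add)
    show ?case
    proof (rule dominated_le[OF *])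
      fix v x assume "v \<in> V"
      then have K: "smooth (K v)" using schwartz_valued_smooth[OF snoc.prems(1)] by simp
      have h: "smooth h" by (rule Cpol_smooth) fact
      have "dderiv w (\<lambda>x. h x * K v x) = (\<lambda>x. h x * dderiv w (K v) x + dderiv w h x * K v x)"
        using K h by (intro dderiv_mult smooth_differentiable)
      then have "dir_derivs (vs @ [w]) (\<lambda>x. h x * K v x) x =
          dir_derivs vs (\<lambda>x. h x * dderiv w (K v) x) x + dir_derivs vs (\<lambda>x. dderiv w h x * K v x) x"
        using K h by (simp add: dir_derivs_snoc dir_derivs_add smooth_mult smooth_dderiv)
      then show "(1 + norm x) ^ N * norm (dir_derivs (vs @ [w]) (\<lambda>x. h x * K v x) x) \<le>
         (1 + norm x) ^ N * norm (dir_derivs vs (\<lambda>x. h x * dderiv w (K v) x) x) +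
         (1 + norm x) ^ N * norm (dir_derivs vs (\<lambda>x. dderiv w h x * K v x) x)"
        using mult_left_mono[OF norm_triangle_ineq, of "(1 + norm x) ^ N"] by (simp add: distrib_left)
    qed
  qed
qed (intro smooth_mult schwartz_valued_smooth[OF assms(1)] Cpol_smooth[OF assms(2)])

lemma schwartz_valued_cnj: "schwartz_valued V P K \<Longrightarrow> schwartz_valued V P (\<lambda>v x. cnj (K v x))"
  by (rule schwartz_valued_bounded_linear[OF _ bounded_linear_cnj])

lemma schwartz_valued_cmult: "schwartz_valued V P K \<Longrightarrow> schwartz_valued V P (\<lambda>v x. c * K v x)"
  by (rule schwartz_valued_mult_Cpol[OF _ Cpol_const])

lemma schwartz_add: "f \<in> schwartz \<Longrightarrow> g \<in> schwartz \<Longrightarrow> (\<lambda>x. f x + g x) \<in> schwartz"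
  unfolding schwartz_iff_valued by (rule schwartz_valued_add)

lemma schwartz_mult_Cpol: "f \<in> schwartz \<Longrightarrow> h \<in> Cpol \<Longrightarrow> (\<lambda>x. h x * f x) \<in> schwartz"
  unfolding schwartz_iff_valued by (rule schwartz_valued_mult_Cpol)

lemma schwartz_cmult: "f \<in> schwartz \<Longrightarrow> (\<lambda>x. c * f x) \<in> schwartz"
  unfolding schwartz_iff_valued by (rule schwartz_valued_cmult)

lemma schwartz_cnj: "f \<in> schwartz \<Longrightarrow> (\<lambda>x. cnj (f x)) \<in> schwartz"
  unfolding schwartz_iff_valued by (rule schwartz_valued_cnj)

lemma schwartz_dderiv: "f \<in> schwartz \<Longrightarrow> dderiv v f \<in> schwartz"
  unfolding schwartz_iff_valued by (rule schwartz_valued_dderiv)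

lemma schwartz_diff: "f \<in> schwartz \<Longrightarrow> g \<in> schwartz \<Longrightarrow> (\<lambda>x. f x - g x) \<in> schwartz"
  using schwartz_add[OF _ schwartz_cmult[of g "-1"], of f] by simp

section \<open>Translates, integrability and the Gaussian\<close>

lemma one_plus_norm_translate: "1 + norm y \<le> (1 + norm x) * (1 + norm (x + y))"
  for x y :: "'w::real_normed_vector"
proof -
  have "norm y \<le> norm (x + y) + norm x" by (metis add.commute add_diff_cancel norm_triangle_ineq4)
  also have "\<dots> \<le> norm (x + y) + norm x + norm x * norm (x + y)" by simp
  finally show ?thesis by (simp add: algebra_simps)
qed

text \<open>The preceding inequality of Peetre type moves the weight from \<open>y\<close> to
  \<open>x + y\<close>, where the seminorm of \<open>f\<close> controls it, at the price of a power
  of \<open>1 + norm x\<close>.\<close>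

lemma schwartz_translate_bound:
  assumes f: "f \<in> schwartz"
  shows "(1 + norm y) ^ N * norm (dir_derivs vs f (x + y)) \<le> (1 + norm x) ^ N * schwartz_seminorm N vs f"
proof -
  have "(1 + norm y) ^ N \<le> (1 + norm x) ^ N * (1 + norm (x + y)) ^ N"
    unfolding power_mult_distrib[symmetric] by (intro power_mono one_plus_norm_translate) auto
  then have "(1 + norm y) ^ N * norm (dir_derivs vs f (x + y)) \<le>
      (1 + norm x) ^ N * ((1 + norm (x + y)) ^ N * norm (dir_derivs vs f (x + y)))"
    using mult_right_mono[OF _ norm_ge_zero, of _ _ "dir_derivs vs f (x + y)"] by (simp add: mult.assoc[symmetric])
  also have "\<dots> \<le> (1 + norm x) ^ N * schwartz_seminorm N vs f"
    by (intro mult_left_mono schwartz_seminorm_ge f) auto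
  finally show ?thesis .
qed

lemma schwartz_translate:
  assumes f: "f \<in> schwartz" shows "(\<lambda>y. f (x + y)) \<in> schwartz"
proof (rule schwartzI)
  fix N vs
  show "\<exists>C. \<forall>y. (1 + norm y) ^ N * norm (dir_derivs vs (\<lambda>y. f (x + y)) y) \<le> C"
    unfolding dir_derivs_translate[OF schwartz_smooth[OF f]]
    using schwartz_translate_bound[OF f, of _ N vs x] by blast
qed (intro smooth_translate schwartz_smooth f)

text \<open>Mean value inequality along the segment from \<open>v\<close> to \<open>x\<close>, whose
  points have norm at most \<open>norm v + norm x\<close>. The factor \<open>norm (v - x)\<close>
  says that translation is continuous in every Schwartz seminorm, with constants of polynomial
  growth.\<close>

lemma schwartz_translate_diff_bound:
  fixes f :: "'w::euclidean_space \<Rightarrow> complex"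
  assumes f: "f \<in> schwartz"
  shows "(1 + norm y) ^ N * norm (dir_derivs vs f (v + y) - dir_derivs vs f (x + y)) \<le>
    norm (v - x) * ((1 + norm v + norm x) ^ N * (\<Sum>b\<in>Basis. schwartz_seminorm N (b # vs) f))"
proof -
  let ?S = "closed_segment v x" and ?F = "\<lambda>z. dir_derivs vs f (z + y)"
  let ?B = "(1 + norm v + norm x) ^ N * (\<Sum>b\<in>Basis. schwartz_seminorm N (b # vs) f) / (1 + norm y) ^ N"
  have pos: "0 < (1 + norm y) ^ N" by (intro zero_less_power add_pos_nonneg) auto
  have sm: "smooth (dir_derivs vs f)" by (intro smooth_dir_derivs schwartz_smooth f)
  have "norm (?F v - ?F x) \<le> ?B * norm (v - x)"
  proof (rule differentiable_bound[of ?S])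
    fix z assume z: "z \<in> ?S"
    let ?D = "frechet_derivative (dir_derivs vs f) (at (z + y))"
    have "(?F has_derivative ?D) (at z)"
      using has_derivative_translate[of "dir_derivs vs f" ?D y z] smooth_has_derivative[OF sm, of "y + z"]
      by (simp add: add.commute)
    then show "(?F has_derivative ?D) (at z within ?S)" by (rule has_derivative_at_withinI)
    have lin: "linear ?D" using smooth_has_derivative[OF sm] by (rule has_derivative_linear)
    obtain u where u: "0 \<le> u" "u \<le> 1" "z = (1 - u) *\<^sub>R v + u *\<^sub>R x" using z unfolding in_segment by blast
    have "norm z \<le> (1 - u) * norm v + u * norm x"
      unfolding u(3) using u(1,2) by (metis abs_of_nonneg diff_ge_0_iff_ge norm_scaleR norm_triangle_ineq)
    also have "\<dots> \<le> norm v + norm x"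
      using u(1,2) by (intro add_mono mult_left_le_one_le) auto
    finally have "norm z \<le> norm v + norm x" .
    have nz: "(1 + norm y) ^ N * norm (?D b) \<le> (1 + norm v + norm x) ^ N * schwartz_seminorm N (b # vs) f" for b
    proof -
      have "(1 + norm y) ^ N * norm (?D b) \<le> (1 + norm z) ^ N * schwartz_seminorm N (b # vs) f"
        using schwartz_translate_bound[OF f, of y N "b # vs" z] by (simp add: dir_derivs_Cons)
      also have "\<dots> \<le> (1 + norm v + norm x) ^ N * schwartz_seminorm N (b # vs) f"
        using \<open>norm z \<le> norm v + norm x\<close> by (intro mult_right_mono power_mono schwartz_seminorm_nonneg f) auto
      finally show ?thesis .
    qed
    show "onorm ?D \<le> ?B"
    proof (rule onorm_le)
      fix h
      \<comment> \<open>Derivatives in arbitrary directions are reduced to the basis, so that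
        finitely many seminorms suffice.\<close>
      have "?D h = (\<Sum>b\<in>Basis. (h \<bullet> b) *\<^sub>R ?D b)"
        by (subst (1) euclidean_representation[symmetric, of h]) (simp add: linear_sum[OF lin] linear_cmul[OF lin])
      also have "norm \<dots> \<le> (\<Sum>b\<in>Basis. norm h * norm (?D b))"
        by (rule order_trans[OF norm_sum sum_mono]) (simp add: Basis_le_norm mult_right_mono)
      finally have "(1 + norm y) ^ N * norm (?D h) \<le> norm h * (\<Sum>b\<in>Basis. (1 + norm y) ^ N * norm (?D b))"
        using pos by (simp add: sum_distrib_left[symmetric] mult.left_commute)
      also have "\<dots> \<le> norm h * (\<Sum>b\<in>Basis. (1 + norm v + norm x) ^ N * schwartz_seminorm N (b # vs) f)"
        by (intro mult_left_mono sum_mono nz) auto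
      finally show "norm (?D h) \<le> ?B * norm h"
        using pos by (simp add: pos_le_divide_eq mult.commute mult.left_commute flip: sum_distrib_left sum_distrib_right)
    qed
  qed auto
  then show ?thesis using pos by (simp add: field_simps)
qed

text \<open>Each factor \<open>1 + (x \<bullet> b)\<^sup>2\<close> is at most
  \<open>(1 + norm x)\<^sup>2\<close>. With the exponent \<open>2 * DIM('w)\<close> the weight
  therefore lies below a product of functions of one coordinate, and the integral of the product is
  a product of finite integrals.\<close>

lemma integrable_weight:
  "integrable lborel (\<lambda>x::'w::euclidean_space. 1 / (1 + norm x) ^ (2 * DIM('w)))"
proof -
  have "integrable lborel (\<lambda>x::real. inverse (1 + x\<^sup>2))"
    using integrable_inverse_1_plus_square by (simp add: set_integrable_def)
  then have fin: "(\<integral>\<^sup>+x. ennreal (inverse (1 + x\<^sup>2)) \<partial>(lborel::real measure)) < \<infinity>"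
    by (simp add: integrable_iff_bounded)
  have "(\<integral>\<^sup>+x. (\<Prod>b\<in>Basis. ennreal (inverse (1 + (x \<bullet> b)\<^sup>2))) \<partial>(lborel::'w measure)) =
      (\<Prod>b\<in>(Basis::'w set). \<integral>\<^sup>+x. ennreal (inverse (1 + x\<^sup>2)) \<partial>(lborel::real measure))"
    by (rule nn_integral_lborel_prod) auto
  also have "\<dots> < \<infinity>" using fin by (simp add: less_top[symmetric] power_eq_top_ennreal)
  finally have fin2: "(\<integral>\<^sup>+x. (\<Prod>b\<in>Basis. ennreal (inverse (1 + (x \<bullet> b)\<^sup>2))) \<partial>(lborel::'w measure)) < \<infinity>" .
  have "1 / (1 + norm x) ^ (2 * DIM('w)) \<le> (\<Prod>b\<in>Basis. inverse (1 + (x \<bullet> b)\<^sup>2))" for x :: 'w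
  proof -
    have "(\<Prod>b\<in>Basis. 1 + (x \<bullet> b)\<^sup>2) \<le> (\<Prod>b\<in>(Basis::'w set). (1 + norm x)\<^sup>2)"
    proof (intro prod_mono conjI)
      fix b :: 'w assume "b \<in> Basis"
      then have "(x \<bullet> b)\<^sup>2 \<le> (norm x)\<^sup>2" by (metis Basis_le_norm abs_le_square_iff abs_norm_cancel)
      then show "1 + (x \<bullet> b)\<^sup>2 \<le> (1 + norm x)\<^sup>2" by (simp add: power2_sum add_increasing2)
    qed auto
    also have "\<dots> = (1 + norm x) ^ (2 * DIM('w))" by (simp add: power_mult)
    finally show ?thesis
      unfolding prod_inversef[of "\<lambda>b. 1 + (x \<bullet> b)\<^sup>2", unfolded comp_def] divide_inverse mult_1_left
      by (intro le_imp_inverse_le prod_pos) (auto intro: add_pos_nonneg)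
  qed
  then have "(\<integral>\<^sup>+x. ennreal (1 / (1 + norm x) ^ (2 * DIM('w))) \<partial>(lborel::'w measure)) \<le>
     (\<integral>\<^sup>+x. (\<Prod>b\<in>Basis. ennreal (inverse (1 + (x \<bullet> b)\<^sup>2))) \<partial>(lborel::'w measure))"
    by (intro nn_integral_mono) (simp add: prod_ennreal ennreal_leI)
  with fin2 show ?thesis
    by (subst integrable_iff_bounded) (auto intro: le_less_trans)
qed

definition weight_int :: "'w::euclidean_space itself \<Rightarrow> real"
  where "weight_int _ = (\<integral>x. 1 / (1 + norm x) ^ (2 * DIM('w)) \<partial>(lborel :: 'w measure))"

lemma schwartz_measurable: "f \<in> schwartz \<Longrightarrow> f \<in> borel_measurable borel"
  by (intro smooth_measurable schwartz_smooth)

lemma schwartz_le_weight: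
  assumes "f \<in> schwartz"
  shows "norm (f x) \<le> schwartz_seminorm N [] f / (1 + norm x) ^ N"
  using schwartz_seminorm_ge[OF assms, of x N "[]"]
  by (simp add: pos_le_divide_eq zero_less_power add_pos_nonneg mult.commute)

text \<open>Of the weight \<open>2 * DIM('w) + M\<close>, the first \<open>2 * DIM('w)\<close>
  powers buy integrability and the other \<open>M\<close> absorb the growth of
  \<open>u\<close>.\<close>

lemma schwartz_mult_integrable:
  fixes f :: "'w::euclidean_space \<Rightarrow> complex"
  assumes f: "f \<in> schwartz" and u: "u \<in> borel_measurable borel" "\<And>x. norm (u x) \<le> C * (1 + norm x) ^ M"
  shows "integrable lborel (\<lambda>x. f x * u x)"
    and "(\<integral>x. norm (f x * u x) \<partial>lborel) \<le> C * schwartz_seminorm (2 * DIM('w) + M) [] f * weight_int TYPE('w)"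
proof -
  let ?p = "schwartz_seminorm (2 * DIM('w) + M) [] f"
  have C: "0 \<le> C" using order_trans[OF norm_ge_zero u(2)[of 0]] by simp
  have le: "norm (f x * u x) \<le> C * ?p * (1 / (1 + norm x) ^ (2 * DIM('w)))" for x
  proof -
    have "norm (f x * u x) \<le> (?p / (1 + norm x) ^ (2 * DIM('w) + M)) * (C * (1 + norm x) ^ M)"
      unfolding norm_mult using C f by (intro mult_mono schwartz_le_weight u) (auto simp: schwartz_seminorm_nonneg)
    also have "\<dots> = C * ?p * (1 / (1 + norm x) ^ (2 * DIM('w)))"
      using add_pos_nonneg[OF zero_less_one norm_ge_zero, of x] by (simp add: power_add divide_simps)
    finally show ?thesis .
  qed
  have wi: "integrable lborel (\<lambda>x::'w. C * ?p * (1 / (1 + norm x) ^ (2 * DIM('w))))"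
    by (intro integrable_mult_right integrable_weight)
  show int: "integrable lborel (\<lambda>x. f x * u x)"
    by (rule Bochner_Integration.integrable_bound[OF wi]) (use schwartz_measurable[OF f] u(1) order_trans[OF le abs_ge_self] in \<open>auto intro!: AE_I2\<close>)
  have "(\<integral>x. norm (f x * u x) \<partial>lborel) \<le> (\<integral>x. C * ?p * (1 / (1 + norm x) ^ (2 * DIM('w))) \<partial>(lborel :: 'w measure))"
    by (intro integral_mono integrable_norm int wi le)
  then show "(\<integral>x. norm (f x * u x) \<partial>lborel) \<le> C * ?p * weight_int TYPE('w)"
    unfolding weight_int_def integral_mult_right_zero .
qed

lemma schwartz_integrable:
  fixes f :: "'w::euclidean_space \<Rightarrow> complex"
  assumes f: "f \<in> schwartz"
  shows "integrable lborel f"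
    and "(\<integral>x. norm (f x) \<partial>lborel) \<le> schwartz_seminorm (2 * DIM('w)) [] f * weight_int TYPE('w)"
  using schwartz_mult_integrable[OF f, of "\<lambda>_. 1" 1 0] by auto

text \<open>A concrete Schwartz function that is positive and equal to 1 at the origin. It
  regularises the double integral in Fourier inversion and tests the normalisation of the
  measure.\<close>

lemma gaussian_schwartz: "(\<lambda>x::'w::euclidean_space. exp (- complex_of_real (x \<bullet> x))) \<in> schwartz"
proof -
  let ?Q = "\<lambda>x::'w. - complex_of_real (x \<bullet> x)"
  have "(\<lambda>x::'w. \<Sum>b\<in>B. complex_of_real (x \<bullet> b) * complex_of_real (x \<bullet> b)) \<in> Cpol" if "finite B" for B
    using that
  proof (induction B)
    case (insert b B)
    have "linear (\<lambda>x::'w. complex_of_real (x \<bullet> b))"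
      by (intro linearI) (auto simp: inner_left_distrib scaleR_conv_of_real)
    then show ?case using insert by (simp add: Cpol_add Cpol_mult Cpol_linear)
  qed (simp add: Cpol_const)
  from Cpol_mult[OF Cpol_const[of "-1"] this[OF finite_Basis]]
  have Q: "?Q \<in> Cpol"
    by (subst euclidean_inner) simp
  have bd: "\<exists>C. \<forall>x. (1 + norm x) ^ N * norm (p x * exp (?Q x)) \<le> C" if p: "p \<in> Cpol" for p :: "'w \<Rightarrow> complex" and N
  proof -
    obtain C M where C: "0 \<le> C" "\<And>x. norm (p x) \<le> C * (1 + norm x) ^ M"
      using Cpol_poly_bounded[OF p] unfolding poly_bounded_def by blast
    have "(1 + norm x) ^ N * norm (p x * exp (?Q x)) \<le> C * (fact (N + M) * exp 2)" for x
    proof -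
      define s where "s = norm x"
      have s: "0 \<le> s" by (simp add: s_def)
      \<comment> \<open>One term of the exponential series bounds the power; the linear exponent
        then loses to the Gaussian through \<open>1 + s - s\<^sup>2 \<le> 2\<close>.\<close>
      have "(1 + s) ^ (N + M) /\<^sub>R fact (N + M) \<le> exp (1 + s)"
        using sum_le_suminf[of "\<lambda>n. (1 + s) ^ n /\<^sub>R fact n" "{N + M}"] exp_converges[of "1 + s"] s
        by (simp add: sums_iff)
      then have 1: "(1 + s) ^ (N + M) \<le> fact (N + M) * exp (1 + s)" by (simp add: field_simps)
      have "0 \<le> (s - 1)\<^sup>2 + s\<^sup>2 + 1" by simp
      then have "1 + s - s\<^sup>2 \<le> 2" by (simp add: power2_eq_square algebra_simps)
      then have 2: "exp (1 + s) * exp (- s\<^sup>2) \<le> exp 2" by (simp flip: exp_add)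
      have "(1 + s) ^ N * norm (p x * exp (?Q x)) \<le> (1 + s) ^ N * ((C * (1 + s) ^ M) * exp (- s\<^sup>2))"
        unfolding norm_mult using C(2)[of x] s
        by (intro mult_left_mono mult_right_mono) (auto simp: s_def power2_norm_eq_inner)
      also have "\<dots> = C * ((1 + s) ^ (N + M) * exp (- s\<^sup>2))" by (simp add: power_add)
      also have "\<dots> \<le> C * ((fact (N + M) * exp (1 + s)) * exp (- s\<^sup>2))"
        using C(1) 1 by (intro mult_left_mono mult_right_mono) auto
      also have "\<dots> \<le> C * (fact (N + M) * exp 2)"
        using C(1) 2 by (intro mult_left_mono) (auto simp: mult.assoc)
      finally show ?thesis by (simp add: s_def)
    qed
    then show ?thesis by blast
  qed
  show ?thesis
  proof (rule schwartzI)
    fix N and vs :: "'w list"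
    show "\<exists>C. \<forall>x. (1 + norm x) ^ N * norm (dir_derivs vs (\<lambda>x. exp (?Q x)) x) \<le> C"
      using dir_derivs_exp[OF Q, of vs] bd by auto
  qed (rule smooth_exp[OF Q])
qed

section \<open>Lebesgue integrals on Euclidean spaces\<close>

lemma lborel_integral_scale:
  fixes f :: "'w::euclidean_space \<Rightarrow> complex"
  assumes [measurable]: "f \<in> borel_measurable borel" and "c \<noteq> 0"
  shows "(\<integral>x. f x \<partial>lborel) = \<bar>c\<bar> ^ DIM('w) *\<^sub>R (\<integral>x. f (t + c *\<^sub>R x) \<partial>lborel)"
  by (subst lborel_affine[OF \<open>c \<noteq> 0\<close>, of t]) (simp add: integral_density integral_distr)

lemma lborel_integral_translate:
  fixes f :: "'w::euclidean_space \<Rightarrow> complex"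
  assumes "f \<in> borel_measurable borel"
  shows "(\<integral>x. f (t + x) \<partial>lborel) = (\<integral>x. f x \<partial>lborel)"
  using lborel_integral_scale[OF assms, of 1 t] by simp

lemma lborel_integral_reflect:
  fixes f :: "'w::euclidean_space \<Rightarrow> complex"
  assumes "f \<in> borel_measurable borel"
  shows "(\<integral>x. f (t - x) \<partial>lborel) = (\<integral>x. f x \<partial>lborel)"
  using lborel_integral_scale[OF assms, of "-1" t] by simp

text \<open>A bounded kernel does not disturb the absolute integrability of the product
  \<open>f x * g y\<close>. The kernels to which this is applied are unimodular characters.\<close>

lemma lborel_Fubini_kernel:
  fixes f g :: "'w::euclidean_space \<Rightarrow> complex" and k :: "'w \<times> 'w \<Rightarrow> complex"
  assumes f: "integrable lborel f" and g: "integrable lborel g"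
    and k [measurable]: "k \<in> borel_measurable (borel \<Otimes>\<^sub>M borel)" and "\<And>z. norm (k z) \<le> 1"
  shows "(\<integral>x. (\<integral>y. k (x, y) * (f x * g y) \<partial>lborel) \<partial>lborel) = (\<integral>y. (\<integral>x. k (x, y) * (f x * g y) \<partial>lborel) \<partial>lborel)"
proof -
  have [measurable]: "f \<in> borel_measurable borel" "g \<in> borel_measurable borel"
    using f g by (auto dest: borel_measurable_integrable)
  have kle: "norm (k z * w) \<le> norm w" for z w
    unfolding norm_mult using assms(4)[of z] by (simp add: mult_left_le_one_le)
  have row: "integrable lborel (\<lambda>y. k (x, y) * (f x * g y))" for x
    by (rule Bochner_Integration.integrable_bound[of _ "\<lambda>y. f x * g y"])
      (use g in \<open>auto intro!: AE_I2 kle\<close>)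
  have "integrable (lborel \<Otimes>\<^sub>M lborel) (\<lambda>z. k z * (f (fst z) * g (snd z)))"
  proof (rule lborel_pair.Fubini_integrable)
    show "AE x in lborel. integrable lborel (\<lambda>y. k (x, y) * (f (fst (x, y)) * g (snd (x, y))))"
      using row by simp
    have "norm (\<integral>y. norm (k (x, y) * (f x * g y)) \<partial>lborel) \<le> norm (f x * (\<integral>y. norm (g y) \<partial>lborel))" for x
    proof -
      have "(\<integral>y. norm (k (x, y) * (f x * g y)) \<partial>lborel) \<le> (\<integral>y. norm (f x * g y) \<partial>lborel)"
        using row g by (intro integral_mono kle integrable_norm integrable_mult_right) auto
      then show ?thesis by (simp add: norm_mult)
    qed
    then show "integrable lborel (\<lambda>x. \<integral>y. norm (k (x, y) * (f (fst (x, y)) * g (snd (x, y)))) \<partial>lborel)"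
      using f
      by (intro Bochner_Integration.integrable_bound[OF integrable_mult_left[OF f, of "complex_of_real (\<integral>y. norm (g y) \<partial>lborel)"]] AE_I2)
        simp_all
  qed measurable
  then have "integrable (lborel \<Otimes>\<^sub>M lborel) (case_prod (\<lambda>x y. k (x, y) * (f x * g y)))"
    by (simp add: case_prod_beta')
  from lborel_pair.Fubini_integral[OF this] show ?thesis by simp
qed

text \<open>The set where \<open>f\<close> does not vanish is open, and a non-empty open set is not
  negligible. Hence a Schwartz function that is not zero has positive L^2 norm.\<close>

lemma continuous_AE_zero:
  fixes f :: "'w::euclidean_space \<Rightarrow> complex"
  assumes "continuous_on UNIV f" "AE x in lborel. f x = 0"
  shows "f x = 0"
proof -
  have "open {x. f x \<noteq> 0}"
    using assms(1) by (intro open_Collect_neq) auto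
  moreover have "{x. f x \<noteq> 0} \<in> null_sets lborel"
    using assms(2) \<open>open {x. f x \<noteq> 0}\<close> by (simp add: AE_iff_null_sets borel_open null_sets_def AE_iff_measurable[OF _ refl])
  then have "negligible {x. f x \<noteq> 0}"
    by (simp add: negligible_iff_null_sets null_sets_completionI)
  ultimately show ?thesis
    using open_not_negligible by blast
qed

text \<open>Sequential form of the directional derivative, as dominated convergence requires
  it.\<close>

lemma directional_difference_quotient:
  fixes f :: "'w::real_normed_vector \<Rightarrow> 'a::real_normed_vector"
  assumes "(f has_derivative D) (at x)" "t \<longlonglongrightarrow> 0" "\<And>n. 0 < t n"
  shows "(\<lambda>n. (f (x + t n *\<^sub>R v) - f x) /\<^sub>R t n) \<longlonglongrightarrow> D v"
proof (cases "v = 0")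
  case True
  then show ?thesis using linear_0[OF has_derivative_linear[OF assms(1)]] by simp
next
  case False
  have lin: "linear D" by (rule has_derivative_linear[OF assms(1)])
  have "((\<lambda>h. norm (f (x + h) - f x - D h) / norm h) \<longlongrightarrow> 0) (at 0)"
    using assms(1) by (simp add: has_derivative_at)
  moreover have "filterlim (\<lambda>n. t n *\<^sub>R v) (at 0) sequentially"
    unfolding filterlim_at
  proof (intro conjI)
    show "(\<lambda>n. t n *\<^sub>R v) \<longlonglongrightarrow> 0"
      using tendsto_scaleR[OF assms(2) tendsto_const[of v]] by simp
    have "t n *\<^sub>R v \<noteq> 0" for n using assms(3)[of n] False by simp
    then show "\<forall>\<^sub>F n in sequentially. t n *\<^sub>R v \<in> UNIV \<and> t n *\<^sub>R v \<noteq> 0" by simp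
  qed
  ultimately have "(\<lambda>n. norm (f (x + t n *\<^sub>R v) - f x - D (t n *\<^sub>R v)) / norm (t n *\<^sub>R v)) \<longlonglongrightarrow> 0"
    by (rule filterlim_compose)
  then have "(\<lambda>n. norm v * (norm (f (x + t n *\<^sub>R v) - f x - D (t n *\<^sub>R v)) / norm (t n *\<^sub>R v))) \<longlonglongrightarrow> 0"
    by (rule tendsto_mult_right_zero)
  moreover have "norm v * (norm (f (x + t n *\<^sub>R v) - f x - D (t n *\<^sub>R v)) / norm (t n *\<^sub>R v)) =
      norm ((f (x + t n *\<^sub>R v) - f x) /\<^sub>R t n - D v)" for n
  proof -
    have t: "0 < t n" by (rule assms(3))
    have "(f (x + t n *\<^sub>R v) - f x) /\<^sub>R t n - D v = (f (x + t n *\<^sub>R v) - f x - D (t n *\<^sub>R v)) /\<^sub>R t n"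
      using t by (simp add: linear_cmul[OF lin] scaleR_diff_right)
    then have "norm ((f (x + t n *\<^sub>R v) - f x) /\<^sub>R t n - D v) = norm (f (x + t n *\<^sub>R v) - f x - D (t n *\<^sub>R v)) / t n"
      using t by (simp only: norm_scaleR) (simp add: divide_inverse)
    then show ?thesis using t False by simp
  qed
  ultimately have "(\<lambda>n. norm ((f (x + t n *\<^sub>R v) - f x) /\<^sub>R t n - D v)) \<longlonglongrightarrow> 0" by simp
  then show ?thesis by (rule LIM_zero_cancel[OF tendsto_norm_zero_cancel])
qed

text \<open>Uniqueness of Haar measure: with \<open>g\<close> the indicator of the unit cube, evaluate the double
  integral of \<open>indicator A x * g (y - x)\<close> in both orders, translating either variable.\<close>

lemma haar_measure_eq_lborel:
  fixes \<mu> :: "'w::euclidean_space measure"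
  assumes "haar_measure \<mu>"
  obtains c where "0 < c" "\<mu> = density lborel (\<lambda>_. ennreal c)"
proof -
  have sets [measurable_cong, simp]: "sets \<mu> = sets borel" and nz: "emeasure \<mu> UNIV \<noteq> 0"
    and K: "\<And>K. compact K \<Longrightarrow> emeasure \<mu> K < \<infinity>" and inv: "\<And>x. distr \<mu> borel (\<lambda>y. x + y) = \<mu>"
    using assms by (auto simp: haar_measure_def)
  have sp: "space \<mu> = UNIV" using sets_eq_imp_space_eq[OF sets] by simp
  interpret \<mu>: sigma_finite_measure \<mu>
  proof
    show "\<exists>A. countable A \<and> A \<subseteq> sets \<mu> \<and> \<Union> A = space \<mu> \<and> (\<forall>a\<in>A. emeasure \<mu> a \<noteq> \<infinity>)"
    proof (intro exI[of _ "range (\<lambda>n::nat. cball 0 (real n))"] conjI ballI)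
      show "\<Union> (range (\<lambda>n::nat. cball (0::'w) (real n))) = space \<mu>"
        using real_arch_simple by (auto simp: sp)
      fix A assume "A \<in> range (\<lambda>n::nat. cball (0::'w) (real n))"
      then show "emeasure \<mu> A \<noteq> \<infinity>" using K[of A] by auto
    qed auto
  qed
  interpret pair_sigma_finite \<mu> "lborel :: 'w measure" ..
  have tr: "(\<integral>\<^sup>+x. f (y + x) \<partial>\<mu>) = (\<integral>\<^sup>+x. f x \<partial>\<mu>)" if [measurable]: "f \<in> borel_measurable borel" for f :: "'w \<Rightarrow> ennreal" and y
    by (subst (2) inv[symmetric, of y]) (simp add: nn_integral_distr)
  have trl: "(\<integral>\<^sup>+x. f (y + x) \<partial>lborel) = (\<integral>\<^sup>+x. f x \<partial>lborel)" if [measurable]: "f \<in> borel_measurable borel" for f :: "'w \<Rightarrow> ennreal" and y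
    by (subst (2) lborel_distr_plus[symmetric, of y]) (simp add: nn_integral_distr)
  define Q where "Q = cbox (0::'w) One"
  define g :: "'w \<Rightarrow> ennreal" where "g = indicator Q"
  have [measurable]: "g \<in> borel_measurable borel" by (simp add: g_def Q_def)
  \<comment> \<open>The reflected argument is what \<open>g (- x + y)\<close> becomes once the
    variable of \<open>\<mu>\<close> has been translated by \<open>y\<close>.\<close>
  define c where "c = (\<integral>\<^sup>+x. g (- x) \<partial>\<mu>)"
  have Q1: "(\<integral>\<^sup>+x. g x \<partial>lborel) = 1" by (simp add: g_def Q_def emeasure_lborel_cbox_eq)
  have cQ: "c = emeasure \<mu> (uminus ` Q)"
  proof -
    have "c = (\<integral>\<^sup>+x. indicator (uminus ` Q) x \<partial>\<mu>)"
      unfolding c_def g_def by (intro nn_integral_cong) (simp add: indicator_def image_iff, metis minus_minus)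
    also have "compact (uminus ` Q)" unfolding Q_def
      by (intro compact_continuous_image continuous_intros compact_cbox)
    then have "(\<integral>\<^sup>+x. indicator (uminus ` Q) x \<partial>\<mu>) = emeasure \<mu> (uminus ` Q)"
      by (intro nn_integral_indicator) (auto intro: borel_compact)
    finally show ?thesis .
  qed
  have c_fin: "c < \<infinity>"
    unfolding cQ Q_def by (intro K compact_continuous_image continuous_intros compact_cbox)
  have main: "emeasure \<mu> A = c * emeasure lborel A" if A: "A \<in> sets borel" for A
  proof -
    have [measurable]: "indicator A \<in> borel_measurable borel" using A by simp
    have "(\<integral>\<^sup>+y. g (- x + y) \<partial>lborel) = 1" for x by (rule trans[OF trl Q1]) measurable
    then have "emeasure \<mu> A = (\<integral>\<^sup>+x. indicator A x * (\<integral>\<^sup>+y. g (- x + y) \<partial>lborel) \<partial>\<mu>)"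
      using A by (simp only: mult_1_right) simp
    also have "\<dots> = (\<integral>\<^sup>+x. (\<integral>\<^sup>+y. indicator A x * g (- x + y) \<partial>lborel) \<partial>\<mu>)"
      using A by (intro nn_integral_cong nn_integral_cmult[symmetric]) simp
    also have "\<dots> = (\<integral>\<^sup>+y. (\<integral>\<^sup>+x. indicator A x * g (- x + y) \<partial>\<mu>) \<partial>lborel)"
      using A by (intro Fubini'[symmetric]) simp
    also have "\<dots> = (\<integral>\<^sup>+y. (\<integral>\<^sup>+x. indicator A (y + x) * g (- x) \<partial>\<mu>) \<partial>lborel)"
    proof (rule nn_integral_cong)
      fix y
      show "(\<integral>\<^sup>+x. indicator A x * g (- x + y) \<partial>\<mu>) = (\<integral>\<^sup>+x. indicator A (y + x) * g (- x) \<partial>\<mu>)"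
        using A by (subst tr[symmetric, of _ y]) simp_all
    qed
    also have "\<dots> = (\<integral>\<^sup>+x. (\<integral>\<^sup>+y. indicator A (y + x) * g (- x) \<partial>lborel) \<partial>\<mu>)"
      using A by (intro Fubini') simp
    also have "\<dots> = (\<integral>\<^sup>+x. emeasure lborel A * g (- x) \<partial>\<mu>)"
    proof (rule nn_integral_cong)
      fix x
      show "(\<integral>\<^sup>+y. indicator A (y + x) * g (- x) \<partial>lborel) = emeasure lborel A * g (- x)"
        using A trl[of "indicator A" x] by (simp add: nn_integral_multc add.commute)
    qed
    also have "\<dots> = c * emeasure lborel A"
      using A by (simp add: nn_integral_cmult c_def mult.commute)
    finally show ?thesis .
  qed
  have "c \<noteq> 0" using main[of UNIV] nz by auto
  show thesis
  proof (rule that)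
    show "0 < enn2real c" using \<open>c \<noteq> 0\<close> c_fin by (simp add: enn2real_positive_iff less_top zero_less_iff_neq_zero)
    show "\<mu> = density lborel (\<lambda>_. ennreal (enn2real c))"
      by (rule measure_eqI) (use c_fin in \<open>auto simp: main emeasure_density_const less_top\<close>)
  qed
qed

section \<open>The symplectic Fourier transformation\<close>

locale symplectic =
  fixes \<sigma> :: "'w::euclidean_space \<Rightarrow> 'w \<Rightarrow> real"
  assumes symplectic_sigma: "symplectic_form \<sigma>"
begin

lemma sigma_bilinear: "bilinear \<sigma>"
  using symplectic_sigma unfolding symplectic_form_def by (rule conjunct1)

lemma sigma_antisym: "\<sigma> x y = - \<sigma> y x"
  using symplectic_sigma unfolding symplectic_form_def by blast

lemma sigma_nondegenerate: "(\<And>y. \<sigma> x y = 0) \<Longrightarrow> x = 0"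
  using symplectic_sigma unfolding symplectic_form_def by blast

lemmas sigma_simps = bilinear_ladd[OF sigma_bilinear] bilinear_radd[OF sigma_bilinear] bilinear_lmul[OF sigma_bilinear]
  bilinear_rmul[OF sigma_bilinear] bilinear_lneg[OF sigma_bilinear] bilinear_rneg[OF sigma_bilinear]
  bilinear_lzero[OF sigma_bilinear] bilinear_rzero[OF sigma_bilinear] bilinear_lsub[OF sigma_bilinear] bilinear_rsub[OF sigma_bilinear]

lemma sigma_bounded_bilinear: "bounded_bilinear \<sigma>"
  using sigma_bilinear by (simp add: bilinear_conv_bounded_bilinear)

lemma sigma_measurable [measurable]:
  assumes "f \<in> borel_measurable M" "g \<in> borel_measurable M"
  shows "(\<lambda>x. \<sigma> (f x) (g x)) \<in> borel_measurable M"
  by (rule borel_measurable_continuous_Pair[OF assms])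
    (intro bounded_bilinear.continuous_on[OF sigma_bounded_bilinear] continuous_intros)

lemma sigma_linear_left: "linear (\<lambda>x. complex_of_real (\<sigma> x y))"
  and sigma_linear_right: "linear (\<lambda>y. complex_of_real (\<sigma> x y))"
  by (intro linearI; simp add: sigma_simps scaleR_conv_of_real)+

text \<open>The map \<open>A\<close> expresses \<open>\<sigma>\<close> by the inner product;
  non-degeneracy makes it injective, hence surjective in finite dimension. Coordinates and the
  linear forms that define the adjoint of \<open>T\<close> are represented in this way.\<close>

lemma sigma_represents:
  assumes "linear l"
  obtains v where "\<And>x. \<sigma> x v = l x"
proof -
  define A where "A = (\<lambda>y. \<Sum>b\<in>Basis. \<sigma> b y *\<^sub>R b)"
  have A: "x \<bullet> A y = \<sigma> x y" for x y
  proof -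
    have "x \<bullet> A y = (\<Sum>b\<in>Basis. (x \<bullet> b) * \<sigma> b y)"
      by (simp add: A_def inner_sum_right mult.commute)
    also have "\<dots> = \<sigma> (\<Sum>b\<in>Basis. (x \<bullet> b) *\<^sub>R b) y"
    proof -
      have l: "linear (\<lambda>x. \<sigma> x y)" using sigma_bilinear unfolding bilinear_def by blast
      show ?thesis by (simp add: linear_sum[OF l] linear_cmul[OF l])
    qed
    finally show ?thesis by (simp add: euclidean_representation)
  qed
  have lin: "linear A"
    by (intro linearI) (simp_all add: A_def sigma_simps scaleR_left_distrib sum.distrib scaleR_sum_right)
  have "inj A"
    unfolding linear_injective_0[OF lin]
  proof (intro allI impI)
    fix y assume "A y = 0"
    then have "\<sigma> y x = 0" for x using A[of x y] sigma_antisym[of y x] by simp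
    then show "y = 0" by (rule sigma_nondegenerate)
  qed
  then have "surj A" by (rule linear_inj_imp_surj[OF lin])
  then obtain v where v: "A v = (\<Sum>b\<in>Basis. l b *\<^sub>R b)" by (metis surjD)
  have "\<sigma> x v = l x" for x
  proof -
    have "\<sigma> x v = (\<Sum>b\<in>Basis. (x \<bullet> b) * l b)"
      unfolding A[symmetric] v by (simp add: inner_sum_right mult.commute)
    also have "\<dots> = l (\<Sum>b\<in>Basis. (x \<bullet> b) *\<^sub>R b)" by (simp add: linear_sum[OF assms] linear_cmul[OF assms])
    finally show ?thesis by (simp add: euclidean_representation)
  qed
  then show thesis by (rule that)
qed

section \<open>The Fourier transformation with respect to Lebesgue measure\<close>

abbreviation F where "F \<equiv> fourier_wrt lborel \<sigma>"

lemma F_integrable: "f \<in> schwartz \<Longrightarrow> integrable lborel (\<lambda>y. exp (- \<i> * complex_of_real (\<sigma> x y)) * f y)"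
  using schwartz_measurable[of f]
  by (intro Bochner_Integration.integrable_bound[OF schwartz_integrable(1), of f]) (auto intro!: AE_I2 simp: norm_mult)

lemma F_bound:
  assumes "f \<in> schwartz"
  shows "norm (F f x) \<le> schwartz_seminorm (2 * DIM('w)) [] f * weight_int TYPE('w)"
proof -
  have "norm (F f x) \<le> (\<integral>y. norm (exp (- \<i> * complex_of_real (\<sigma> x y)) * f y) \<partial>lborel)"
    unfolding fourier_wrt_def by (rule integral_norm_bound)
  also have "\<dots> = (\<integral>y. norm (f y) \<partial>lborel)" by (simp add: norm_mult)
  also note schwartz_integrable(2)[OF assms]
  finally show ?thesis .
qed

lemma F_add: "f \<in> schwartz \<Longrightarrow> g \<in> schwartz \<Longrightarrow> F (\<lambda>x. f x + g x) x = F f x + F g x"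
  using Bochner_Integration.integral_add[OF F_integrable F_integrable, of f g x x]
  by (simp add: fourier_wrt_def distrib_left)

lemma F_cmult: "F (\<lambda>x. c * f x) x = c * F f x"
  by (simp add: fourier_wrt_def mult.left_commute)

lemma sigma_mult_schwartz:
  "f \<in> schwartz \<Longrightarrow> (\<lambda>y. - \<i> * complex_of_real (\<sigma> v y) * f y) \<in> schwartz"
  by (intro schwartz_mult_Cpol Cpol_mult Cpol_const Cpol_linear sigma_linear_right)

text \<open>Differentiation under the integral with an explicit remainder: |exp(iu) - 1 - iu| is at
  most u^2 / 2, so the error is quadratic in the increment, with a second moment of \<open>f\<close>
  as constant (\<open>J\<close>).\<close>

lemma F_has_derivative:
  assumes f: "f \<in> schwartz"
  shows "(F f has_derivative (\<lambda>v. F (\<lambda>y. - \<i> * complex_of_real (\<sigma> v y) * f y) x)) (at x)"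
proof -
  let ?D = "\<lambda>v. F (\<lambda>y. - \<i> * complex_of_real (\<sigma> v y) * f y) x"
  obtain B where B: "0 \<le> B" "\<And>x y. \<bar>\<sigma> x y\<bar> \<le> norm x * norm y * B"
    using bounded_bilinear.nonneg_bounded[OF sigma_bounded_bilinear] by auto
  have [measurable]: "f \<in> borel_measurable borel" using f by (rule schwartz_measurable)
  define J where "J = B\<^sup>2 * (\<integral>y. norm (f y * complex_of_real ((norm y)\<^sup>2)) \<partial>lborel)"
  have int2: "integrable lborel (\<lambda>y. f y * complex_of_real ((norm y)\<^sup>2))"
  proof (rule schwartz_mult_integrable(1)[OF f, of _ 1 2])
    fix y :: 'w show "norm (complex_of_real ((norm y)\<^sup>2)) \<le> 1 * (1 + norm y)\<^sup>2"
      by (simp add: norm_power power2_sum)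
  qed simp
  have lin: "linear ?D"
  proof (rule linearI)
    fix v w
    have "(\<lambda>y. - \<i> * complex_of_real (\<sigma> (v + w) y) * f y) =
        (\<lambda>y. - \<i> * complex_of_real (\<sigma> v y) * f y + - \<i> * complex_of_real (\<sigma> w y) * f y)"
      by (simp add: sigma_simps algebra_simps)
    then show "?D (v + w) = ?D v + ?D w"
      using F_add[OF sigma_mult_schwartz[OF f] sigma_mult_schwartz[OF f]] by simp
  next
    fix r v
    have "(\<lambda>y. - \<i> * complex_of_real (\<sigma> (r *\<^sub>R v) y) * f y) =
        (\<lambda>y. complex_of_real r * (- \<i> * complex_of_real (\<sigma> v y) * f y))"
      by (simp add: sigma_simps algebra_simps)
    then show "?D (r *\<^sub>R v) = r *\<^sub>R ?D v"
      by (simp only: F_cmult scaleR_conv_of_real)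
  qed
  show ?thesis
  proof (rule has_derivativeI_sandwich[where e = 1 and H = "\<lambda>z. J * norm (z - x)"])
    show "bounded_linear ?D" using lin by (simp add: linear_conv_bounded_linear)
    show "((\<lambda>z. J * norm (z - x)) \<longlongrightarrow> 0) (at x)"
      by (rule tendsto_eq_intros refl | simp)+
    fix z assume "z \<noteq> x"
    let ?h = "z - x"
    let ?e = "\<lambda>y. exp (- \<i> * complex_of_real (\<sigma> x y)) * ((exp (\<i> * complex_of_real (- \<sigma> ?h y)) - 1 - \<i> * complex_of_real (- \<sigma> ?h y)) * f y)"
    have "F f z - F f x - ?D ?h = (\<integral>y. ?e y \<partial>lborel)"
    proof -
      have "F f z - F f x - ?D ?h = (\<integral>y. exp (- \<i> * complex_of_real (\<sigma> z y)) * f y - exp (- \<i> * complex_of_real (\<sigma> x y)) * f y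
         - exp (- \<i> * complex_of_real (\<sigma> x y)) * (- \<i> * complex_of_real (\<sigma> ?h y) * f y) \<partial>lborel)"
        unfolding fourier_wrt_def
        by (subst Bochner_Integration.integral_diff Bochner_Integration.integral_diff,
            (intro Bochner_Integration.integrable_diff F_integrable f sigma_mult_schwartz)+)+ simp
      also have "\<dots> = (\<integral>y. ?e y \<partial>lborel)"
      proof (rule Bochner_Integration.integral_cong[OF refl])
        fix y
        have "exp (- \<i> * complex_of_real (\<sigma> z y)) = exp (- \<i> * complex_of_real (\<sigma> x y)) * exp (\<i> * complex_of_real (- \<sigma> ?h y))"
          by (simp add: sigma_simps algebra_simps flip: exp_add)
        then show "exp (- \<i> * complex_of_real (\<sigma> z y)) * f y - exp (- \<i> * complex_of_real (\<sigma> x y)) * f y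
         - exp (- \<i> * complex_of_real (\<sigma> x y)) * (- \<i> * complex_of_real (\<sigma> ?h y) * f y) = ?e y"
          by (simp add: algebra_simps)
      qed
      finally show ?thesis .
    qed
    also have "norm \<dots> \<le> (\<integral>y. (norm ?h)\<^sup>2 * B\<^sup>2 * norm (f y * complex_of_real ((norm y)\<^sup>2)) \<partial>lborel)"
    proof -
      have est: "norm (?e y) \<le> (norm ?h)\<^sup>2 * B\<^sup>2 * norm (f y * complex_of_real ((norm y)\<^sup>2))" for y
      proof -
        have "norm (exp (\<i> * complex_of_real (- \<sigma> ?h y)) - 1 - \<i> * complex_of_real (- \<sigma> ?h y)) \<le> \<bar>- \<sigma> ?h y\<bar>\<^sup>2 / 2"
        proof -
          have "(\<Sum>k\<le>1. (\<i> * complex_of_real u) ^ k / fact k) = 1 + \<i> * complex_of_real u" for u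
            by simp
          then show ?thesis
            using iexp_approx1[of "- \<sigma> ?h y" 1] by (simp only: diff_diff_eq) (simp add: numeral_2_eq_2)
        qed
        also have "\<dots> \<le> \<bar>\<sigma> ?h y\<bar>\<^sup>2" by simp
        also have "\<dots> \<le> (norm ?h * norm y * B)\<^sup>2" by (intro power_mono B) auto
        finally have "norm (exp (\<i> * complex_of_real (- \<sigma> ?h y)) - 1 - \<i> * complex_of_real (- \<sigma> ?h y)) * norm (f y)
            \<le> (norm ?h * norm y * B)\<^sup>2 * norm (f y)" by (rule mult_right_mono) simp
        moreover have "norm (?e y) = norm (exp (\<i> * complex_of_real (- \<sigma> ?h y)) - 1 - \<i> * complex_of_real (- \<sigma> ?h y)) * norm (f y)"
          by (subst norm_mult, subst norm_mult) simp
        moreover have "(norm ?h * norm y * B)\<^sup>2 * norm (f y) = (norm ?h)\<^sup>2 * B\<^sup>2 * norm (f y * complex_of_real ((norm y)\<^sup>2))"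
          by (simp add: norm_mult norm_power power_mult_distrib)
        ultimately show ?thesis by linarith
      qed
      have int: "integrable lborel (\<lambda>y. (norm ?h)\<^sup>2 * B\<^sup>2 * norm (f y * complex_of_real ((norm y)\<^sup>2)))"
        by (intro integrable_mult_right integrable_norm int2)
      have "integrable lborel ?e"
      proof (rule Bochner_Integration.integrable_bound[OF int])
        show "?e \<in> borel_measurable lborel" by measurable
        show "AE y in lborel. norm (?e y) \<le> norm ((norm ?h)\<^sup>2 * B\<^sup>2 * norm (f y * complex_of_real ((norm y)\<^sup>2)))"
          unfolding real_norm_def by (intro AE_I2 order_trans[OF est abs_ge_self])
      qed
      then show ?thesis
        by (intro order_trans[OF integral_norm_bound integral_mono] integrable_norm int est)
    qed
    also have "\<dots> = J * norm ?h * norm ?h" by (simp add: J_def power2_eq_square)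
    finally show "norm (F f z - F f x - ?D ?h) / norm ?h \<le> J * norm ?h"
      using \<open>z \<noteq> x\<close> by (simp add: pos_divide_le_eq)
  qed simp
qed

lemma dderiv_F: "f \<in> schwartz \<Longrightarrow> dderiv v (F f) = F (\<lambda>y. - \<i> * complex_of_real (\<sigma> v y) * f y)"
  by (rule dderiv_eqI[OF F_has_derivative])

lemma smooth_F: "f \<in> schwartz \<Longrightarrow> smooth (F f)"
proof (rule smooth_coinduct[where \<C> = "F ` schwartz"])
  fix g v x assume "g \<in> F ` schwartz"
  then obtain a where a: "g = F a" "a \<in> schwartz" by blast
  show "dderiv v g \<in> F ` schwartz"
    unfolding a(1) dderiv_F[OF a(2)] by (rule imageI[OF sigma_mult_schwartz[OF a(2)]])
  show "g differentiable (at x)"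
    unfolding a(1) differentiable_def using F_has_derivative[OF a(2)] by blast
qed simp

text \<open>Instead of integrating by parts, difference quotients of \<open>f\<close> are
  transformed. A translation of \<open>f\<close> multiplies the transform by a character, whose own
  difference quotient converges to the asserted factor; the translation estimate supplies the
  integrable majorant.\<close>

lemma F_dderiv:
  assumes f: "f \<in> schwartz"
  shows "F (dderiv v f) x = \<i> * complex_of_real (\<sigma> x v) * F f x"
proof -
  define t where "t = (\<lambda>n::nat. inverse (real (Suc n)))"
  have t: "t \<longlonglongrightarrow> 0" "\<And>n. 0 < t n" "\<And>n. t n \<le> 1"
    unfolding t_def by (rule LIMSEQ_inverse_real_of_nat) (auto simp: inverse_le_1_iff)
  have [measurable]: "f \<in> borel_measurable borel" using f by (rule schwartz_measurable)
  have [measurable]: "dderiv v f \<in> borel_measurable borel" by (intro schwartz_measurable schwartz_dderiv f)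
  let ?ch = "\<lambda>y. exp (- \<i> * complex_of_real (\<sigma> x y))"
  let ?q = "\<lambda>n y. (f (y + t n *\<^sub>R v) - f y) /\<^sub>R t n"
  let ?n = "2 * DIM('w)"
  let ?C = "norm v * ((1 + norm v) ^ ?n * (\<Sum>b\<in>Basis. schwartz_seminorm ?n [b] f))"
  have "(\<lambda>n. \<integral>y. ?ch y * ?q n y \<partial>lborel) \<longlonglongrightarrow> (\<integral>y. ?ch y * dderiv v f y \<partial>lborel)"
  proof (rule integral_dominated_convergence[where w = "\<lambda>y. ?C * (1 / (1 + norm y) ^ ?n)"])
    show "integrable lborel (\<lambda>y::'w. ?C * (1 / (1 + norm y) ^ ?n))"
      by (intro integrable_mult_right integrable_weight)
    show "AE y in lborel. (\<lambda>n. ?ch y * ?q n y) \<longlonglongrightarrow> ?ch y * dderiv v f y"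
      using t(1,2) by (intro AE_I2 tendsto_mult tendsto_const directional_difference_quotient
          smooth_has_derivative schwartz_smooth f)
    fix n
    show "AE y in lborel. norm (?ch y * ?q n y) \<le> ?C * (1 / (1 + norm y) ^ ?n)"
    proof (rule AE_I2)
      fix y :: 'w
      have p: "0 < (1 + norm y) ^ ?n" by (intro zero_less_power add_pos_nonneg) auto
      have "norm (t n *\<^sub>R v) \<le> norm v" using t(2,3)[of n] by (simp add: mult_left_le_one_le)
      then have "(1 + norm (t n *\<^sub>R v)) ^ ?n \<le> (1 + norm v) ^ ?n" by (intro power_mono) auto
      then have "norm (t n *\<^sub>R v) * ((1 + norm (t n *\<^sub>R v)) ^ ?n * (\<Sum>b\<in>Basis. schwartz_seminorm ?n [b] f))
        \<le> norm (t n *\<^sub>R v) * ((1 + norm v) ^ ?n * (\<Sum>b\<in>Basis. schwartz_seminorm ?n [b] f))"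
        by (intro mult_left_mono mult_right_mono sum_nonneg schwartz_seminorm_nonneg f) auto
      note B = this
      have A: "(1 + norm y) ^ ?n * norm (f (y + t n *\<^sub>R v) - f y) \<le>
          norm (t n *\<^sub>R v) * ((1 + norm (t n *\<^sub>R v)) ^ ?n * (\<Sum>b\<in>Basis. schwartz_seminorm ?n [b] f))"
        using schwartz_translate_diff_bound[OF f, of y ?n "[]" "t n *\<^sub>R v" 0] by (simp add: add.commute)
      have "(1 + norm y) ^ ?n * norm (f (y + t n *\<^sub>R v) - f y) \<le> t n * ?C"
        using order_trans[OF A B] t(2)[of n] by (simp add: mult.assoc)
      then show "norm (?ch y * ?q n y) \<le> ?C * (1 / (1 + norm y) ^ ?n)"
      proof -
        have "norm (?ch y * ?q n y) = norm (f (y + t n *\<^sub>R v) - f y) / t n"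
          using t(2)[of n] by (simp add: norm_mult divide_inverse mult.commute)
        also have "\<dots> \<le> ?C / (1 + norm y) ^ ?n"
          using \<open>_ \<le> t n * ?C\<close> p t(2)[of n] by (simp add: pos_divide_le_eq pos_le_divide_eq mult.commute)
        finally show ?thesis by simp
      qed
    qed
  qed measurable
  \<comment> \<open>The terms with 0 are kept so that the first factor is literally a difference
    quotient of the character at the origin.\<close>
  moreover have "(\<integral>y. ?ch y * ?q n y \<partial>lborel) = ((exp (\<i> * complex_of_real (\<sigma> x (0 + t n *\<^sub>R v))) - exp (\<i> * complex_of_real (\<sigma> x 0))) /\<^sub>R t n) * F f x" for n
  proof -
    have fs: "(\<lambda>y. f (y + t n *\<^sub>R v)) \<in> schwartz" using schwartz_translate[OF f, of "t n *\<^sub>R v"] by (simp add: add.commute)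
    have c: "exp (\<i> * complex_of_real (\<sigma> x u)) * ?ch (u + y) = ?ch y" for u y
      by (simp add: sigma_simps algebra_simps flip: exp_add)
    have m: "(\<lambda>y. ?ch y * f y) \<in> borel_measurable borel" by measurable
    have "(\<integral>y. ?ch y * f (y + t n *\<^sub>R v) \<partial>lborel) = (\<integral>y. exp (\<i> * complex_of_real (\<sigma> x (t n *\<^sub>R v))) * (?ch (t n *\<^sub>R v + y) * f (t n *\<^sub>R v + y)) \<partial>lborel)"
      by (simp only: mult.assoc[symmetric] c add.commute[of _ "t n *\<^sub>R v"])
    also have "\<dots> = exp (\<i> * complex_of_real (\<sigma> x (t n *\<^sub>R v))) * F f x"
      using lborel_integral_translate[OF m, of "t n *\<^sub>R v"]
      by (simp only: integral_mult_right_zero fourier_wrt_def)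
    finally have *: "(\<integral>y. ?ch y * f (y + t n *\<^sub>R v) \<partial>lborel) = exp (\<i> * complex_of_real (\<sigma> x (t n *\<^sub>R v))) * F f x" .
    have "(\<integral>y. ?ch y * ?q n y \<partial>lborel) = (\<integral>y. (?ch y * f (y + t n *\<^sub>R v) - ?ch y * f y) /\<^sub>R t n \<partial>lborel)"
      by (simp add: right_diff_distrib)
    also have "\<dots> = (exp (\<i> * complex_of_real (\<sigma> x (t n *\<^sub>R v))) * F f x - F f x) /\<^sub>R t n"
      using Bochner_Integration.integral_diff[OF F_integrable[OF fs, of x] F_integrable[OF f, of x]] *
      by (simp add: fourier_wrt_def)
    finally show ?thesis by (simp add: sigma_simps algebra_simps)
  qed
  moreover have "(\<lambda>n. ((exp (\<i> * complex_of_real (\<sigma> x (0 + t n *\<^sub>R v))) - exp (\<i> * complex_of_real (\<sigma> x 0))) /\<^sub>R t n) * F f x)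
      \<longlonglongrightarrow> (\<i> * complex_of_real (\<sigma> x v)) * F f x"
  proof (intro tendsto_mult tendsto_const)
    have "((\<lambda>y. \<i> * complex_of_real (\<sigma> x y)) has_derivative (\<lambda>v. \<i> * complex_of_real (\<sigma> x v))) (at 0)"
      using has_derivative_mult_right[OF bounded_linear_imp_has_derivative[OF sigma_linear_right[unfolded linear_conv_bounded_linear]]] .
    from has_derivative_compose[OF this DERIV_exp[unfolded has_field_derivative_def]]
    have "((\<lambda>y. exp (\<i> * complex_of_real (\<sigma> x y))) has_derivative (\<lambda>v. \<i> * complex_of_real (\<sigma> x v))) (at 0)"
      by (simp add: sigma_simps)
    from directional_difference_quotient[OF this t(1,2)]
    show "(\<lambda>n. (exp (\<i> * complex_of_real (\<sigma> x (0 + t n *\<^sub>R v))) - exp (\<i> * complex_of_real (\<sigma> x 0))) /\<^sub>R t n) \<longlonglongrightarrow> \<i> * complex_of_real (\<sigma> x v)" .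
  qed
  ultimately show ?thesis
    unfolding fourier_wrt_def by (simp only:) (rule LIMSEQ_unique)
qed

text \<open>A derivative of the transform is the transform of \<open>K v\<close> times a linear
  form, and a power of the weight costs derivatives of \<open>K v\<close>. Both operations preserve
  the hypothesis on \<open>K\<close>, which is therefore generalised; in the end only
  \<open>F_bound\<close> is needed.\<close>

lemma schwartz_valued_F:
  assumes "schwartz_valued V P K"
  shows "schwartz_valued V P (\<lambda>v. F (K v))"
proof (rule schwartz_valuedI)
  fix N vs
  show "dominated V P (\<lambda>v x. (1 + norm x) ^ N * norm (dir_derivs vs (F (K v)) x))"
    using assms
  proof (induction vs arbitrary: K rule: rev_induct)
    case Nil
    then show ?case
    proof (induction N arbitrary: K)
      case 0
      have nn: "0 \<le> weight_int TYPE('w)" unfolding weight_int_def by (intro integral_nonneg_AE) auto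
      have "dominated V P (\<lambda>v (i::unit). weight_int TYPE('w) * schwartz_seminorm (2 * DIM('w)) [] (K v))"
        by (intro dominated_cmult schwartz_valued_seminorm 0 nn)
      then show ?case
        by (rule dominated_mono) (use F_bound[OF schwartz_valued_mem[OF 0]] in \<open>simp add: mult.commute\<close>)
    next
      case (Suc N)
      \<comment> \<open>Each coordinate has the form \<open>\<sigma> x (r b)\<close>, so multiplying
        the transform by it amounts to differentiating \<open>K v\<close>; the absolute values of
        the coordinates together bound \<open>norm x\<close>.\<close>
      have "\<exists>v. \<forall>x. \<sigma> x v = x \<bullet> b" for b
        by (rule sigma_represents[of "\<lambda>x. x \<bullet> b"]) (auto intro!: linearI simp: inner_left_distrib)
      then obtain r where r: "\<And>b x. \<sigma> x (r b) = x \<bullet> b" by metis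
      have "dominated V P (\<lambda>v x. (1 + norm x) ^ N * norm (dir_derivs [] (F (K v)) x) +
          (\<Sum>b\<in>Basis. (1 + norm x) ^ N * norm (dir_derivs [] (F (dderiv (r b) (K v))) x)))"
        by (intro dominated_add dominated_sum Suc.IH schwartz_valued_dderiv Suc.prems) simp
      then show ?case
      proof (rule dominated_le)
        fix v x assume v: "v \<in> V"
        have "norm (F (dderiv (r b) (K v)) x) = \<bar>x \<bullet> b\<bar> * norm (F (K v) x)" for b
          by (simp add: F_dderiv[OF schwartz_valued_mem[OF Suc.prems v]] r norm_mult)
        then have "(1 + norm x) ^ N * norm (F (K v) x) + (\<Sum>b\<in>Basis. (1 + norm x) ^ N * norm (F (dderiv (r b) (K v)) x))
            = (1 + norm x) ^ N * norm (F (K v) x) + (\<Sum>b\<in>Basis. \<bar>x \<bullet> b\<bar> * ((1 + norm x) ^ N * norm (F (K v) x)))"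
          by (simp add: mult.left_commute)
        also have "\<dots> = (1 + (\<Sum>b\<in>Basis. \<bar>x \<bullet> b\<bar>)) * ((1 + norm x) ^ N * norm (F (K v) x))"
          by (simp only: sum_distrib_right[symmetric] distrib_right mult_1_left)
        also have "\<dots> \<ge> (1 + norm x) * ((1 + norm x) ^ N * norm (F (K v) x))"
          using norm_le_l1[of x] by (intro mult_right_mono) auto
        finally show "(1 + norm x) ^ Suc N * norm (dir_derivs [] (F (K v)) x) \<le>
          (1 + norm x) ^ N * norm (dir_derivs [] (F (K v)) x) +
          (\<Sum>b\<in>Basis. (1 + norm x) ^ N * norm (dir_derivs [] (F (dderiv (r b) (K v))) x))"
          by simp
      qed
    qed
  next
    case (snoc w vs)
    show ?case
    proof (rule dominated_le[OF snoc.IH])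
      show "schwartz_valued V P (\<lambda>v y. - \<i> * complex_of_real (\<sigma> w y) * K v y)"
        by (intro schwartz_valued_mult_Cpol snoc.prems Cpol_mult Cpol_const Cpol_linear sigma_linear_right)
      fix v x assume "v \<in> V"
      then show "(1 + norm x) ^ N * norm (dir_derivs (vs @ [w]) (F (K v)) x) \<le>
        (1 + norm x) ^ N * norm (dir_derivs vs (F (\<lambda>y. - \<i> * complex_of_real (\<sigma> w y) * K v y)) x)"
        by (simp add: dir_derivs_snoc dderiv_F schwartz_valued_mem[OF snoc.prems])
    qed
  qed
qed (intro smooth_F schwartz_valued_mem[OF assms])

lemma schwartz_F: "f \<in> schwartz \<Longrightarrow> F f \<in> schwartz"
  unfolding schwartz_iff_valued by (rule schwartz_valued_F)

lemma kernel_compose: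
  "exp (- \<i> * complex_of_real (\<sigma> x y)) * exp (- \<i> * complex_of_real (\<sigma> y z)) =
    exp (- \<i> * complex_of_real (\<sigma> (x - z) y))"
  \<comment> \<open>Antisymmetry turns the second kernel around. Two transformations with the same
    sign in the exponent therefore invert each other, without a reflection.\<close>
  using sigma_antisym[of y z] by (simp add: sigma_simps algebra_simps flip: exp_add)

text \<open>The regularising factor \<open>\<kappa>(\<epsilon> y)\<close> makes the double integral absolutely convergent.  After the
  exchange of the integrations the inner one is a rescaled approximate identity of mass \<open>\<integral> F \<kappa>\<close>.\<close>

lemma F_F_gaussian:
  fixes \<kappa> :: "'w \<Rightarrow> complex"
  defines "\<kappa> \<equiv> (\<lambda>x. exp (- complex_of_real (x \<bullet> x)))"
  assumes a: "a \<in> schwartz"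
  shows "F (F a) x = (\<integral>w. F \<kappa> w \<partial>lborel) * a x"
proof -
  have \<kappa>: "\<kappa> \<in> schwartz" unfolding \<kappa>_def by (rule gaussian_schwartz)
  have \<kappa>1: "norm (\<kappa> y) \<le> 1" and \<kappa>0: "\<kappa> 0 = 1" for y by (simp_all add: \<kappa>_def)
  have [measurable]: "a \<in> borel_measurable borel" "\<kappa> \<in> borel_measurable borel"
      "F a \<in> borel_measurable borel" "F \<kappa> \<in> borel_measurable borel"
    using a \<kappa> by (auto intro!: schwartz_measurable schwartz_F)
  define e where "e = (\<lambda>n::nat. inverse (real (Suc n)))"
  have e: "e \<longlonglongrightarrow> 0" "\<And>n. 0 < e n"
    unfolding e_def by (rule LIMSEQ_inverse_real_of_nat) auto
  have a_bd: "norm (a y) \<le> schwartz_seminorm 0 [] a" for y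
    using schwartz_seminorm_ge[OF a, of y 0 "[]"] by simp
  let ?ch = "\<lambda>x y. exp (- \<i> * complex_of_real (\<sigma> x y))"
  have \<kappa>e: "integrable lborel (\<lambda>y. \<kappa> (e n *\<^sub>R y))" for n
  proof -
    have "integrable lborel (\<lambda>y. \<kappa> (0 + e n *\<^sub>R y))"
    proof -
      have "integrable (density (distr lborel borel (\<lambda>x. 0 + (1 / e n) *\<^sub>R x)) (\<lambda>_. ennreal (\<bar>1 / e n\<bar> ^ DIM('w)))) (\<lambda>y. \<kappa> (0 + e n *\<^sub>R y))"
        using schwartz_integrable(1)[OF \<kappa>] e(2)[of n] by (simp add: integrable_density integrable_distr_eq)
      then show ?thesis using lborel_affine[of "1 / e n" "0::'w"] e(2)[of n] by simp
    qed
    then show ?thesis by simp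
  qed
  have "(\<lambda>n. \<integral>y. ?ch x y * (\<kappa> (e n *\<^sub>R y) * F a y) \<partial>lborel) \<longlonglongrightarrow> (\<integral>y. ?ch x y * F a y \<partial>lborel)"
  proof (rule integral_dominated_convergence[where w = "\<lambda>y. norm (F a y)"])
    show "integrable lborel (\<lambda>y. norm (F a y))"
      by (intro integrable_norm schwartz_integrable schwartz_F a)
    show "AE y in lborel. (\<lambda>n. ?ch x y * (\<kappa> (e n *\<^sub>R y) * F a y)) \<longlonglongrightarrow> ?ch x y * F a y"
    proof (rule AE_I2)
      fix y :: 'w
      have "(\<lambda>n. e n *\<^sub>R y) \<longlonglongrightarrow> 0" using tendsto_scaleR[OF e(1) tendsto_const[of y]] by simp
      moreover have "isCont \<kappa> 0" unfolding \<kappa>_def by (intro continuous_intros)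
      ultimately have "(\<lambda>n. \<kappa> (e n *\<^sub>R y)) \<longlonglongrightarrow> 1" using isCont_tendsto_compose \<kappa>0 by metis
      from tendsto_mult[OF tendsto_const tendsto_mult[OF this tendsto_const]]
      show "(\<lambda>n. ?ch x y * (\<kappa> (e n *\<^sub>R y) * F a y)) \<longlonglongrightarrow> ?ch x y * F a y" by simp
    qed
    show "AE y in lborel. norm (?ch x y * (\<kappa> (e n *\<^sub>R y) * F a y)) \<le> norm (F a y)" for n
      using \<kappa>1 by (intro AE_I2) (simp add: norm_mult mult_left_le_one_le)
  qed measurable
  moreover have "(\<integral>y. ?ch x y * (\<kappa> (e n *\<^sub>R y) * F a y) \<partial>lborel) = (\<integral>w. a (x - e n *\<^sub>R w) * F \<kappa> w \<partial>lborel)" for n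
  proof -
    have en: "e n \<noteq> 0" "0 < e n" using e(2)[of n] by auto
    have "(\<integral>y. ?ch x y * (\<kappa> (e n *\<^sub>R y) * F a y) \<partial>lborel) =
        (\<integral>y. (\<integral>z. ?ch (x - z) y * (\<kappa> (e n *\<^sub>R y) * a z) \<partial>lborel) \<partial>lborel)"
      unfolding fourier_wrt_def by (simp only: integral_mult_right_zero[symmetric] kernel_compose[symmetric] mult_ac)
    also have "\<dots> = (\<integral>z. (\<integral>y. ?ch (x - z) y * (\<kappa> (e n *\<^sub>R y) * a z) \<partial>lborel) \<partial>lborel)"
      using lborel_Fubini_kernel[OF \<kappa>e[of n] schwartz_integrable(1)[OF a], of "\<lambda>(y, z). ?ch (x - z) y"]
      by (simp add: case_prod_beta')
    also have "\<dots> = (\<integral>z. a z * (\<integral>y. ?ch (x - z) y * \<kappa> (e n *\<^sub>R y) \<partial>lborel) \<partial>lborel)"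
      by (simp only: integral_mult_right_zero[symmetric] mult_ac)
    also have "\<dots> = (\<integral>z. a (x - z) * (\<integral>y. ?ch z y * \<kappa> (e n *\<^sub>R y) \<partial>lborel) \<partial>lborel)"
      by (subst lborel_integral_reflect[symmetric, of _ x]) (auto simp: case_prod_beta')
    also have "\<dots> = \<bar>e n\<bar> ^ DIM('w) *\<^sub>R (\<integral>w. a (x - e n *\<^sub>R w) * (\<integral>y. ?ch (e n *\<^sub>R w) y * \<kappa> (e n *\<^sub>R y) \<partial>lborel) \<partial>lborel)"
      by (subst lborel_integral_scale[OF _ en(1), of _ 0]) (auto simp: case_prod_beta')
    also have "\<dots> = (\<integral>w. a (x - e n *\<^sub>R w) * (\<bar>e n\<bar> ^ DIM('w) *\<^sub>R (\<integral>y. ?ch (e n *\<^sub>R w) y * \<kappa> (e n *\<^sub>R y) \<partial>lborel)) \<partial>lborel)"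
      by simp
    \<comment> \<open>The Jacobian is exactly what the substitution in the inner integral consumes,
      and bilinearity of \<open>\<sigma>\<close> moves the factor \<open>e n\<close> from one
      argument to the other.\<close>
    also have "\<dots> = (\<integral>w. a (x - e n *\<^sub>R w) * F \<kappa> w \<partial>lborel)"
    proof (rule Bochner_Integration.integral_cong[OF refl])
      fix w
      have "F \<kappa> w = \<bar>e n\<bar> ^ DIM('w) *\<^sub>R (\<integral>y. ?ch w (0 + e n *\<^sub>R y) * \<kappa> (0 + e n *\<^sub>R y) \<partial>lborel)"
        unfolding fourier_wrt_def by (rule lborel_integral_scale[OF _ en(1)]) measurable
      then show "a (x - e n *\<^sub>R w) * (\<bar>e n\<bar> ^ DIM('w) *\<^sub>R (\<integral>y. ?ch (e n *\<^sub>R w) y * \<kappa> (e n *\<^sub>R y) \<partial>lborel)) =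
          a (x - e n *\<^sub>R w) * F \<kappa> w"
        by (simp add: sigma_simps)
    qed
    finally show ?thesis .
  qed
  moreover have "(\<lambda>n. \<integral>w. a (x - e n *\<^sub>R w) * F \<kappa> w \<partial>lborel) \<longlonglongrightarrow> (\<integral>w. a x * F \<kappa> w \<partial>lborel)"
  proof (rule integral_dominated_convergence[where w = "\<lambda>w. schwartz_seminorm 0 [] a * norm (F \<kappa> w)"])
    show "integrable lborel (\<lambda>w. schwartz_seminorm 0 [] a * norm (F \<kappa> w))"
      by (intro integrable_mult_right integrable_norm schwartz_integrable schwartz_F \<kappa>)
    show "AE w in lborel. (\<lambda>n. a (x - e n *\<^sub>R w) * F \<kappa> w) \<longlonglongrightarrow> a x * F \<kappa> w"
    proof (rule AE_I2)
      fix w :: 'w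
      have "(\<lambda>n. x - e n *\<^sub>R w) \<longlonglongrightarrow> x"
        using tendsto_diff[OF tendsto_const[of x] tendsto_scaleR[OF e(1) tendsto_const[of w]]] by simp
      moreover have "isCont a x"
        using smooth_continuous[OF schwartz_smooth[OF a], of UNIV] by (simp add: continuous_on_eq_continuous_at)
      ultimately have "(\<lambda>n. a (x - e n *\<^sub>R w)) \<longlonglongrightarrow> a x" using isCont_tendsto_compose by metis
      then show "(\<lambda>n. a (x - e n *\<^sub>R w) * F \<kappa> w) \<longlonglongrightarrow> a x * F \<kappa> w" by (intro tendsto_mult tendsto_const)
    qed
    show "AE w in lborel. norm (a (x - e n *\<^sub>R w) * F \<kappa> w) \<le> schwartz_seminorm 0 [] a * norm (F \<kappa> w)" for n
      by (intro AE_I2) (simp add: norm_mult mult_right_mono a_bd)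
  qed measurable
  ultimately show ?thesis
    unfolding fourier_wrt_def[of lborel \<sigma> "F a"] by (simp add: LIMSEQ_unique mult.commute)
qed

text \<open>Conjugating the kernel exchanges its two arguments, by antisymmetry; the rest is
  Fubini.\<close>

lemma F_self_adjoint:
  assumes f: "f \<in> schwartz" and g: "g \<in> schwartz"
  shows "(\<integral>x. cnj (F f x) * g x \<partial>lborel) = (\<integral>x. cnj (f x) * F g x \<partial>lborel)"
proof -
  have k: "cnj (exp (- \<i> * complex_of_real (\<sigma> x y))) = exp (- \<i> * complex_of_real (\<sigma> y x))" for x y
    using sigma_antisym[of x y] by (simp add: exp_cnj)
  have "(\<integral>x. cnj (F f x) * g x \<partial>lborel) =
      (\<integral>x. (\<integral>y. exp (- \<i> * complex_of_real (\<sigma> y x)) * (g x * cnj (f y)) \<partial>lborel) \<partial>lborel)"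
  proof -
    have "cnj (F f x) = (\<integral>y. exp (- \<i> * complex_of_real (\<sigma> y x)) * cnj (f y) \<partial>lborel)" for x
      unfolding fourier_wrt_def by (simp only: Bochner_Integration.integral_cnj[symmetric] complex_cnj_mult k)
    then show ?thesis by (simp only: integral_mult_right_zero[symmetric] mult_ac)
  qed
  also have "\<dots> = (\<integral>y. (\<integral>x. exp (- \<i> * complex_of_real (\<sigma> y x)) * (g x * cnj (f y)) \<partial>lborel) \<partial>lborel)"
    using lborel_Fubini_kernel[OF schwartz_integrable(1)[OF g] schwartz_integrable(1)[OF schwartz_cnj[OF f]],
        of "\<lambda>(x, y). exp (- \<i> * complex_of_real (\<sigma> y x))"]
    by (simp add: case_prod_beta')
  also have "\<dots> = (\<integral>x. cnj (f x) * F g x \<partial>lborel)"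
    unfolding fourier_wrt_def by (simp only: integral_mult_right_zero[symmetric] mult_ac)
  finally show ?thesis .
qed

text \<open>\<open>F\<close> is symmetric, so \<open>\<parallel>F f\<parallel>\<^sup>2 = \<langle>f, F (F f)\<rangle>\<close>; this makes the constant positive without
  computing it.\<close>

lemma F_F: "\<exists>C>0. \<forall>f\<in>schwartz. F (F f) = (\<lambda>x. complex_of_real C * f x)"
proof -
  define \<kappa> :: "'w \<Rightarrow> complex" where "\<kappa> = (\<lambda>x. exp (- complex_of_real (x \<bullet> x)))"
  define c where "c = (\<integral>w. F \<kappa> w \<partial>lborel)"
  have FF: "F (F f) x = c * f x" if "f \<in> schwartz" for f x
    unfolding c_def \<kappa>_def by (rule F_F_gaussian[OF that])
  have \<kappa>: "\<kappa> \<in> schwartz" unfolding \<kappa>_def by (rule gaussian_schwartz)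
  have sq: "cnj z * z = complex_of_real ((norm z)\<^sup>2)" for z
    by (metis complex_norm_square mult.commute)
  have l2: "integrable lborel (\<lambda>x. (norm (f x))\<^sup>2)" "(\<exists>x. f x \<noteq> 0) \<Longrightarrow> 0 < (\<integral>x. (norm (f x))\<^sup>2 \<partial>lborel)"
    if f: "f \<in> schwartz" for f :: "'w \<Rightarrow> complex"
  proof -
    have "integrable lborel (\<lambda>x. norm (f x * f x))"
      by (intro integrable_norm schwartz_integrable schwartz_mult_Cpol schwartz_Cpol f)
    then show int: "integrable lborel (\<lambda>x. (norm (f x))\<^sup>2)" by (simp add: norm_mult power2_eq_square)
    assume "\<exists>x. f x \<noteq> 0"
    then have "\<not> (AE x in lborel. f x = 0)"
      using continuous_AE_zero[OF smooth_continuous[OF schwartz_smooth[OF f]]] by blast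
    then have "(\<integral>x. (norm (f x))\<^sup>2 \<partial>lborel) \<noteq> 0"
      using integral_nonneg_eq_0_iff_AE[OF int] by simp
    moreover have "0 \<le> (\<integral>x. (norm (f x))\<^sup>2 \<partial>lborel)" by simp
    ultimately show "0 < (\<integral>x. (norm (f x))\<^sup>2 \<partial>lborel)" by linarith
  qed
  have "\<kappa> 0 \<noteq> 0" by (simp add: \<kappa>_def)
  then have pos1: "0 < (\<integral>x. (norm (\<kappa> x))\<^sup>2 \<partial>lborel)" by (intro l2(2) \<kappa>) blast
  \<comment> \<open>At the origin the character is 1, so the transform is the integral of a positive
    function.\<close>
  have "F \<kappa> 0 \<noteq> 0"
  proof -
    have "F \<kappa> 0 = (\<integral>x. complex_of_real (exp (- (x \<bullet> x))) \<partial>(lborel :: 'w measure))"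
      by (simp add: fourier_wrt_def sigma_simps \<kappa>_def exp_of_real[symmetric])
    also have "\<dots> = complex_of_real (\<integral>x. exp (- (x \<bullet> x)) \<partial>(lborel :: 'w measure))" by simp
    finally have *: "F \<kappa> 0 = complex_of_real (\<integral>x. exp (- (x \<bullet> x)) \<partial>(lborel :: 'w measure))" .
    have int: "integrable (lborel :: 'w measure) (\<lambda>x. exp (- (x \<bullet> x)))"
      using integrable_norm[OF schwartz_integrable(1)[OF \<kappa>]] by (simp add: \<kappa>_def)
    have "\<not> (AE x in (lborel :: 'w measure). exp (- (x \<bullet> x)) = 0)"
      by (simp add: trivial_limit_def[symmetric] ae_filter_eq_bot_iff)
    then show ?thesis using integral_nonneg_eq_0_iff_AE[OF int] by (simp add: *)
  qed
  then have pos2: "0 < (\<integral>x. (norm (F \<kappa> x))\<^sup>2 \<partial>lborel)" by (intro l2(2) schwartz_F \<kappa>) blast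
  have "complex_of_real (\<integral>x. (norm (F \<kappa> x))\<^sup>2 \<partial>lborel) = (\<integral>x. cnj (F \<kappa> x) * F \<kappa> x \<partial>lborel)"
    by (simp only: sq integral_complex_of_real)
  also have "\<dots> = (\<integral>x. cnj (\<kappa> x) * F (F \<kappa>) x \<partial>lborel)"
    by (rule F_self_adjoint[OF \<kappa> schwartz_F[OF \<kappa>]])
  also have "\<dots> = (\<integral>x. c * complex_of_real ((norm (\<kappa> x))\<^sup>2) \<partial>lborel)"
    unfolding FF[OF \<kappa>] sq[symmetric] by (simp only: mult.left_commute)
  also have "\<dots> = c * complex_of_real (\<integral>x. (norm (\<kappa> x))\<^sup>2 \<partial>lborel)"
    by (simp only: integral_mult_right_zero integral_complex_of_real)
  finally have "c = complex_of_real ((\<integral>x. (norm (F \<kappa> x))\<^sup>2 \<partial>lborel) / (\<integral>x. (norm (\<kappa> x))\<^sup>2 \<partial>lborel))"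
    using pos1 by (simp add: field_simps)
  with FF pos1 pos2 show ?thesis
    by (intro exI[of _ "(\<integral>x. (norm (F \<kappa> x))\<^sup>2 \<partial>lborel) / (\<integral>x. (norm (\<kappa> x))\<^sup>2 \<partial>lborel)"]) auto
qed

end

section \<open>The normalised Haar measure\<close>

lemma density_const_lborel:
  fixes f :: "'w::euclidean_space \<Rightarrow> 'b::{banach, second_countable_topology}"
  assumes "0 < k"
  shows "integrable (density lborel (\<lambda>_. ennreal k)) f \<longleftrightarrow> integrable lborel f"
    and "(\<integral>x. f x \<partial>density lborel (\<lambda>_. ennreal k)) = k *\<^sub>R (\<integral>x. f x \<partial>lborel)"
proof -
  have m: "f \<in> borel_measurable borel" if "integrable (density lborel (\<lambda>_. ennreal k)) f \<or> integrable lborel f"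
    using that by (auto dest: borel_measurable_integrable)
  have "integrable (density lborel (\<lambda>_. ennreal k)) f \<longleftrightarrow> integrable lborel f" if "f \<in> borel_measurable borel"
  proof -
    have "integrable lborel f" if "integrable lborel (\<lambda>x. k *\<^sub>R f x)"
      using integrable_scaleR_right[OF that, of "1 / k"] assms by simp
    then show ?thesis using that assms by (subst integrable_density) auto
  qed
  then show iff: "integrable (density lborel (\<lambda>_. ennreal k)) f \<longleftrightarrow> integrable lborel f" using m by blast
  show "(\<integral>x. f x \<partial>density lborel (\<lambda>_. ennreal k)) = k *\<^sub>R (\<integral>x. f x \<partial>lborel)"
  proof (cases "integrable lborel f")
    case True
    then show ?thesis using m assms by (subst integral_density) auto
  next
    case False
    then show ?thesis using iff by (simp add: not_integrable_integral_eq)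
  qed
qed

lemma haar_measure_density_lborel:
  assumes "0 < k"
  shows "haar_measure (density lborel (\<lambda>_. ennreal k) :: 'w::euclidean_space measure)"
  unfolding haar_measure_def
proof (intro conjI allI impI)
  let ?\<mu> = "density lborel (\<lambda>_. ennreal k) :: 'w measure"
  have em: "emeasure ?\<mu> A = ennreal k * emeasure lborel A" if "A \<in> sets borel" for A
    using that by (simp add: emeasure_density_const)
  show "emeasure ?\<mu> UNIV \<noteq> 0" using assms by (simp add: em)
  fix K :: "'w set" assume "compact K"
  then have "emeasure lborel K < \<infinity>" "K \<in> sets borel"
    by (intro emeasure_compact_finite borel_compact; assumption)+
  then show "emeasure ?\<mu> K < \<infinity>" by (simp add: em ennreal_mult_less_top)
next
  fix x :: 'w
  let ?\<mu> = "density lborel (\<lambda>_. ennreal k) :: 'w measure"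
  show "distr ?\<mu> borel (\<lambda>y. x + y) = ?\<mu>"
  proof (rule measure_eqI)
    fix A assume "A \<in> sets (distr ?\<mu> borel (\<lambda>y. x + y))"
    then have A: "A \<in> sets borel" by simp
    have "(\<lambda>y. x + y) -` A \<inter> space borel \<in> sets borel" by (rule measurable_sets[OF _ A]) measurable
    then have A': "(\<lambda>y. x + y) -` A \<in> sets borel" by simp
    have "emeasure lborel ((\<lambda>y. x + y) -` A) = emeasure lborel A"
      using A by (subst (2) lborel_distr_plus[symmetric, of x]) (simp add: emeasure_distr)
    then show "emeasure (distr ?\<mu> borel (\<lambda>y. x + y)) A = emeasure ?\<mu> A"
      using A A' by (simp add: emeasure_distr emeasure_density_const)
  qed simp
qed simp

context symplectic
begin

text \<open>The density of \<open>dsigma \<sigma>\<close> with respect to Lebesgue measure, fixed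
  together with the inversion constant of \<open>F\<close> to which it is tied.\<close>

definition haar_const :: real
  where "haar_const = (SOME k. 0 < k \<and> dsigma \<sigma> = density lborel (\<lambda>_. ennreal k) \<and>
    (\<forall>f\<in>schwartz. F (F f) = (\<lambda>x. complex_of_real (1 / k\<^sup>2) * f x)))"

lemma fourier_wrt_density:
  "0 < k \<Longrightarrow> fourier_wrt (density lborel (\<lambda>_. ennreal k)) \<sigma> f = (\<lambda>x. complex_of_real k * F f x)"
  unfolding fourier_wrt_def by (simp add: density_const_lborel scaleR_conv_of_real)

text \<open>Multiplying the measure by \<open>k\<close> multiplies the twofold transform by
  \<open>k\<^sup>2\<close>, so involutivity forces \<open>k = 1 / sqrt C\<close>. Unitarity follows
  because \<open>F\<close> is symmetric.\<close>

lemma haar_const: "0 < haar_const" "dsigma \<sigma> = density lborel (\<lambda>_. ennreal haar_const)"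
  "f \<in> schwartz \<Longrightarrow> F (F f) = (\<lambda>x. complex_of_real (1 / haar_const\<^sup>2) * f x)"
proof -
  obtain C :: real where C: "0 < C" "\<And>f. f \<in> schwartz \<Longrightarrow> F (F f) = (\<lambda>x. complex_of_real C * f x)"
    using F_F by blast
  define k where "k = 1 / sqrt C"
  have k: "0 < k" "C = 1 / k\<^sup>2" using C(1) by (simp_all add: k_def power_divide)
  define Pr where "Pr \<mu> \<longleftrightarrow> haar_measure \<mu> \<and>
    (\<forall>a\<in>schwartz. fourier_wrt \<mu> \<sigma> (fourier_wrt \<mu> \<sigma> a) = a \<and>
      (\<integral>x. (norm (fourier_wrt \<mu> \<sigma> a x))\<^sup>2 \<partial>\<mu>) = (\<integral>x. (norm (a x))\<^sup>2 \<partial>\<mu>))" for \<mu>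
  have inv: "fourier_wrt (density lborel (\<lambda>_. ennreal c)) \<sigma> (fourier_wrt (density lborel (\<lambda>_. ennreal c)) \<sigma> a)
      = (\<lambda>x. complex_of_real (c\<^sup>2 * C) * a x)" if "a \<in> schwartz" "0 < c" for a c
    unfolding fourier_wrt_density[OF that(2)]
    by (rule ext) (simp add: F_cmult C(2)[OF that(1)] power2_eq_square)
  have "Pr (density lborel (\<lambda>_. ennreal k))"
    unfolding Pr_def
  proof (intro conjI ballI haar_measure_density_lborel k(1))
    fix a :: "'w \<Rightarrow> complex" assume a: "a \<in> schwartz"
    show "fourier_wrt (density lborel (\<lambda>_. ennreal k)) \<sigma> (fourier_wrt (density lborel (\<lambda>_. ennreal k)) \<sigma> a) = a"
      using k by (simp add: inv[OF a])
    have sq: "cnj z * z = complex_of_real ((norm z)\<^sup>2)" for z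
      by (metis complex_norm_square mult.commute)
    have "complex_of_real (\<integral>x. (norm (F a x))\<^sup>2 \<partial>lborel) = (\<integral>x. cnj (F a x) * F a x \<partial>lborel)"
      by (simp only: sq integral_complex_of_real)
    also have "\<dots> = (\<integral>x. cnj (a x) * F (F a) x \<partial>lborel)"
      by (rule F_self_adjoint[OF a schwartz_F[OF a]])
    also have "\<dots> = (\<integral>x. complex_of_real C * complex_of_real ((norm (a x))\<^sup>2) \<partial>lborel)"
      unfolding C(2)[OF a] sq[symmetric] by (simp only: mult.left_commute)
    also have "\<dots> = complex_of_real (C * (\<integral>x. (norm (a x))\<^sup>2 \<partial>lborel))"
      by (simp only: integral_mult_right_zero integral_complex_of_real of_real_mult)
    finally have "(\<integral>x. (norm (F a x))\<^sup>2 \<partial>lborel) = C * (\<integral>x. (norm (a x))\<^sup>2 \<partial>lborel)"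
      by (simp only: of_real_eq_iff)
    then show "(\<integral>x. (norm (fourier_wrt (density lborel (\<lambda>_. ennreal k)) \<sigma> a x))\<^sup>2 \<partial>density lborel (\<lambda>_. ennreal k))
        = (\<integral>x. (norm (a x))\<^sup>2 \<partial>density lborel (\<lambda>_. ennreal k))"
      using k by (simp add: fourier_wrt_density density_const_lborel norm_mult power_mult_distrib)
  qed
  moreover have "\<mu> = density lborel (\<lambda>_. ennreal k)" if "Pr \<mu>" for \<mu>
  proof -
    have haar: "haar_measure \<mu>" using that unfolding Pr_def by blast
    obtain c where c: "0 < c" "\<mu> = density lborel (\<lambda>_. ennreal c)"
      by (rule haar_measure_eq_lborel[OF haar])
    \<comment> \<open>One test function with a non-zero value, here 1 at the origin, determines the
      density.\<close>
    let ?g = "\<lambda>x::'w. exp (- complex_of_real (x \<bullet> x))"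
    have "fourier_wrt \<mu> \<sigma> (fourier_wrt \<mu> \<sigma> ?g) = ?g"
      using that gaussian_schwartz unfolding Pr_def by blast
    then have "(\<lambda>x. complex_of_real (c\<^sup>2 * C) * ?g x) = ?g"
      unfolding c(2) using inv[OF gaussian_schwartz c(1)] by simp
    from fun_cong[OF this, of 0] have "complex_of_real (c\<^sup>2 * C) = 1" by simp
    then have "c\<^sup>2 * C = 1" by (simp only: of_real_eq_1_iff)
    then have "c\<^sup>2 = k\<^sup>2" using k by (simp add: field_simps)
    then show ?thesis using c k by (simp add: power2_eq_iff_nonneg)
  qed
  ultimately have "dsigma \<sigma> = density lborel (\<lambda>_. ennreal k)"
    unfolding dsigma_def Pr_def[symmetric] by (rule the_equality)
  then have "\<exists>k. 0 < k \<and> dsigma \<sigma> = density lborel (\<lambda>_. ennreal k) \<and>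
    (\<forall>f\<in>schwartz. F (F f) = (\<lambda>x. complex_of_real (1 / k\<^sup>2) * f x))"
    using k C by auto
  from someI_ex[OF this, folded haar_const_def]
  show "0 < haar_const" "dsigma \<sigma> = density lborel (\<lambda>_. ennreal haar_const)"
    "f \<in> schwartz \<Longrightarrow> F (F f) = (\<lambda>x. complex_of_real (1 / haar_const\<^sup>2) * f x)" by blast+
qed

lemma sets_dsigma [simp, measurable_cong]: "sets (dsigma \<sigma>) = sets borel"
  by (simp add: haar_const(2))

lemma integrable_dsigma: "integrable (dsigma \<sigma>) f \<longleftrightarrow> integrable lborel f"
  for f :: "'w \<Rightarrow> 'b::{banach, second_countable_topology}"
  unfolding haar_const(2) by (rule density_const_lborel(1)[OF haar_const(1)])

lemma integral_dsigma: "(\<integral>x. f x \<partial>dsigma \<sigma>) = haar_const *\<^sub>R (\<integral>x. f x \<partial>lborel)"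
  for f :: "'w \<Rightarrow> 'b::{banach, second_countable_topology}"
  unfolding haar_const(2) by (rule density_const_lborel(2)[OF haar_const(1)])

lemma AE_dsigma: "(AE x in dsigma \<sigma>. P x) \<longleftrightarrow> (AE x in lborel. P x)"
  unfolding haar_const(2) using haar_const(1) by (simp add: AE_density)

lemma fourier_eq: "fourier \<sigma> f = (\<lambda>x. complex_of_real haar_const * F f x)"
  unfolding fourier_def haar_const(2) by (rule fourier_wrt_density[OF haar_const(1)])

lemma schwartz_valued_fourier: "schwartz_valued V P K \<Longrightarrow> schwartz_valued V P (\<lambda>v. fourier \<sigma> (K v))"
  unfolding fourier_eq by (intro schwartz_valued_cmult schwartz_valued_F)

lemma schwartz_fourier: "f \<in> schwartz \<Longrightarrow> fourier \<sigma> f \<in> schwartz"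
  unfolding schwartz_iff_valued by (rule schwartz_valued_fourier)

lemma fourier_fourier: "f \<in> schwartz \<Longrightarrow> fourier \<sigma> (fourier \<sigma> f) = f"
  using haar_const(1) by (simp add: fourier_eq F_cmult haar_const(3) power2_eq_square)

lemma fourier_add: "f \<in> schwartz \<Longrightarrow> g \<in> schwartz \<Longrightarrow> fourier \<sigma> (\<lambda>x. f x + g x) = (\<lambda>x. fourier \<sigma> f x + fourier \<sigma> g x)"
  by (simp add: fourier_eq F_add distrib_left)

lemma fourier_cmult: "fourier \<sigma> (\<lambda>x. c * f x) = (\<lambda>x. c * fourier \<sigma> f x)"
  by (simp add: fourier_eq F_cmult mult.left_commute)

lemma fourier_modulation:
  "fourier \<sigma> (\<lambda>y. exp (- \<i> * complex_of_real (\<sigma> z y)) * f y) = (\<lambda>x. fourier \<sigma> f (z + x))"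
proof -
  have "exp (- \<i> * complex_of_real (\<sigma> x y)) * (exp (- \<i> * complex_of_real (\<sigma> z y)) * f y) =
      exp (- \<i> * complex_of_real (\<sigma> (z + x) y)) * f y" for x y
    by (simp add: sigma_simps algebra_simps flip: exp_add mult.assoc)
  then show ?thesis by (simp only: fourier_eq fourier_wrt_def)
qed

end

section \<open>Complex Hilbert spaces\<close>

lemma cinner_add_left: "cinner (x + y) z = cinner x z + cinner y (z::'h::complex_hilbert)"
proof -
  have "cinner (x + y) z = cnj (cinner z (x + y))" by (rule cinner_commute)
  also have "\<dots> = cnj (cinner z x) + cnj (cinner z y)" by (simp add: cinner_add_right)
  finally show ?thesis by (simp only: cinner_commute[symmetric])
qed

lemma cinner_scaleC_left: "cinner (a *\<^sub>C x) y = cnj a * cinner x (y::'h::complex_hilbert)"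
proof -
  have "cinner (a *\<^sub>C x) y = cnj (cinner y (a *\<^sub>C x))" by (rule cinner_commute)
  also have "\<dots> = cnj a * cnj (cinner y x)" by (simp add: cinner_scaleC_right)
  finally show ?thesis by (simp only: cinner_commute[symmetric])
qed

lemma scaleC_one [simp]: "1 *\<^sub>C x = (x::'h::complex_hilbert)"
  using scaleR_scaleC[of 1 x] by simp

lemma scaleC_zero_left [simp]: "0 *\<^sub>C x = (0::'h::complex_hilbert)"
  using scaleR_scaleC[of 0 x] by simp

lemma scaleC_minus_one: "(-1) *\<^sub>C x = - (x::'h::complex_hilbert)"
  using scaleR_scaleC[of "-1" x] by simp

lemma cinner_zero [simp]: "cinner x 0 = (0::complex)" "cinner 0 x = (0::complex)" for x :: "'h::complex_hilbert"
  using cinner_add_right[of x 0 0] cinner_add_left[of 0 0 x] by simp_all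

lemma cinner_minus [simp]: "cinner x (- y) = - cinner x y" "cinner (- x) y = - cinner x y" for x y :: "'h::complex_hilbert"
  using cinner_add_right[of x y "- y"] cinner_add_left[of x "- x" y] by (simp_all add: add_eq_0_iff)

lemma cinner_eqI:
  fixes x y :: "'h::complex_hilbert"
  assumes "\<And>z. cinner x z = cinner y z" shows "x = y"
proof -
  have "cinner (x + - y) (x + - y) = 0"
    unfolding cinner_add_left[of x "- y"] cinner_minus(2) assms[of "x + - y"] by simp
  then show ?thesis by (simp add: cinner_self)
qed

lemma norm_scaleC: "norm (a *\<^sub>C x) = cmod a * norm (x::'h::complex_hilbert)"
proof -
  have "complex_of_real ((norm (a *\<^sub>C x))\<^sup>2) = (cnj a * a) * cinner x x"
    by (simp only: cinner_self[symmetric] cinner_scaleC_left cinner_scaleC_right mult_ac)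
  also have "\<dots> = complex_of_real ((cmod a * norm x)\<^sup>2)"
    using complex_norm_square[of a] by (simp add: cinner_self power_mult_distrib mult_ac)
  finally have "(norm (a *\<^sub>C x))\<^sup>2 = (cmod a * norm x)\<^sup>2" by (simp only: of_real_eq_iff)
  then show ?thesis by (simp add: power2_eq_iff_nonneg)
qed

lemma cinner_Cauchy_Schwarz: "cmod (cinner x y) \<le> norm x * norm (y::'h::complex_hilbert)"
proof (cases "y = 0")
  case False
  define n where "n = (norm y)\<^sup>2"
  have n: "0 < n" using False by (simp add: n_def)
  \<comment> \<open>Minus the coefficient of the projection of \<open>x\<close> to the line through
    \<open>y\<close>, so that \<open>z\<close> is orthogonal to \<open>y\<close>.\<close>
  define t where "t = - (cinner y x / complex_of_real n)"
  define z where "z = x + t *\<^sub>C y"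
  have yz: "cinner y z = 0"
    using n by (simp add: z_def t_def cinner_add_right cinner_scaleC_right cinner_self n_def)
  have "complex_of_real ((norm z)\<^sup>2) = cinner x z"
    unfolding cinner_self[symmetric] by (subst z_def) (simp add: cinner_add_left cinner_scaleC_left yz)
  also have "\<dots> = complex_of_real ((norm x)\<^sup>2) - cinner y x * cinner x y / complex_of_real n"
    by (simp add: z_def t_def cinner_add_right cinner_scaleC_right cinner_self)
  also have "cinner y x * cinner x y = complex_of_real ((cmod (cinner x y))\<^sup>2)"
    using cinner_commute[of y x] complex_norm_square[of "cinner x y"] by (simp add: mult.commute)
  finally have "(norm z)\<^sup>2 = (norm x)\<^sup>2 - (cmod (cinner x y))\<^sup>2 / n"
    by (simp only: of_real_diff[symmetric] of_real_divide[symmetric] of_real_eq_iff)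
  then have "(cmod (cinner x y))\<^sup>2 / n \<le> (norm x)\<^sup>2" using zero_le_power2[of "norm z"] by linarith
  then have "(cmod (cinner x y))\<^sup>2 \<le> (norm x * norm y)\<^sup>2"
    using n by (simp add: pos_divide_le_eq n_def power_mult_distrib)
  then show ?thesis by (rule power2_le_imp_le) simp
qed simp

lemma bounded_bilinear_scaleC: "bounded_bilinear (scaleC :: complex \<Rightarrow> 'h \<Rightarrow> 'h::complex_hilbert)"
  by standard
    (auto simp: scaleC_add_left scaleC_add_right scaleR_scaleC scaleC_scaleC norm_scaleC scaleC_complex_def mult.commute
      intro!: exI[of _ 1])

lemma bounded_bilinear_cinner: "bounded_bilinear (cinner :: 'h \<Rightarrow> 'h \<Rightarrow> complex)" for dummy :: "'h::complex_hilbert"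
proof
  show "\<exists>K. \<forall>a b :: 'h. norm (cinner a b) \<le> norm a * norm b * K"
    by (rule exI[of _ 1]) (simp add: cinner_Cauchy_Schwarz)
qed (simp_all add: cinner_add_left cinner_add_right scaleR_scaleC cinner_scaleC_left cinner_scaleC_right scaleC_complex_def)

lemma bounded_linear_cinner: "bounded_linear (cinner (x :: 'h::complex_hilbert))"
  by (rule bounded_bilinear.bounded_linear_right[OF bounded_bilinear_cinner])

lemma hilbert_adjoint_eqI:
  assumes "\<And>x y. cinner (B x) y = cinner x (A y)"
  shows "hilbert_adjoint A = B"
  unfolding hilbert_adjoint_def
proof (rule the_equality)
  fix C assume "\<forall>x y. cinner (C x) y = cinner x (A y)"
  then have C: "cinner (C x) y = cinner (B x) y" for x y using assms by simp
  show "C = B" by (rule ext, rule cinner_eqI) (rule C)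
qed (simp add: assms)

section \<open>Smooth vectors of a Weyl representation\<close>

text \<open>The adjoint is a definite description. Representing linear forms by
  \<open>\<sigma>\<close> gives existence; non-degeneracy gives uniqueness and, with it,
  linearity.\<close>

lemma (in symplectic) symp_adjoint:
  assumes "linear T"
  shows "linear (symp_adjoint \<sigma> T)" "\<sigma> (symp_adjoint \<sigma> T x) y = \<sigma> x (T y)"
proof -
  have lin: "linear (\<lambda>y. - \<sigma> x (T y))" for x
    using assms by (intro linearI) (simp_all add: linear_add linear_cmul sigma_simps)
  have "\<exists>v. \<forall>y. \<sigma> v y = \<sigma> x (T y)" for x
  proof (rule sigma_represents[OF lin[of x]])
    fix v assume "\<And>y. \<sigma> y v = - \<sigma> x (T y)"
    then have "\<sigma> v y = \<sigma> x (T y)" for y using sigma_antisym[of v y] by simp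
    then show ?thesis by blast
  qed
  then obtain T' where T': "\<And>x y. \<sigma> (T' x) y = \<sigma> x (T y)" by metis
  have uniq: "u = v" if "\<And>y. \<sigma> u y = \<sigma> v y" for u v
    using sigma_nondegenerate[of "u - v"] that by (simp add: sigma_simps)
  have lT': "linear T'"
    by (intro linearI uniq) (simp_all add: T' sigma_simps)
  have "symp_adjoint \<sigma> T = T'"
    unfolding symp_adjoint_def
  proof (rule the_equality)
    fix T2 assume "linear T2 \<and> (\<forall>x y. \<sigma> (T2 x) y = \<sigma> x (T y))"
    then show "T2 = T'" using T' by (intro ext uniq) simp
  qed (use lT' T' in blast)
  then show "linear (symp_adjoint \<sigma> T)" "\<sigma> (symp_adjoint \<sigma> T x) y = \<sigma> x (T y)" using lT' T' by simp_all
qed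

locale weyl_representation = symplectic \<sigma> for \<sigma> :: "'w::euclidean_space \<Rightarrow> 'w \<Rightarrow> real" +
  fixes T :: "'w \<Rightarrow> 'w" and W :: "'w \<Rightarrow> 'h::complex_hilbert \<Rightarrow> 'h"
  assumes linear_T: "linear T" and bij_S: "bij (sym_part \<sigma> T)" and rep: "omega_representation \<sigma> T W"
begin

section \<open>Commutation relations of the Weyl operators\<close>

abbreviation S where "S \<equiv> sym_part \<sigma> T"
abbreviation Wt where "Wt \<equiv> W_tilde \<sigma> T W"
abbreviation Sm where "Sm \<equiv> smooth_vectors W"
abbreviation smooth_seminorms where "smooth_seminorms \<equiv> range (smooth_seminorm \<sigma> T W)"

definition \<beta> :: "'w \<Rightarrow> 'w \<Rightarrow> real" where "\<beta> x y = \<sigma> x (S y)"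

lemma linear_S: "linear S"
  using linear_T symp_adjoint(1)[OF linear_T] unfolding sym_part_def by (rule linear_compose_add)

text \<open>Makes antisymmetry visible: \<open>\<beta>\<close> is twice the antisymmetric part of
  the form \<open>\<sigma> x (T y)\<close>, the part that commutators detect.\<close>

lemma beta_eq: "\<beta> x y = \<sigma> x (T y) - \<sigma> y (T x)"
proof -
  have "\<sigma> x (symp_adjoint \<sigma> T y) = - \<sigma> y (T x)"
    using symp_adjoint(2)[OF linear_T, of y x] sigma_antisym[of x "symp_adjoint \<sigma> T y"] by simp
  then show ?thesis by (simp add: \<beta>_def sym_part_def sigma_simps)
qed

lemma beta_antisym: "\<beta> x y = - \<beta> y x"
  by (simp add: beta_eq)

lemma S_symmetric: "\<sigma> (S x) y = \<beta> x y"
  using beta_antisym[of x y] sigma_antisym[of "S x" y] by (simp add: \<beta>_def)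

lemma beta_simps: "\<beta> (x + y) z = \<beta> x z + \<beta> y z" "\<beta> x (y + z) = \<beta> x y + \<beta> x z"
  "\<beta> (r *\<^sub>R x) y = r * \<beta> x y" "\<beta> x (r *\<^sub>R y) = r * \<beta> x y" "\<beta> (- x) y = - \<beta> x y" "\<beta> x (- y) = - \<beta> x y"
  "\<beta> x x = 0" "\<beta> 0 x = 0" "\<beta> x 0 = 0"
  using linear_S beta_antisym[of x x]
  by (simp_all add: \<beta>_def sigma_simps linear_add linear_cmul linear_neg linear_0)

lemma beta_linear: "linear (\<lambda>x. complex_of_real (\<beta> x y))"
  unfolding \<beta>_def by (rule sigma_linear_left)

lemma W_add: "W x (u + v) = W x u + W x v"
  and W_scaleC: "W x (a *\<^sub>C v) = a *\<^sub>C W x v"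
  and W_isometry: "cinner (W x u) (W x v) = cinner u v"
  and W_mult: "W x (W y v) = exp (\<i> * complex_of_real (\<sigma> x (T y))) *\<^sub>C W (x + y) v"
  using rep unfolding omega_representation_def unitary_map_def clinear_map_def by simp_all

lemma Wt_eq: "Wt x v = exp (\<i> / 2 * complex_of_real (\<sigma> x (T x))) *\<^sub>C W x v"
  by (simp add: W_tilde_def)

lemma W_eq: "W x v = exp (- (\<i> / 2 * complex_of_real (\<sigma> x (T x)))) *\<^sub>C Wt x v"
  by (simp add: Wt_eq scaleC_scaleC flip: exp_add)

lemma Wt_add: "Wt x (u + v) = Wt x u + Wt x v"
  and Wt_scaleC: "Wt x (a *\<^sub>C v) = a *\<^sub>C Wt x v"
  by (simp_all add: Wt_eq W_add W_scaleC scaleC_add_right scaleC_scaleC mult.commute)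

text \<open>The quadratic phase in \<open>Wt\<close> cancels the symmetric part of the exponent
  \<open>\<sigma> x (T y)\<close>; its antisymmetric part, half of \<open>\<beta>\<close>,
  remains.\<close>

lemma Wt_mult: "Wt x (Wt y v) = exp (\<i> / 2 * complex_of_real (\<beta> x y)) *\<^sub>C Wt (x + y) v"
proof -
  have "\<i> / 2 * complex_of_real (\<sigma> x (T x)) + (\<i> / 2 * complex_of_real (\<sigma> y (T y)) + \<i> * complex_of_real (\<sigma> x (T y)))
      = \<i> / 2 * complex_of_real (\<beta> x y) + \<i> / 2 * complex_of_real (\<sigma> (x + y) (T (x + y)))"
    by (simp add: beta_eq linear_add[OF linear_T] sigma_simps field_simps)
  then show ?thesis
    unfolding Wt_eq W_scaleC W_mult scaleC_scaleC exp_add[symmetric] by (simp only: add.assoc)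
qed

lemma Wt_isometry: "cinner (Wt x u) (Wt x v) = cinner u v"
proof -
  have *: "exp (\<i> / 2 * complex_of_real r) * cnj (exp (\<i> / 2 * complex_of_real r)) = 1" for r
    by (simp add: exp_cnj flip: exp_add)
  show ?thesis
    unfolding Wt_eq cinner_scaleC_left cinner_scaleC_right W_isometry mult.assoc[symmetric]
    by (simp only: * mult_1_left)
qed

text \<open>The multiplication rule makes \<open>Wt 0\<close> idempotent and isometry makes it
  injective; an injective idempotent is the identity.\<close>

lemma Wt_zero [simp]: "Wt 0 v = v"
proof (rule cinner_eqI)
  have *: "Wt 0 (Wt 0 v) = Wt 0 v" using Wt_mult[of 0 0 v] by (simp add: beta_simps)
  have "cinner (Wt 0 v + - v) (Wt 0 v + - v) = cinner (Wt 0 (Wt 0 v + - v)) (Wt 0 (Wt 0 v + - v))"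
    by (rule Wt_isometry[symmetric])
  also have "Wt 0 (Wt 0 v + - v) = 0"
    unfolding Wt_add scaleC_minus_one[of v, symmetric] Wt_scaleC * by (simp add: scaleC_minus_one)
  finally show "cinner (Wt 0 v) z = cinner v z" for z by (simp add: cinner_self)
qed

lemma Wt_adjoint: "cinner (Wt (- x) u) v = cinner u (Wt x v)"
proof -
  have "cinner (Wt (- x) u) v = cinner (Wt x (Wt (- x) u)) (Wt x v)" by (rule Wt_isometry[symmetric])
  then show ?thesis by (simp add: Wt_mult beta_simps)
qed

lemma norm_Wt: "norm (Wt x v) = norm v"
proof -
  have "complex_of_real ((norm (Wt x v))\<^sup>2) = complex_of_real ((norm v)\<^sup>2)"
    unfolding cinner_self[symmetric] by (rule Wt_isometry)
  then show ?thesis by (simp only: of_real_eq_iff) (simp add: power2_eq_iff_nonneg)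
qed

lemma bounded_linear_Wt: "bounded_linear (Wt x)"
  by (rule bounded_linear_intro[of _ 1]) (simp_all add: Wt_add Wt_scaleC scaleR_scaleC norm_Wt)

lemma quadratic_Cpol: "(\<lambda>x. complex_of_real (\<sigma> x (T x))) \<in> Cpol"
proof -
  have "(\<lambda>x. \<Sum>b\<in>B. complex_of_real (x \<bullet> b) * complex_of_real (\<sigma> b (T x))) \<in> Cpol" if "finite B" for B
    using that
  proof (induction B)
    case (insert b B)
    have "linear (\<lambda>x::'w. complex_of_real (x \<bullet> b))"
      by (intro linearI) (auto simp: inner_left_distrib scaleR_conv_of_real)
    moreover have "linear (\<lambda>x. complex_of_real (\<sigma> b (T x)))"
      using linear_compose[OF linear_T sigma_linear_right[of b]] by (simp add: comp_def)
    ultimately show ?case using insert by (simp add: Cpol_add Cpol_mult Cpol_linear)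
  qed (simp add: Cpol_const)
  from this[OF finite_Basis] show ?thesis
  proof (rule back_subst[of "\<lambda>f. f \<in> Cpol"], intro ext)
    fix x
    have l: "linear (\<lambda>z. \<sigma> z (T x))" using sigma_bilinear unfolding bilinear_def by blast
    have "\<sigma> x (T x) = \<sigma> (\<Sum>b\<in>Basis. (x \<bullet> b) *\<^sub>R b) (T x)" by (simp add: euclidean_representation)
    also have "\<dots> = (\<Sum>b\<in>Basis. (x \<bullet> b) * \<sigma> b (T x))" by (simp add: linear_sum[OF l] linear_cmul[OF l])
    finally show "(\<Sum>b\<in>Basis. complex_of_real (x \<bullet> b) * complex_of_real (\<sigma> b (T x))) = complex_of_real (\<sigma> x (T x))"
      by simp
  qed
qed

text \<open>The factor between \<open>W\<close> and \<open>Wt\<close> multiplies smooth functions to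
  smooth functions and Schwartz functions to Schwartz functions, so one may pass freely between the
  two.\<close>

lemma phase_Cpol: "(\<lambda>x. exp (\<i> * complex_of_real r * complex_of_real (\<sigma> x (T x)))) \<in> Cpol"
  by (rule Cpol_exp[OF Cpol_mult[OF Cpol_const quadratic_Cpol]]) simp

lemma Sm_iff: "v \<in> Sm \<longleftrightarrow> smooth (\<lambda>x. Wt x v)"
proof
  assume "v \<in> Sm"
  then have "smooth (\<lambda>x. W x v)" by (simp add: smooth_vectors_def)
  from bounded_bilinear.smooth_prod[OF bounded_bilinear_scaleC Cpol_smooth[OF phase_Cpol[of "1/2"]] this]
  show "smooth (\<lambda>x. Wt x v)" by (simp add: Wt_eq)
next
  assume "smooth (\<lambda>x. Wt x v)"
  from bounded_bilinear.smooth_prod[OF bounded_bilinear_scaleC Cpol_smooth[OF phase_Cpol[of "-1/2"]] this]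
  have "smooth (\<lambda>x. W x v)" by (simp add: W_eq[of _ v])
  then show "v \<in> Sm" by (simp add: smooth_vectors_def)
qed

lemma Sm_add: "u \<in> Sm \<Longrightarrow> v \<in> Sm \<Longrightarrow> u + v \<in> Sm"
  unfolding Sm_iff Wt_add by (rule smooth_add)

lemma Sm_scaleC: "v \<in> Sm \<Longrightarrow> a *\<^sub>C v \<in> Sm"
  unfolding Sm_iff Wt_scaleC
  by (rule smooth_bounded_linear[OF bounded_bilinear.bounded_linear_right[OF bounded_bilinear_scaleC]])

lemma Sm_diff: "u \<in> Sm \<Longrightarrow> v \<in> Sm \<Longrightarrow> u - v \<in> Sm"
  using Sm_add[OF _ Sm_scaleC[of v "-1"], of u] by (simp add: scaleC_minus_one)

text \<open>\<open>D y = \<i> \<phi>(y)\<close> with the field operator \<open>\<phi>(y)\<close>.\<close>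

definition D :: "'w \<Rightarrow> 'h \<Rightarrow> 'h"
  where "D y v = frechet_derivative (\<lambda>x. Wt x v) (at 0) y"

lemma Wt_line_derivative:
  assumes "v \<in> Sm"
  shows "((\<lambda>t. Wt (x + t *\<^sub>R y) v) has_vector_derivative frechet_derivative (\<lambda>x. Wt x v) (at x) y) (at 0)"
proof -
  have d: "((\<lambda>x. Wt x v) has_derivative frechet_derivative (\<lambda>x. Wt x v) (at (x + 0 *\<^sub>R y))) (at (x + 0 *\<^sub>R y))"
    using assms unfolding Sm_iff by (rule smooth_has_derivative)
  have "((\<lambda>t. x + t *\<^sub>R y) has_derivative (\<lambda>t. t *\<^sub>R y)) (at 0)"
    by (auto intro!: derivative_eq_intros)
  from has_derivative_compose[OF this d]
  show ?thesis
    using linear_cmul[OF has_derivative_linear[OF d]] by (simp add: has_vector_derivative_def)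
qed

lemma D_eq: "v \<in> Sm \<Longrightarrow> D y v = \<i> *\<^sub>C field_op \<sigma> T W y v"
  using vector_derivative_at[OF Wt_line_derivative[of v 0 y]]
  by (simp add: field_op_def D_def scaleC_scaleC scaleC_minus_one)

lemma field_op_eq: "v \<in> Sm \<Longrightarrow> field_op \<sigma> T W y v = (- \<i>) *\<^sub>C D y v"
  by (simp add: D_eq scaleC_scaleC)

lemma phase_derivative:
  "((\<lambda>t. exp (\<i> / 2 * complex_of_real (t * c))) has_vector_derivative (\<i> / 2 * complex_of_real c)) (at 0)"
proof -
  have "((\<lambda>z. exp (\<i> / 2 * (z * complex_of_real c))) has_field_derivative \<i> / 2 * complex_of_real c) (at (complex_of_real 0))"
    by (auto intro!: derivative_eq_intros)
  from has_vector_derivative_real_field[OF this] show ?thesis by simp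
qed

text \<open>\<open>Wt x (Wt (t *\<^sub>R y) v)\<close> is differentiated at \<open>t = 0\<close> in
  two ways: as a bounded operator applied to a curve, and as a phase times
  \<open>Wt (x + t *\<^sub>R y) v\<close>.\<close>

lemma dderiv_Wt:
  assumes "v \<in> Sm"
  shows "dderiv y (\<lambda>x. Wt x v) x = Wt x (D y v) + (- (\<i> / 2) * complex_of_real (\<beta> x y)) *\<^sub>C Wt x v"
proof -
  have "((\<lambda>t. Wt x (Wt (0 + t *\<^sub>R y) v)) has_vector_derivative Wt x (D y v)) (at 0)"
    unfolding D_def by (rule bounded_linear.has_vector_derivative[OF bounded_linear_Wt Wt_line_derivative[OF assms]])
  moreover have "((\<lambda>t. exp (\<i> / 2 * complex_of_real (t * \<beta> x y)) *\<^sub>C Wt (x + t *\<^sub>R y) v) has_vector_derivative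
      exp (\<i> / 2 * complex_of_real (0 * \<beta> x y)) *\<^sub>C dderiv y (\<lambda>x. Wt x v) x +
      (\<i> / 2 * complex_of_real (\<beta> x y)) *\<^sub>C Wt (x + 0 *\<^sub>R y) v) (at 0)"
    by (rule bounded_bilinear.has_vector_derivative[OF bounded_bilinear_scaleC phase_derivative Wt_line_derivative[OF assms]])
  ultimately have "Wt x (D y v) = dderiv y (\<lambda>x. Wt x v) x + (\<i> / 2 * complex_of_real (\<beta> x y)) *\<^sub>C Wt x v"
    using vector_derivative_unique_at by (fastforce simp: Wt_mult beta_simps)
  then show ?thesis by (simp add: bounded_bilinear.minus_left[OF bounded_bilinear_scaleC])
qed

text \<open>The preceding formula, solved for \<open>Wt x (D y v)\<close>, expresses it by functions
  known to be smooth in \<open>x\<close>.\<close>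

lemma D_Sm:
  assumes "v \<in> Sm" shows "D y v \<in> Sm"
proof -
  have sm: "smooth (\<lambda>x. Wt x v)" using assms by (simp add: Sm_iff)
  have "Wt x (D y v) = dderiv y (\<lambda>x. Wt x v) x + (\<i> / 2 * complex_of_real (\<beta> x y)) *\<^sub>C Wt x v" for x
    unfolding dderiv_Wt[OF assms] by (simp add: bounded_bilinear.minus_left[OF bounded_bilinear_scaleC])
  moreover have "smooth (\<lambda>x. dderiv y (\<lambda>x. Wt x v) x + (\<i> / 2 * complex_of_real (\<beta> x y)) *\<^sub>C Wt x v)"
    by (intro smooth_add smooth_dderiv sm bounded_bilinear.smooth_prod[OF bounded_bilinear_scaleC]
        Cpol_smooth Cpol_mult Cpol_const Cpol_linear beta_linear)
  ultimately show ?thesis by (simp add: Sm_iff)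
qed

lemma field_op_Sm: "v \<in> Sm \<Longrightarrow> field_op \<sigma> T W y v \<in> Sm"
  by (simp add: field_op_eq D_Sm Sm_scaleC)

section \<open>Matrix coefficients of smooth vectors are Schwartz functions\<close>

definition mcoeff :: "'h \<Rightarrow> 'h \<Rightarrow> 'w \<Rightarrow> complex"
  where "mcoeff u v = (\<lambda>x. cinner u (Wt x v))"

lemma smooth_mcoeff: "v \<in> Sm \<Longrightarrow> smooth (mcoeff u v)"
  unfolding mcoeff_def Sm_iff by (rule smooth_bounded_linear[OF bounded_linear_cinner])

lemma dderiv_mcoeff_right:
  assumes "v \<in> Sm"
  shows "dderiv y (mcoeff u v) x = mcoeff u (D y v) x - \<i> / 2 * complex_of_real (\<beta> x y) * mcoeff u v x"
proof -
  have "dderiv y (\<lambda>x. cinner u (Wt x v)) = (\<lambda>x. cinner u (dderiv y (\<lambda>x. Wt x v) x))"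
    using assms unfolding Sm_iff by (intro dderiv_bounded_linear bounded_linear_cinner smooth_differentiable)
  from fun_cong[OF this, of x] show ?thesis
    unfolding mcoeff_def by (simp add: dderiv_Wt[OF assms] cinner_add_right cinner_scaleC_right)
qed

text \<open>The displacement is split off on the left and moved to \<open>u\<close> by the adjoint.
  The phase term has the sign opposite to that in \<open>dderiv_mcoeff_right\<close>, where the
  displacement acts on \<open>v\<close>; decay comes out of this discrepancy.\<close>

lemma dderiv_mcoeff_left:
  assumes "u \<in> Sm" "v \<in> Sm"
  shows "dderiv y (mcoeff u v) x = \<i> / 2 * complex_of_real (\<beta> x y) * mcoeff u v x - mcoeff (D y u) v x"
proof -
  have sm: "(mcoeff u v has_derivative frechet_derivative (mcoeff u v) (at (x + 0 *\<^sub>R y))) (at (x + 0 *\<^sub>R y))"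
    by (rule smooth_has_derivative[OF smooth_mcoeff[OF assms(2)]])
  have "((\<lambda>t. x + t *\<^sub>R y) has_derivative (\<lambda>t. t *\<^sub>R y)) (at 0)"
    by (auto intro!: derivative_eq_intros)
  from has_derivative_compose[OF this sm]
  have 1: "((\<lambda>t. mcoeff u v (x + t *\<^sub>R y)) has_vector_derivative dderiv y (mcoeff u v) x) (at 0)"
    using linear_cmul[OF has_derivative_linear[OF sm]] by (simp add: has_vector_derivative_def)
  have "((\<lambda>t. Wt (0 + t *\<^sub>R (- y)) u) has_vector_derivative - D y u) (at 0)"
    using Wt_line_derivative[OF assms(1), of 0 "- y"]
      linear_neg[OF has_derivative_linear[OF smooth_has_derivative], of "\<lambda>x. Wt x u" 0 y] assms(1)
    by (simp add: D_def Sm_iff)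
  then have "((\<lambda>t. cinner (Wt (- (t *\<^sub>R y)) u) (Wt x v)) has_vector_derivative cinner (- D y u) (Wt x v)) (at 0)"
    using bounded_linear.has_vector_derivative[OF bounded_bilinear.bounded_linear_left[OF bounded_bilinear_cinner]]
    by fastforce
  from has_vector_derivative_mult[OF phase_derivative[of "\<beta> x y"] this]
  have 2: "((\<lambda>t. exp (\<i> / 2 * complex_of_real (t * \<beta> x y)) * cinner (Wt (- (t *\<^sub>R y)) u) (Wt x v)) has_vector_derivative
      cinner (- D y u) (Wt x v) + \<i> / 2 * complex_of_real (\<beta> x y) * cinner u (Wt x v)) (at 0)" by simp
  have "exp (\<i> / 2 * complex_of_real (t * \<beta> x y)) * cinner (Wt (- (t *\<^sub>R y)) u) (Wt x v) = mcoeff u v (x + t *\<^sub>R y)" for t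
    unfolding Wt_adjoint Wt_mult cinner_scaleC_right beta_simps beta_antisym[of y x] mcoeff_def mult.assoc[symmetric]
    by (simp add: add.commute flip: exp_add)
  with 2 have 3: "((\<lambda>t. mcoeff u v (x + t *\<^sub>R y)) has_vector_derivative
      cinner (- D y u) (Wt x v) + \<i> / 2 * complex_of_real (\<beta> x y) * cinner u (Wt x v)) (at 0)" by simp
  show ?thesis
    using vector_derivative_unique_at[OF 1 3] by (simp add: mcoeff_def)
qed

text \<open>Here \<open>d\<close> is the derivative and \<open>k\<close> the coefficient times
  \<open>\<i> * \<beta> x y\<close>: the sum of the two equations isolates \<open>d\<close>, their
  difference \<open>k\<close>.\<close>

lemma half_system_solution:
  fixes d k a b :: complex
  assumes "d = k / 2 - b" "d = a - k / 2"
  shows "d = (a - b) / 2" "k = a + b"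
  using assms by (auto simp: complex_eq_iff)

lemma dderiv_mcoeff:
  assumes "u \<in> Sm" "v \<in> Sm"
  shows "dderiv y (mcoeff u v) x = (mcoeff u (D y v) x - mcoeff (D y u) v x) / 2"
  using dderiv_mcoeff_left[OF assms, where y = y and x = x] dderiv_mcoeff_right[OF assms(2), where y = y and u = u and x = x]
    half_system_solution[of _ "\<i> * complex_of_real (\<beta> x y) * mcoeff u v x"] by simp

lemma beta_mcoeff:
  assumes "u \<in> Sm" "v \<in> Sm"
  shows "\<i> * complex_of_real (\<beta> x y) * mcoeff u v x = mcoeff u (D y v) x + mcoeff (D y u) v x"
  using dderiv_mcoeff_left[OF assms, where y = y and x = x] dderiv_mcoeff_right[OF assms(2), where y = y and u = u and x = x]
    half_system_solution[of _ "\<i> * complex_of_real (\<beta> x y) * mcoeff u v x"] by simp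

lemma mcoeff_bound: "norm (mcoeff u v x) \<le> norm u * norm v"
  unfolding mcoeff_def using cinner_Cauchy_Schwarz[of u "Wt x v"] by (simp add: norm_Wt)

lemma dominated_norm: "dominated Sm smooth_seminorms (\<lambda>u (i::unit). norm u)"
proof -
  have "dominated Sm smooth_seminorms (\<lambda>u (i::unit). smooth_seminorm \<sigma> T W [] u)"
    by (rule dominated_base[OF rangeI]) (simp add: smooth_seminorm_def)
  then show ?thesis by (simp add: smooth_seminorm_def)
qed

lemma dominated_field_op:
  assumes "dominated Sm smooth_seminorms q"
  shows "dominated Sm smooth_seminorms (\<lambda>u. q (field_op \<sigma> T W y u))"
proof (rule dominated_compose[OF assms])
  fix p assume "p \<in> smooth_seminorms"
  then obtain xs where p: "p = smooth_seminorm \<sigma> T W xs" by blast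
  have *: "p (field_op \<sigma> T W y u) = smooth_seminorm \<sigma> T W (xs @ [y]) u" for u
    by (simp add: p smooth_seminorm_def)
  show "dominated Sm smooth_seminorms (\<lambda>u (i::unit). p (field_op \<sigma> T W y u))"
    unfolding * by (rule dominated_base[OF rangeI]) (simp add: smooth_seminorm_def)
qed (rule field_op_Sm)

text \<open>The seminorms on smooth vectors are built from field operators, from which
  \<open>D\<close> differs by a unimodular factor.\<close>

lemma norm_mcoeff_D: "u \<in> Sm \<Longrightarrow> norm (dir_derivs vs (mcoeff (D y u) v) x) = norm (dir_derivs vs (mcoeff (field_op \<sigma> T W y u) v) x)"
  if v: "v \<in> Sm"
proof -
  assume u: "u \<in> Sm"
  have "mcoeff (D y u) v = (\<lambda>x. - \<i> * mcoeff (field_op \<sigma> T W y u) v x)"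
    by (simp add: mcoeff_def fun_eq_iff D_eq[OF u] cinner_scaleC_left)
  then have "dir_derivs vs (mcoeff (D y u) v) = (\<lambda>x. - \<i> * dir_derivs vs (mcoeff (field_op \<sigma> T W y u) v) x)"
    using dir_derivs_bounded_linear[OF bounded_linear_mult_right[of "- \<i>"] smooth_mcoeff[OF v]] by simp
  then show ?thesis by (simp add: norm_mult)
qed

text \<open>Each derivative and each power of the weight puts a \<open>D y\<close> on
  \<open>u\<close> or on \<open>v\<close>. On \<open>v\<close> it is absorbed by generalising
  \<open>v\<close> in the induction; on \<open>u\<close> it lengthens the list of field operators in
  the seminorm. What is left in the end is the Cauchy-Schwarz bound.\<close>

lemma schwartz_valued_mcoeff:
  assumes "v \<in> Sm"
  shows "schwartz_valued Sm smooth_seminorms (\<lambda>u. mcoeff u v)"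
proof (rule schwartz_valuedI)
  fix N vs
  let ?q = "\<lambda>N vs v u x. (1 + norm x) ^ N * norm (dir_derivs vs (mcoeff u v) x)"
  have right: "dominated Sm smooth_seminorms (\<lambda>u. ?q N vs v (D y u))"
    if "dominated Sm smooth_seminorms (?q N vs v)" "v \<in> Sm" for N vs v y
    by (rule dominated_le[OF dominated_field_op[OF that(1), where y = y]]) (simp add: norm_mcoeff_D[OF that(2)])
  show "dominated Sm smooth_seminorms (?q N vs v)"
    using assms
  proof (induction vs arbitrary: v rule: rev_induct)
    case Nil
    then show ?case
    proof (induction N arbitrary: v)
      case 0
      show ?case
      proof (rule dominated_mono[OF dominated_cmult[OF dominated_norm norm_ge_zero[of v]]], rule exI)
        fix u :: 'h and x :: 'w
        show "?q 0 [] v u x \<le> norm v * norm u" using mcoeff_bound[of u v x] by (simp add: mult.commute)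
      qed
    next
      case (Suc N)
      \<comment> \<open>Bijectivity of \<open>S\<close> enters here: a coordinate is first
        represented by \<open>\<sigma>\<close> and then, with a preimage under \<open>S\<close>, by
        \<open>\<beta>\<close>.\<close>
      have "\<exists>y. \<forall>x. \<beta> x y = x \<bullet> b" for b
      proof -
        have "linear (\<lambda>x. x \<bullet> b)" by (auto intro!: linearI simp: inner_left_distrib)
        then have "\<exists>z. \<forall>x. \<sigma> x z = x \<bullet> b" by (rule sigma_represents) blast
        then obtain z where "\<And>x. \<sigma> x z = x \<bullet> b" by blast
        moreover obtain y where "S y = z" using bij_S by (metis bij_pointE)
        ultimately show ?thesis unfolding \<beta>_def by blast
      qed
      then obtain r where r: "\<And>b x. \<beta> x (r b) = x \<bullet> b" by metis
      have "dominated Sm smooth_seminorms (\<lambda>u x. ?q N [] v u x +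
          (\<Sum>b\<in>Basis. ?q N [] (D (r b) v) u x + ?q N [] v (D (r b) u) x))"
        by (intro dominated_add dominated_sum Suc.IH D_Sm Suc.prems right) simp
      then show ?case
      proof (rule dominated_le)
        fix u x assume u: "u \<in> Sm"
        have le: "\<bar>x \<bullet> b\<bar> * norm (mcoeff u v x) \<le> norm (mcoeff u (D (r b) v) x) + norm (mcoeff (D (r b) u) v x)" for b
        proof -
          have "\<bar>x \<bullet> b\<bar> * norm (mcoeff u v x) = norm (\<i> * complex_of_real (\<beta> x (r b)) * mcoeff u v x)"
            by (simp add: r norm_mult)
          also have "\<dots> \<le> norm (mcoeff u (D (r b) v) x) + norm (mcoeff (D (r b) u) v x)"
            unfolding beta_mcoeff[OF u Suc.prems] by (rule norm_triangle_ineq)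
          finally show ?thesis .
        qed
        have "(1 + norm x) * norm (mcoeff u v x) \<le> (1 + (\<Sum>b\<in>Basis. \<bar>x \<bullet> b\<bar>)) * norm (mcoeff u v x)"
          using norm_le_l1[of x] by (intro mult_right_mono) auto
        also have "\<dots> = norm (mcoeff u v x) + (\<Sum>b\<in>Basis. \<bar>x \<bullet> b\<bar> * norm (mcoeff u v x))"
          by (simp only: sum_distrib_right distrib_right mult_1_left)
        also have "\<dots> \<le> norm (mcoeff u v x) + (\<Sum>b\<in>Basis. norm (mcoeff u (D (r b) v) x) + norm (mcoeff (D (r b) u) v x))"
          by (intro add_left_mono sum_mono le)
        finally have "(1 + norm x) ^ N * ((1 + norm x) * norm (mcoeff u v x)) \<le> (1 + norm x) ^ N *
          (norm (mcoeff u v x) + (\<Sum>b\<in>Basis. norm (mcoeff u (D (r b) v) x) + norm (mcoeff (D (r b) u) v x)))"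
          by (rule mult_left_mono) simp
        then show "?q (Suc N) [] v u x \<le> ?q N [] v u x +
            (\<Sum>b\<in>Basis. ?q N [] (D (r b) v) u x + ?q N [] v (D (r b) u) x)"
          by (simp add: distrib_left sum_distrib_left mult_ac)
      qed
    qed
  next
    case (snoc y vs)
    have "dominated Sm smooth_seminorms (\<lambda>u x. (1/2) * (?q N vs (D y v) u x + ?q N vs v (D y u) x))"
      by (intro dominated_cmult dominated_add snoc.IH D_Sm snoc.prems right) simp
    then show ?case
    proof (rule dominated_le)
      fix u x assume u: "u \<in> Sm"
      have "dderiv y (mcoeff u v) = (\<lambda>x. (1/2) * mcoeff u (D y v) x + (-1/2) * mcoeff (D y u) v x)"
        by (rule ext) (simp add: dderiv_mcoeff[OF u snoc.prems] field_simps)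
      note eq = this
      have sm: "smooth (\<lambda>x. c * mcoeff u v x)" "dir_derivs vs (\<lambda>x. c * mcoeff u v x) = (\<lambda>x. c * dir_derivs vs (mcoeff u v) x)"
        if "v \<in> Sm" for c u v
        using smooth_bounded_linear[OF bounded_linear_mult_right[of c] smooth_mcoeff[OF that]]
          dir_derivs_bounded_linear[OF bounded_linear_mult_right[of c] smooth_mcoeff[OF that]] by simp_all
      have eq2: "dir_derivs (vs @ [y]) (mcoeff u v) x =
          (1/2) * dir_derivs vs (mcoeff u (D y v)) x + (-1/2) * dir_derivs vs (mcoeff (D y u) v) x"
        by (simp only: dir_derivs_snoc eq dir_derivs_add[OF sm(1)[OF D_Sm[OF snoc.prems]] sm(1)[OF snoc.prems]]
          sm(2)[OF D_Sm[OF snoc.prems]] sm(2)[OF snoc.prems])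
      have "norm (dir_derivs (vs @ [y]) (mcoeff u v) x) \<le>
          (1/2) * (norm (dir_derivs vs (mcoeff u (D y v)) x) + norm (dir_derivs vs (mcoeff (D y u) v) x))"
        unfolding eq2 by (rule order_trans[OF norm_triangle_ineq]) (simp add: norm_mult)
      then have "(1 + norm x) ^ N * norm (dir_derivs (vs @ [y]) (mcoeff u v) x) \<le> (1 + norm x) ^ N *
        ((1/2) * (norm (dir_derivs vs (mcoeff u (D y v)) x) + norm (dir_derivs vs (mcoeff (D y u) v) x)))"
        by (rule mult_left_mono) simp
      then show "?q N (vs @ [y]) v u x \<le> (1/2) * (?q N vs (D y v) u x + ?q N vs v (D y u) x)"
        by (simp only: mult.left_commute[of _ "1/2 :: real"] distrib_left)
    qed
  qed
qed (rule smooth_mcoeff[OF assms])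

section \<open>Matrix elements of \<open>Op\<close> and their behaviour under conjugation\<close>

text \<open>The test function at which \<open>F a\<close> is evaluated in the matrix element of \<open>Op a\<close>.\<close>

definition symbol :: "'h \<Rightarrow> 'h \<Rightarrow> 'w \<Rightarrow> complex"
  where "symbol u v = (\<lambda>x. cnj (cinner u (W x v)))"

lemma schwartz_valued_symbol:
  assumes "v \<in> Sm"
  shows "schwartz_valued Sm smooth_seminorms (\<lambda>u. symbol u v)"
proof -
  have "symbol u v = (\<lambda>x. cnj (exp (\<i> * complex_of_real (-1/2) * complex_of_real (\<sigma> x (T x))) * mcoeff u v x))" for u
    unfolding symbol_def mcoeff_def by (rule ext) (simp add: W_eq[of _ v] cinner_scaleC_right)
  then show ?thesis
    using schwartz_valued_cnj[OF schwartz_valued_mult_Cpol[OF schwartz_valued_mcoeff[OF assms] phase_Cpol[of "-1/2"]]]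
    by (simp only:)
qed

lemma symbol_schwartz: "u \<in> Sm \<Longrightarrow> v \<in> Sm \<Longrightarrow> symbol u v \<in> schwartz"
  using schwartz_valued_mem[OF schwartz_valued_symbol] by blast

text \<open>Conjugation makes \<open>symbol\<close> linear in \<open>u\<close> and antilinear in
  \<open>v\<close>. Applying an antilinear functional reverses both, as is right for a matrix
  element.\<close>

lemma symbol_add_left: "symbol (u + u') v = (\<lambda>x. symbol u v x + symbol u' v x)"
  and symbol_add_right: "symbol u (v + v') = (\<lambda>x. symbol u v x + symbol u v' x)"
  and symbol_scaleC_left: "symbol (a *\<^sub>C u) v = (\<lambda>x. a * symbol u v x)"
  and symbol_scaleC_right: "symbol u (a *\<^sub>C v) = (\<lambda>x. cnj a * symbol u v x)"
  by (simp_all add: symbol_def fun_eq_iff cinner_add_left cinner_add_right cinner_scaleC_left cinner_scaleC_right W_add W_scaleC)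

lemma Op_eq: "Op \<sigma> W a v u = a (fourier \<sigma> (symbol u v))"
  by (simp add: Op_def fourier_dist_def symbol_def)

lemma inv_S_neg: "inv S (- x) = - inv S x"
proof -
  have "S (- inv S x) = - x"
    using linear_neg[OF linear_S] bij_S by (simp add: bij_is_surj surj_f_inv_f)
  then show ?thesis using bij_S by (metis bij_inv_eq_iff)
qed

text \<open>The commutator phase of \<open>Wt\<close> at \<open>s\<close> is
  \<open>\<beta> s y\<close>, that is, \<open>\<sigma> (S s) y\<close>. This is why
  \<open>U_rep\<close> inserts the inverse of \<open>S\<close>: the phase becomes
  \<open>\<sigma> x y\<close>.\<close>

lemma symbol_translate:
  "symbol (U_rep \<sigma> T W (- x) u) (U_rep \<sigma> T W (- x) v) = (\<lambda>y. exp (- \<i> * complex_of_real (\<sigma> x y)) * symbol u v y)"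
proof
  fix y
  define s where "s = inv S x"
  have Ss: "S s = x" unfolding s_def using bij_S by (simp add: bij_is_surj surj_f_inv_f)
  have "\<beta> s y = \<sigma> x y" using S_symmetric[of s y] Ss by simp
  \<comment> \<open>Two half phases of equal sign add up to a full one.\<close>
  moreover have "Wt s (Wt y (Wt (- s) v)) = exp (\<i> * complex_of_real (\<beta> s y)) *\<^sub>C Wt y v"
    unfolding Wt_mult Wt_scaleC scaleC_scaleC beta_simps beta_antisym[of y s]
    by (simp flip: exp_add add: beta_simps)
  ultimately have *: "cinner (Wt (- s) u) (Wt y (Wt (- s) v)) = exp (\<i> * complex_of_real (\<sigma> x y)) * cinner u (Wt y v)"
    by (simp add: Wt_adjoint cinner_scaleC_right)
  have c: "cnj (exp (\<i> * complex_of_real (\<sigma> x y))) = exp (- \<i> * complex_of_real (\<sigma> x y))"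
    by (simp add: exp_cnj)
  show "symbol (U_rep \<sigma> T W (- x) u) (U_rep \<sigma> T W (- x) v) y = exp (- \<i> * complex_of_real (\<sigma> x y)) * symbol u v y"
  proof -
    have eq: "cinner u' (W y v') = exp (- (\<i> / 2 * complex_of_real (\<sigma> y (T y)))) * cinner u' (Wt y v')" for u' v'
      by (simp only: W_eq[of y v'] cinner_scaleC_right)
    have U: "U_rep \<sigma> T W (- x) w = Wt (- s) w" for w
      by (simp only: U_rep_def inv_S_neg s_def)
    show ?thesis
      unfolding symbol_def U eq * complex_cnj_mult c by (rule mult.left_commute)
  qed
qed

text \<open>The extension to the antidual acts through the Hilbert space adjoint, and the adjoint of
  U(x) is U(-x): both vectors are moved by the same unitary.\<close>

lemma translate_op_eq: "translate_op \<sigma> T W A x v u = A (U_rep \<sigma> T W (- x) v) (U_rep \<sigma> T W (- x) u)"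
proof -
  have "hilbert_adjoint (U_rep \<sigma> T W x) = U_rep \<sigma> T W (- x)"
    by (rule hilbert_adjoint_eqI) (simp add: U_rep_def inv_S_neg Wt_adjoint)
  then show ?thesis by (simp add: translate_op_def dual_extension_def)
qed

lemma translate_Op: "translate_op \<sigma> T W (Op \<sigma> W a) x v u = a (\<lambda>y. fourier \<sigma> (symbol u v) (x + y))"
  by (simp only: translate_op_eq Op_eq symbol_translate fourier_modulation)

lemma smooth_seminorm_zero: "smooth_seminorm \<sigma> T W xs 0 = 0"
proof -
  have W0: "Wt x 0 = 0" for x using Wt_scaleC[of x 0 0] by simp
  have "field_op \<sigma> T W x 0 = 0" for x
    using bounded_bilinear.zero_right[OF bounded_bilinear_scaleC]
    by (simp add: field_op_def W0)
  then have "foldr (field_op \<sigma> T W) xs 0 = 0" by (induction xs) auto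
  then show ?thesis by (simp add: smooth_seminorm_def)
qed

lemma continuous_smooth_functional:
  fixes f :: "'h \<Rightarrow> complex"
  assumes add: "\<And>u v. u \<in> Sm \<Longrightarrow> v \<in> Sm \<Longrightarrow> f (u + v) = f u + f v"
    and cmult: "\<And>a v. v \<in> Sm \<Longrightarrow> f (a *\<^sub>C v) = cnj a * f v"
    and dom: "dominated Sm smooth_seminorms (\<lambda>v (i::unit). norm (f v))"
  shows "continuous_map (smooth_topology \<sigma> T W) euclidean f"
  unfolding smooth_topology_def
proof (rule continuous_map_seminorm_topology[OF _ _ _ _ dom])
  fix u v assume uv: "u \<in> Sm" "v \<in> Sm"
  show "u - v \<in> Sm" using uv by (rule Sm_diff)
  show "f (u - v) = f u - f v"
    using add[OF uv(1) Sm_scaleC[OF uv(2), of "-1"]] cmult[OF uv(2), of "-1"] by (simp add: scaleC_minus_one)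
qed (auto simp: smooth_seminorm_zero)

end

lemma borel_measurable_cnj [measurable]:
  assumes "f \<in> borel_measurable M"
  shows "(\<lambda>x. cnj (f x)) \<in> borel_measurable M"
  by (rule borel_measurable_continuous_on[OF _ assms]) (intro continuous_intros)

section \<open>Tempered distributions\<close>

lemma schwartz_seminorm_add:
  assumes f: "f \<in> schwartz" and g: "g \<in> schwartz"
  shows "schwartz_seminorm N vs (\<lambda>x. f x + g x) \<le> schwartz_seminorm N vs f + schwartz_seminorm N vs g"
proof (rule schwartz_seminorm_le)
  fix x
  have "(1 + norm x) ^ N * norm (dir_derivs vs f x + dir_derivs vs g x) \<le>
      (1 + norm x) ^ N * (norm (dir_derivs vs f x) + norm (dir_derivs vs g x))"
    by (intro mult_left_mono norm_triangle_ineq) simp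
  also have "\<dots> \<le> schwartz_seminorm N vs f + schwartz_seminorm N vs g"
    unfolding distrib_left by (intro add_mono schwartz_seminorm_ge f g)
  finally show "(1 + norm x) ^ N * norm (dir_derivs vs (\<lambda>x. f x + g x) x) \<le>
      schwartz_seminorm N vs f + schwartz_seminorm N vs g"
    by (simp only: dir_derivs_add[OF schwartz_smooth[OF f] schwartz_smooth[OF g]])
qed

lemma schwartz_seminorm_cmult:
  assumes f: "f \<in> schwartz"
  shows "schwartz_seminorm N vs (\<lambda>x. a * f x) \<le> cmod a * schwartz_seminorm N vs f"
proof (rule schwartz_seminorm_le)
  fix x
  have "cmod a * ((1 + norm x) ^ N * norm (dir_derivs vs f x)) \<le> cmod a * schwartz_seminorm N vs f"
    by (intro mult_left_mono schwartz_seminorm_ge f) simp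
  then show "(1 + norm x) ^ N * norm (dir_derivs vs (\<lambda>x. a * f x) x) \<le> cmod a * schwartz_seminorm N vs f"
    by (simp add: dir_derivs_bounded_linear[OF bounded_linear_mult_right schwartz_smooth[OF f]] norm_mult mult.left_commute)
qed

lemma schwartz_zero: "(\<lambda>_::'w::euclidean_space. 0) \<in> schwartz"
  using schwartz_cmult[OF gaussian_schwartz, of 0] by simp

lemma schwartz_minus: "f \<in> schwartz \<Longrightarrow> g \<in> schwartz \<Longrightarrow> f - g \<in> schwartz"
  using schwartz_diff[of f g] by (simp add: fun_diff_def)

lemma schwartz_seminorm_diff_self: "schwartz_seminorm N vs (f - f) = 0"
proof -
  have "dir_derivs vs (\<lambda>_::'a. 0::complex) = (\<lambda>_. 0)"
  proof (induction vs)
    case (Cons v vs)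
    have "dderiv v (\<lambda>_::'a. 0::complex) = (\<lambda>_. 0)"
      by (intro dderiv_eqI) (auto intro!: derivative_eq_intros)
    then show ?case using Cons by (simp add: dir_derivs_Cons)
  qed simp
  then show ?thesis by (simp add: schwartz_seminorm_def fun_diff_def)
qed

lemma tempered_add: "u \<in> tempered \<Longrightarrow> f \<in> schwartz \<Longrightarrow> g \<in> schwartz \<Longrightarrow> u (\<lambda>x. f x + g x) = u f + u g"
  and tempered_cmult: "u \<in> tempered \<Longrightarrow> f \<in> schwartz \<Longrightarrow> u (\<lambda>x. a * f x) = cnj a * u f"
  by (simp_all add: tempered_def)

lemma tempered_zero: "u \<in> tempered \<Longrightarrow> u (\<lambda>_. 0) = 0"
  using tempered_cmult[OF _ schwartz_zero, of u 0] by simp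

lemma tempered_diff:
  "u \<in> tempered \<Longrightarrow> f \<in> schwartz \<Longrightarrow> g \<in> schwartz \<Longrightarrow> u (\<lambda>x. f x - g x) = u f - u g"
  using tempered_add[OF _ _ schwartz_cmult[of g "-1"], of u f] tempered_cmult[of u g "-1"] by simp

lemma tempered_sum:
  assumes "u \<in> tempered" "finite I" "\<And>i. i \<in> I \<Longrightarrow> f i \<in> schwartz"
  shows "(\<lambda>x. \<Sum>i\<in>I. a i * f i x) \<in> schwartz" "u (\<lambda>x. \<Sum>i\<in>I. a i * f i x) = (\<Sum>i\<in>I. cnj (a i) * u (f i))"
  using assms(2,3)
  by (induction I rule: finite_induct)
    (simp_all add: schwartz_zero tempered_zero[OF assms(1)] schwartz_add schwartz_cmult
      tempered_add[OF assms(1)] tempered_cmult[OF assms(1)])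

text \<open>A continuous functional is smaller than 1 on a neighbourhood of 0 given by finitely many
  seminorms, and scaling \<open>f\<close> into it yields the bound. Later estimates use continuity
  only in this form.\<close>

lemma tempered_dominated:
  assumes u: "u \<in> tempered"
  shows "dominated schwartz schwartz_seminorms (\<lambda>f (i::unit). norm (u f))"
proof -
  let ?z = "\<lambda>_::'a. 0::complex"
  have cont: "continuous_map (seminorm_topology schwartz schwartz_seminorms) euclidean u"
    using u by (simp add: tempered_def schwartz_topology_def)
  let ?U = "{f \<in> topspace (seminorm_topology schwartz schwartz_seminorms). u f \<in> ball 0 1}"
  have U: "openin (seminorm_topology schwartz schwartz_seminorms) ?U"
    by (rule openin_continuous_map_preimage[OF cont]) simp
  have "?z \<in> topspace (seminorm_topology schwartz schwartz_seminorms)"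
  proof -
    have "?z \<in> {y \<in> schwartz. schwartz_seminorm 0 [] (y - ?z) < 1}"
      using schwartz_zero schwartz_seminorm_diff_self[of 0 "[]" ?z] by simp
    then show ?thesis
      unfolding seminorm_topology_def topology_generated_by_topspace using schwartz_zero
      by (intro UnionI[of "{y \<in> schwartz. schwartz_seminorm 0 [] (y - ?z) < 1}"]) (auto intro!: exI[of _ "schwartz_seminorm 0 []"] exI[of _ ?z] exI[of _ "1::real"] exI[of _ "0::nat"] exI[of _ "[]"])
  qed
  then have zU: "?z \<in> ?U" using tempered_zero[OF u] by simp
  have tri: "p (f - h) \<le> p (f - g) + p (g - h)"
    if p: "p \<in> schwartz_seminorms" and fgh: "f \<in> schwartz" "g \<in> schwartz" "h \<in> schwartz"
    for p :: "('a \<Rightarrow> complex) \<Rightarrow> real" and f g h :: "'a \<Rightarrow> complex"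
  proof -
    from p obtain N vs where p: "p = schwartz_seminorm N vs" by blast
    have "f - h = (\<lambda>x. (f - g) x + (g - h) x)" by (simp add: fun_eq_iff)
    then show ?thesis
      unfolding p using schwartz_seminorm_add[OF schwartz_minus[OF fgh(1,2)] schwartz_minus[OF fgh(2,3)], of N vs] by simp
  qed
  obtain X e where X: "finite X" "X \<subseteq> schwartz_seminorms" "0 < e"
    and sub': "\<forall>f\<in>schwartz. (\<forall>p\<in>X. p (f - ?z) < e) \<longrightarrow> f \<in> ?U"
  proof -
    have "\<exists>X e. finite X \<and> X \<subseteq> schwartz_seminorms \<and> 0 < e \<and> (\<forall>f\<in>schwartz. (\<forall>p\<in>X. p (f - ?z) < e) \<longrightarrow> f \<in> ?U)"
    proof (rule seminorm_topology_nhd[OF U zU schwartz_zero])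
      fix p :: "('a \<Rightarrow> complex) \<Rightarrow> real" and f g h :: "'a \<Rightarrow> complex"
      assume "p \<in> schwartz_seminorms" "f \<in> schwartz" "g \<in> schwartz" "h \<in> schwartz"
      then show "p (f - h) \<le> p (f - g) + p (g - h)" by (rule tri)
    qed
    then show thesis using that by blast
  qed
  have sub: "f \<in> ?U" if "f \<in> schwartz" "\<And>p. p \<in> X \<Longrightarrow> p (f - ?z) < e" for f
    using sub' that by blast
  have nn: "0 \<le> p f" if "p \<in> X" "f \<in> schwartz" for p f
    using X(2) that schwartz_seminorm_nonneg by blast
  show ?thesis
  proof (rule dominatedI[of "2 / e" X])
    fix f :: "'a \<Rightarrow> complex" and i :: unit assume f: "f \<in> schwartz"
    define s where "s = (\<Sum>p\<in>X. p f)"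
    have s: "0 \<le> s" unfolding s_def using nn f by (intro sum_nonneg) auto
    \<comment> \<open>The positive \<open>\<eta>\<close> keeps the scaling factor finite when all
      seminorms of \<open>f\<close> in \<open>X\<close> vanish; it is removed afterwards by a
      limit.\<close>
    have le: "norm (u f) \<le> 2 / e * s + 2 / e * \<eta>" if \<eta>: "0 < \<eta>" for \<eta>
    proof -
      define t where "t = e / (2 * (s + \<eta>))"
      have t: "0 < t" using X(3) s \<eta> by (simp add: t_def)
      have "(\<lambda>x. complex_of_real t * f x) \<in> ?U"
      proof (rule sub[OF schwartz_cmult[OF f]])
        fix p assume p: "p \<in> X"
        then obtain N vs where pe: "p = schwartz_seminorm N vs" using X(2) by blast
        have "p f \<le> s" unfolding s_def using X(1) p nn[OF _ f] by (intro member_le_sum) auto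
        have "p (\<lambda>x. complex_of_real t * f x) \<le> t * p f"
          using schwartz_seminorm_cmult[OF f, of N vs "complex_of_real t"] t by (simp add: pe)
        also have "\<dots> \<le> t * s" using t \<open>p f \<le> s\<close> by simp
        also have "\<dots> = (e / 2) * (s / (s + \<eta>))" by (simp add: t_def)
        also have "\<dots> \<le> e / 2" using s \<eta> X(3) by (intro mult_right_le_one_le) auto
        also have "\<dots> < e" using X(3) by simp
        finally show "p ((\<lambda>x. complex_of_real t * f x) - ?z) < e" by (simp add: fun_diff_def)
      qed
      then have "norm (u (\<lambda>x. complex_of_real t * f x)) < 1" by simp
      then have "t * norm (u f) < 1" using t by (simp add: tempered_cmult[OF u f] norm_mult)
      then have "norm (u f) < 1 / t" using t by (simp add: field_simps)
      also have "\<dots> = 2 / e * s + 2 / e * \<eta>" using X(3) s \<eta> by (simp add: t_def field_simps)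
      finally show ?thesis by simp
    qed
    have "norm (u f) \<le> 2 / e * s"
    proof (rule field_le_epsilon)
      fix \<delta> :: real assume "0 < \<delta>"
      then show "norm (u f) \<le> 2 / e * s + \<delta>" using le[of "\<delta> * e / 2"] X(3) by simp
    qed
    then show "norm (u f) \<le> 2 / e * (\<Sum>p\<in>X. p f)" by (simp add: s_def)
  qed (use X nn in auto)
qed

lemma temperedI:
  assumes add: "\<And>f g. f \<in> schwartz \<Longrightarrow> g \<in> schwartz \<Longrightarrow> u (\<lambda>x. f x + g x) = u f + u g"
    and cmult: "\<And>a f. f \<in> schwartz \<Longrightarrow> u (\<lambda>x. a * f x) = cnj a * u f"
    and dom: "dominated schwartz schwartz_seminorms (\<lambda>f (i::unit). norm (u f))"
  shows "u \<in> tempered"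
  unfolding tempered_def schwartz_topology_def
proof (intro CollectI conjI ballI allI)
  show "continuous_map (seminorm_topology schwartz schwartz_seminorms) euclidean u"
  proof (rule continuous_map_seminorm_topology[OF _ _ _ _ dom])
    fix f g :: "'a \<Rightarrow> complex" assume fg: "f \<in> schwartz" "g \<in> schwartz"
    show "f - g \<in> schwartz" using fg by (rule schwartz_minus)
    show "u (f - g) = u f - u g"
      using add[OF fg(1) schwartz_cmult[OF fg(2), of "-1"]] cmult[OF fg(2), of "-1"] by (simp add: fun_diff_def)
  qed (auto simp: schwartz_seminorm_diff_self)
qed (use add cmult in auto)

text \<open>If \<open>u\<close> is integrable against some inverse power of the weight, a single
  Schwartz seminorm with that power bounds the pairing.\<close>

lemma (in symplectic) tempered_functionI:
  assumes u [measurable]: "u \<in> borel_measurable borel"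
    and int: "integrable lborel (\<lambda>x. norm (u x) / (1 + norm x) ^ N)"
  shows "tempered_function \<sigma> u"
    and "\<And>f. f \<in> schwartz \<Longrightarrow> integrable lborel (\<lambda>x. cnj (f x) * u x)"
proof -
  have le: "norm (cnj (f x) * u x) \<le> schwartz_seminorm N [] f * (norm (u x) / (1 + norm x) ^ N)"
    if "f \<in> schwartz" for f x
    using mult_right_mono[OF schwartz_le_weight[OF that, of x N] norm_ge_zero[of "u x"]] by (simp add: norm_mult)
  show ig: "integrable lborel (\<lambda>x. cnj (f x) * u x)" if f: "f \<in> schwartz" for f
  proof (rule Bochner_Integration.integrable_bound[OF integrable_mult_right[OF int, of "schwartz_seminorm N [] f"]])
    show "(\<lambda>x. cnj (f x) * u x) \<in> borel_measurable lborel"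
      using borel_measurable_times[OF schwartz_measurable[OF schwartz_cnj[OF f]] u] by simp
  qed (use le[OF f] order_trans[OF le[OF f] abs_ge_self] in \<open>simp\<close>)
  have "func_dist \<sigma> u \<in> tempered"
  proof (rule temperedI)
    fix f g :: "'w \<Rightarrow> complex" assume "f \<in> schwartz" "g \<in> schwartz"
    then show "func_dist \<sigma> u (\<lambda>x. f x + g x) = func_dist \<sigma> u f + func_dist \<sigma> u g"
      using Bochner_Integration.integral_add[OF ig ig, of f g]
      by (simp add: func_dist_def integral_dsigma distrib_right scaleR_add_right)
  next
    fix a and f :: "'w \<Rightarrow> complex" assume "f \<in> schwartz"
    then show "func_dist \<sigma> u (\<lambda>x. a * f x) = cnj a * func_dist \<sigma> u f"
      by (simp add: func_dist_def mult.assoc)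
  next
    let ?C = "haar_const * (\<integral>x. norm (u x) / (1 + norm x) ^ N \<partial>lborel)"
    have C: "0 \<le> ?C" using haar_const(1) by (intro mult_nonneg_nonneg integral_nonneg_AE) auto
    have "dominated schwartz schwartz_seminorms (\<lambda>f (i::unit). ?C * schwartz_seminorm N [] f)"
      by (intro dominated_cmult dominated_base C) (auto simp: schwartz_seminorm_nonneg)
    then show "dominated schwartz schwartz_seminorms (\<lambda>f (i::unit). norm (func_dist \<sigma> u f))"
    proof (rule dominated_le)
      fix f :: "'w \<Rightarrow> complex" assume f: "f \<in> schwartz"
      have "norm (\<integral>x. cnj (f x) * u x \<partial>lborel) \<le> (\<integral>x. schwartz_seminorm N [] f * (norm (u x) / (1 + norm x) ^ N) \<partial>lborel)"
        by (rule order_trans[OF integral_norm_bound integral_mono])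
          (intro integrable_norm ig f integrable_mult_right int le[OF f])+
      then have "haar_const * norm (\<integral>x. cnj (f x) * u x \<partial>lborel) \<le>
          haar_const * (schwartz_seminorm N [] f * (\<integral>x. norm (u x) / (1 + norm x) ^ N \<partial>lborel))"
        using haar_const(1) unfolding integral_mult_right_zero by (intro mult_left_mono) auto
      then show "norm (func_dist \<sigma> u f) \<le> ?C * schwartz_seminorm N [] f"
        using haar_const(1) by (simp add: func_dist_def integral_dsigma mult_ac)
    qed
  qed
  then show "tempered_function \<sigma> u"
    unfolding tempered_function_def using ig by (simp add: integrable_dsigma)
qed

section \<open>Integrals of translates\<close>

lemma dir_derivs_reflect:
  fixes f :: "'w::euclidean_space \<Rightarrow> complex"
  assumes "smooth f"
  shows "dir_derivs vs (\<lambda>x. f (- x)) = (\<lambda>x. (- 1) ^ length vs * dir_derivs vs f (- x))"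
proof (induction vs)
  case (Cons v vs)
  have "dderiv v (\<lambda>x. (- 1) ^ length vs * dir_derivs vs f (- x)) = (\<lambda>x. (- 1) ^ length (v # vs) * dderiv v (dir_derivs vs f) (- x))"
  proof (rule dderiv_eqI[THEN trans])
    fix x
    let ?g = "dir_derivs vs f"
    have g: "(?g has_derivative frechet_derivative ?g (at (- x))) (at (- x))"
      using smooth_has_derivative[OF smooth_dir_derivs[OF assms]] .
    have "((\<lambda>x. - x) has_derivative (\<lambda>h. - h)) (at x)" by (auto intro!: derivative_eq_intros)
    from has_derivative_compose[OF this g]
    show "((\<lambda>x. (- 1) ^ length vs * ?g (- x)) has_derivative (\<lambda>h. (- 1) ^ length vs * frechet_derivative ?g (at (- x)) (- h))) (at x)"
      by (rule has_derivative_mult_right)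
  next
    show "(\<lambda>x. (- 1) ^ length vs * dderiv (- v) (dir_derivs vs f) (- x)) = (\<lambda>x. (- 1) ^ length (v # vs) * dderiv v (dir_derivs vs f) (- x))"
      using linear_neg[OF has_derivative_linear[OF smooth_has_derivative[OF smooth_dir_derivs[OF assms]]]] by simp
  qed
  then show ?case using Cons by (simp add: dir_derivs_Cons)
qed simp

lemma schwartz_reflect:
  assumes f: "f \<in> schwartz" shows "(\<lambda>x. f (- x)) \<in> schwartz"
proof (rule schwartzI)
  show "smooth (\<lambda>x. f (- x))"
    unfolding smooth_def dir_derivs_reflect[OF schwartz_smooth[OF f]]
  proof (intro allI)
    fix vs x
    let ?g = "dir_derivs vs f"
    have g: "(?g has_derivative frechet_derivative ?g (at (- x))) (at (- x))"
      using smooth_has_derivative[OF smooth_dir_derivs[OF schwartz_smooth[OF f]]] .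
    have "((\<lambda>x. - x) has_derivative (\<lambda>h. - h)) (at x)" by (auto intro!: derivative_eq_intros)
    from has_derivative_mult_right[OF has_derivative_compose[OF this g], of "(- 1) ^ length vs"]
    show "(\<lambda>x. (- 1) ^ length vs * ?g (- x)) differentiable (at x)"
      unfolding differentiable_def by blast
  qed
  fix N vs
  have "(1 + norm x) ^ N * norm (dir_derivs vs (\<lambda>x. f (- x)) x) \<le> schwartz_seminorm N vs f" for x
    using schwartz_seminorm_ge[OF f, of "- x" N vs]
    by (simp add: dir_derivs_reflect[OF schwartz_smooth[OF f]] norm_mult norm_power)
  then show "\<exists>C. \<forall>x. (1 + norm x) ^ N * norm (dir_derivs vs (\<lambda>x. f (- x)) x) \<le> C" by blast
qed

section \<open>Correlations of Schwartz functions and functionals of translates\<close>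

lemma schwartz_dir_derivs: "f \<in> schwartz \<Longrightarrow> dir_derivs vs f \<in> schwartz"
  by (induction vs) (simp_all add: dir_derivs_Cons schwartz_dderiv)

text \<open>A correlation rather than a convolution, because Kato's identity integrates the
  translates G(x + .). The conjugate on \<open>g\<close> compensates the antilinearity of the
  functional that will be applied.\<close>

definition corr :: "('w::euclidean_space \<Rightarrow> complex) \<Rightarrow> ('w \<Rightarrow> complex) \<Rightarrow> 'w \<Rightarrow> complex"
  where "corr f g y = (\<integral>x. f (x + y) * cnj (g x) \<partial>lborel)"

context symplectic
begin

text \<open>Convolution theorem: \<open>f\<close> is written as \<open>haar_const\<^sup>2\<close>
  times its twofold transform and the integrals are exchanged. As the transform of a product of
  Schwartz functions, the correlation is a Schwartz function without further estimates.\<close>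

lemma corr_eq:
  assumes f: "f \<in> schwartz" and g: "g \<in> schwartz"
  shows "corr f g = F (\<lambda>z. complex_of_real (haar_const\<^sup>2) * (F f z * cnj (F g z)))"
proof
  fix y
  let ?k = "complex_of_real (haar_const\<^sup>2)"
  let ?e = "\<lambda>x z. exp (- \<i> * complex_of_real (\<sigma> x z))"
  have cF: "cnj (F g z) = (\<integral>x. ?e x z * cnj (g x) \<partial>lborel)" for z
  proof -
    have "cnj (?e z x) = ?e x z" for x using sigma_antisym[of x z] by (simp add: exp_cnj)
    then show ?thesis
      unfolding fourier_wrt_def by (simp only: Bochner_Integration.integral_cnj[symmetric] complex_cnj_mult)
  qed
  have f_eq: "f w = ?k * F (F f) w" for w
    using haar_const(1) by (simp add: haar_const(3)[OF f] power2_eq_square)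
  have e_add: "?e (x + y) z = ?e y z * ?e x z" for x z
    by (simp add: sigma_simps algebra_simps flip: exp_add)
  have "corr f g y = (\<integral>x. (\<integral>z. (?e x z) * (cnj (g x) * (?k * (?e y z * F f z))) \<partial>lborel) \<partial>lborel)"
    unfolding corr_def f_eq[of "_ + y"] fourier_wrt_def[of lborel \<sigma> "F f"]
    by (simp only: integral_mult_right_zero[symmetric] integral_mult_left_zero[symmetric] e_add mult_ac)
  also have "\<dots> = (\<integral>z. (\<integral>x. (?e x z) * (cnj (g x) * (?k * (?e y z * F f z))) \<partial>lborel) \<partial>lborel)"
    using lborel_Fubini_kernel[OF schwartz_integrable(1)[OF schwartz_cnj[OF g]]
        integrable_mult_right[OF F_integrable[OF schwartz_F[OF f], of y], of ?k], of "\<lambda>(x, z). ?e x z"]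
    by (simp add: case_prod_beta')
  also have "\<dots> = F (\<lambda>z. ?k * (F f z * cnj (F g z))) y"
    unfolding fourier_wrt_def[of lborel \<sigma> "\<lambda>z. ?k * (F f z * cnj (F g z))"] unfolding cF
    by (simp only: integral_mult_right_zero[symmetric] integral_mult_left_zero[symmetric] mult_ac)
  finally show "corr f g y = F (\<lambda>z. ?k * (F f z * cnj (F g z))) y" .
qed

lemma corr_symbol_schwartz:
  assumes f: "f \<in> schwartz" and g: "g \<in> schwartz"
  shows "(\<lambda>z. complex_of_real (haar_const\<^sup>2) * (F f z * cnj (F g z))) \<in> schwartz"
  by (intro schwartz_cmult schwartz_mult_Cpol schwartz_cnj schwartz_F f g schwartz_Cpol)

lemma corr_schwartz:
  fixes f g :: "'w \<Rightarrow> complex"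
  assumes f: "f \<in> schwartz" and g: "g \<in> schwartz"
  shows "corr f g \<in> schwartz"
  unfolding corr_eq[OF f g] by (intro schwartz_F corr_symbol_schwartz f g)

text \<open>On the Fourier side, differentiating the correlation and differentiating
  \<open>f\<close> are the same multiplication.\<close>

lemma dderiv_corr:
  fixes f g :: "'w \<Rightarrow> complex"
  assumes f: "f \<in> schwartz" and g: "g \<in> schwartz"
  shows "dderiv v (corr f g) = corr (dderiv v f) g"
proof -
  have "- \<i> * complex_of_real (\<sigma> v z) * (complex_of_real (haar_const\<^sup>2) * (F f z * cnj (F g z))) =
      complex_of_real (haar_const\<^sup>2) * (F (dderiv v f) z * cnj (F g z))" for z
    unfolding F_dderiv[OF f] using sigma_antisym[of z v] by simp
  then show ?thesis
    unfolding corr_eq[OF f g] corr_eq[OF schwartz_dderiv[OF f] g] dderiv_F[OF corr_symbol_schwartz[OF f g]] by simp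
qed

lemma dir_derivs_corr:
  fixes f g :: "'w \<Rightarrow> complex"
  shows "f \<in> schwartz \<Longrightarrow> g \<in> schwartz \<Longrightarrow> dir_derivs vs (corr f g) = corr (dir_derivs vs f) g"
  by (induction vs) (simp_all add: dir_derivs_Cons dderiv_corr schwartz_dir_derivs)

end

text \<open>One pair of constants serves finitely many seminorms, both for the growth of translates
  and for their Lipschitz dependence on the displacement. Raising exponents to \<open>M + N\<close>
  is harmless because the weights are at least 1.\<close>

lemma translate_bounds_sum:
  fixes f :: "'w::euclidean_space \<Rightarrow> complex"
  assumes f: "f \<in> schwartz" and X: "finite X" "X \<subseteq> schwartz_seminorms"
  shows "\<exists>K M. 0 \<le> K \<and> (\<forall>x. (\<Sum>p\<in>X. p (\<lambda>y. f (x + y))) \<le> K * (1 + norm x) ^ M) \<and>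
    (\<forall>v x. (\<Sum>p\<in>X. p (\<lambda>y. f (v + y) - f (x + y))) \<le> norm (v - x) * (K * (1 + norm v + norm x) ^ M))"
  using X
proof (induction X rule: finite_induct)
  case empty
  show ?case by (rule exI[of _ 0]) simp
next
  case (insert p X)
  then obtain K M where K: "0 \<le> K" "\<And>x. (\<Sum>p\<in>X. p (\<lambda>y. f (x + y))) \<le> K * (1 + norm x) ^ M"
    "\<And>v x. (\<Sum>p\<in>X. p (\<lambda>y. f (v + y) - f (x + y))) \<le> norm (v - x) * (K * (1 + norm v + norm x) ^ M)" by auto
  from insert obtain N vs where p: "p = schwartz_seminorm N vs" by auto
  let ?L = "schwartz_seminorm N vs f + (\<Sum>b\<in>Basis. schwartz_seminorm N (b # vs) f)"
  have nn: "0 \<le> schwartz_seminorm N vs f" "0 \<le> (\<Sum>b\<in>Basis. schwartz_seminorm N (b # vs) f)"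
    by (intro sum_nonneg schwartz_seminorm_nonneg f)+
  have pow: "a ^ M \<le> a ^ (M + N)" "a ^ N \<le> a ^ (M + N)" if "1 \<le> a" for a :: real
    using that by (simp_all add: power_increasing)
  have 1: "p (\<lambda>y. f (x + y)) \<le> ?L * (1 + norm x) ^ (M + N)" for x
  proof -
    have "p (\<lambda>y. f (x + y)) \<le> (1 + norm x) ^ N * schwartz_seminorm N vs f"
      unfolding p by (rule schwartz_seminorm_le)
        (simp add: dir_derivs_translate[OF schwartz_smooth[OF f]] schwartz_translate_bound[OF f])
    also have "\<dots> \<le> (1 + norm x) ^ (M + N) * ?L"
      using nn pow(2)[of "1 + norm x"] by (intro mult_mono) auto
    finally show ?thesis by (simp add: mult.commute)
  qed
  have 2: "p (\<lambda>y. f (v + y) - f (x + y)) \<le> norm (v - x) * (?L * (1 + norm v + norm x) ^ (M + N))" for v x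
  proof -
    have d: "dir_derivs vs (\<lambda>y. f (v + y) - f (x + y)) = (\<lambda>y. dir_derivs vs f (v + y) - dir_derivs vs f (x + y))"
      using dir_derivs_add[OF smooth_translate[OF schwartz_smooth[OF f], of v]
          smooth_translate[OF schwartz_smooth[OF schwartz_cmult[OF f, of "-1"]], of x], of vs]
        dir_derivs_bounded_linear[OF bounded_linear_minus[OF bounded_linear_ident] smooth_translate[OF schwartz_smooth[OF f], of x], of vs]
      by (simp add: dir_derivs_translate[OF schwartz_smooth[OF f]])
    have "p (\<lambda>y. f (v + y) - f (x + y)) \<le> norm (v - x) * ((1 + norm v + norm x) ^ N * (\<Sum>b\<in>Basis. schwartz_seminorm N (b # vs) f))"
      unfolding p by (rule schwartz_seminorm_le) (simp only: d schwartz_translate_diff_bound[OF f])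
    also have "\<dots> \<le> norm (v - x) * ((1 + norm v + norm x) ^ (M + N) * ?L)"
      using nn pow(2)[of "1 + norm v + norm x"] by (intro mult_left_mono mult_mono) auto
    finally show ?thesis by (simp add: mult_ac)
  qed
  show ?case
  proof (intro exI[of _ "K + ?L"] exI[of _ "M + N"] conjI allI)
    show "0 \<le> K + ?L" using K(1) nn by simp
    fix x :: 'w
    have "K * (1 + norm x) ^ M \<le> K * (1 + norm x) ^ (M + N)" using K(1) pow(1) by (intro mult_left_mono) auto
    then show "(\<Sum>p\<in>insert p X. p (\<lambda>y. f (x + y))) \<le> (K + ?L) * (1 + norm x) ^ (M + N)"
      using insert(1,2) K(2)[of x] 1[of x] by (simp add: distrib_right)
  next
    fix v x :: 'w
    have "norm (v - x) * (K * (1 + norm v + norm x) ^ M) \<le> norm (v - x) * (K * (1 + norm v + norm x) ^ (M + N))"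
      using K(1) pow(1) by (intro mult_left_mono) auto
    with add_mono[OF 2[of v x] order_trans[OF K(3)[of v x] this]]
    show "(\<Sum>p\<in>insert p X. p (\<lambda>y. f (v + y) - f (x + y))) \<le> norm (v - x) * ((K + ?L) * (1 + norm v + norm x) ^ (M + N))"
      using insert(1,2) by (simp add: distrib_left distrib_right algebra_simps)
  qed
qed

text \<open>The growth bound makes the function of the displacement integrable against Schwartz
  functions; the second bound makes it continuous.\<close>

lemma tempered_translates:
  fixes c :: "('w::euclidean_space \<Rightarrow> complex) \<Rightarrow> complex"
  assumes c: "c \<in> tempered" and f: "f \<in> schwartz"
  shows "\<exists>K M. 0 \<le> K \<and> (\<forall>x. norm (c (\<lambda>y. f (x + y))) \<le> K * (1 + norm x) ^ M) \<and>
    (\<forall>v x. norm (c (\<lambda>y. f (v + y)) - c (\<lambda>y. f (x + y))) \<le> norm (v - x) * (K * (1 + norm v + norm x) ^ M))"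
proof -
  obtain C X where X: "0 \<le> C" "finite X" "X \<subseteq> schwartz_seminorms" "\<And>f. f \<in> schwartz \<Longrightarrow> norm (c f) \<le> C * (\<Sum>p\<in>X. p f)"
    using tempered_dominated[OF c] unfolding dominated_def by auto
  obtain K M where K: "0 \<le> K"
    "\<And>x. (\<Sum>p\<in>X. p (\<lambda>y. f (x + y))) \<le> K * (1 + norm x) ^ M"
    "\<And>v x. (\<Sum>p\<in>X. p (\<lambda>y. f (v + y) - f (x + y))) \<le> norm (v - x) * (K * (1 + norm v + norm x) ^ M)"
    using translate_bounds_sum[OF f X(2,3)] by blast
  show ?thesis
  proof (intro exI[of _ "C * K"] exI[of _ M] conjI allI)
    show "0 \<le> C * K" using X(1) K(1) by simp
    fix x :: 'w
    show "norm (c (\<lambda>y. f (x + y))) \<le> C * K * (1 + norm x) ^ M"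
      using order_trans[OF X(4)[OF schwartz_translate[OF f]] mult_left_mono[OF K(2) X(1)]] by (simp add: mult.assoc)
  next
    fix v x :: 'w
    have "norm (c (\<lambda>y. f (v + y)) - c (\<lambda>y. f (x + y))) = norm (c (\<lambda>y. f (v + y) - f (x + y)))"
      by (simp add: tempered_diff[OF c schwartz_translate[OF f] schwartz_translate[OF f]])
    also have "\<dots> \<le> C * (norm (v - x) * (K * (1 + norm v + norm x) ^ M))"
      by (rule order_trans[OF X(4)[OF schwartz_diff[OF schwartz_translate[OF f] schwartz_translate[OF f]]] mult_left_mono[OF K(3) X(1)]])
    finally show "norm (c (\<lambda>y. f (v + y)) - c (\<lambda>y. f (x + y))) \<le> norm (v - x) * (C * K * (1 + norm v + norm x) ^ M)"
      by (simp add: mult_ac)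
  qed
qed

lemma tempered_translates_continuous:
  fixes c :: "('w::euclidean_space \<Rightarrow> complex) \<Rightarrow> complex"
  assumes c: "c \<in> tempered" and f: "f \<in> schwartz"
  shows "continuous_on UNIV (\<lambda>x. c (\<lambda>y. f (x + y)))"
proof -
  obtain K M where K: "0 \<le> K"
    "\<And>v x. norm (c (\<lambda>y. f (v + y)) - c (\<lambda>y. f (x + y))) \<le> norm (v - x) * (K * (1 + norm v + norm x) ^ M)"
    using tempered_translates[OF c f] by blast
  show ?thesis
    unfolding continuous_on_eq_continuous_at[OF open_UNIV]
  proof
    fix x :: 'w
    have "((\<lambda>v. norm (v - x) * (K * (1 + norm v + norm x) ^ M)) \<longlongrightarrow> norm (x - x) * (K * (1 + norm x + norm x) ^ M)) (at x)"
      by (intro tendsto_intros)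
    then have lim: "((\<lambda>v. norm (v - x) * (K * (1 + norm v + norm x) ^ M)) \<longlongrightarrow> 0) (at x)" by simp
    have "((\<lambda>v. c (\<lambda>y. f (v + y)) - c (\<lambda>y. f (x + y))) \<longlongrightarrow> 0) (at x)"
      by (rule Lim_null_comparison[OF _ lim]) (simp add: K(2))
    then show "isCont (\<lambda>x. c (\<lambda>y. f (x + y))) x"
      unfolding isCont_def by (rule LIM_zero_cancel)
  qed
qed

text \<open>Simple functions \<open>s n \<longlonglongrightarrow> id\<close> turn the integrals into finite sums, through which the functional
  passes by linearity; both sides converge because translation is continuous in every seminorm.\<close>

lemma (in symplectic) tempered_corr:
  fixes c :: "('w \<Rightarrow> complex) \<Rightarrow> complex"
  assumes c: "c \<in> tempered" and f: "f \<in> schwartz" and g: "g \<in> schwartz"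
  shows "integrable lborel (\<lambda>x. g x * c (\<lambda>y. f (x + y)))"
    and "c (corr f g) = (\<integral>x. g x * c (\<lambda>y. f (x + y)) \<partial>lborel)"
proof -
  define \<Theta> where "\<Theta> = (\<lambda>x. c (\<lambda>y. f (x + y)))"
  obtain K M where K: "0 \<le> K" "\<And>x. norm (\<Theta> x) \<le> K * (1 + norm x) ^ M"
    unfolding \<Theta>_def using tempered_translates[OF c f] by blast
  have contT: "continuous_on UNIV \<Theta>" unfolding \<Theta>_def by (rule tempered_translates_continuous[OF c f])
  have [measurable]: "\<Theta> \<in> borel_measurable borel" by (rule borel_measurable_continuous_onI[OF contT])
  have gm [measurable]: "g \<in> borel_measurable borel" by (rule schwartz_measurable[OF g])
  \<comment> \<open>The constant \<open>C\<close> is there because \<open>s i x\<close> is only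
    known to have norm at most \<open>2 * norm x\<close>: the majorants below use
    \<open>C = 2\<close> and \<open>C = 3\<close>.\<close>
  have gint: "integrable lborel (\<lambda>x. norm (g x) * (B * (1 + C * norm x) ^ N))" if "0 \<le> B" "0 \<le> C" for B C N
  proof -
    have "integrable lborel (\<lambda>x. g x * complex_of_real (B * (1 + C * norm x) ^ N))"
    proof (rule schwartz_mult_integrable(1)[OF g])
      show "norm (complex_of_real (B * (1 + C * norm x) ^ N)) \<le> B * (1 + C) ^ N * (1 + norm x) ^ N" for x :: 'w
      proof -
        have "1 + C * norm x \<le> (1 + C) * (1 + norm x)" using that(2) by (simp add: algebra_simps)
        then have "(1 + C * norm x) ^ N \<le> ((1 + C) * (1 + norm x)) ^ N" using that(2) by (intro power_mono) auto
        then show ?thesis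
          using that mult_left_mono[of "(1 + C * norm x) ^ N" "((1 + C) * (1 + norm x)) ^ N" B]
          by (simp only: norm_of_real power_mult_distrib) (simp add: mult.assoc)
      qed
    qed measurable
    moreover have "norm (g x * complex_of_real (B * (1 + C * norm x) ^ N)) = norm (g x) * (B * (1 + C * norm x) ^ N)" for x
      unfolding norm_mult norm_of_real using that by (subst abs_of_nonneg) auto
    ultimately show ?thesis using integrable_norm by fastforce
  qed
  have "integrable lborel (\<lambda>x. g x * \<Theta> x)"
    by (rule schwartz_mult_integrable(1)[OF g _ K(2)]) measurable
  then show "integrable lborel (\<lambda>x. g x * c (\<lambda>y. f (x + y)))" by (simp add: \<Theta>_def)
  obtain s :: "nat \<Rightarrow> 'w \<Rightarrow> 'w" where s: "\<And>i. simple_function lborel (s i)" "\<And>x. (\<lambda>i. s i x) \<longlonglongrightarrow> x"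
      "\<And>i x. norm (s i x) \<le> 2 * norm x"
    using borel_measurable_implies_sequence_metric[of "\<lambda>x::'w. x" lborel 0] by auto
  have sm [measurable]: "s i \<in> borel_measurable borel" for i
    using borel_measurable_simple_function[OF s(1)] by simp
  \<comment> \<open>The integral of \<open>cnj g\<close> over the set where \<open>s i\<close> takes
    the value \<open>v\<close>; only finitely many values occur.\<close>
  define a where "a = (\<lambda>i v. \<integral>x. indicator {x. s i x = v} x * cnj (g x) \<partial>lborel)"
  have fin: "finite (range (s i))" for i using simple_functionD(1)[OF s(1)[of i]] by simp
  have ind_int: "integrable lborel (\<lambda>x. indicator {x. s i x = v} x * w x)" if "integrable lborel w"
    for w :: "'w \<Rightarrow> complex" and i v
  proof -
    have A: "{x. s i x = v} \<in> sets lborel"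
      using measurable_sets[OF sm[of i], of "{v}"] by (simp add: vimage_def)
    show ?thesis
    proof (rule Bochner_Integration.integrable_bound[OF that])
      show "(\<lambda>x. indicator {x. s i x = v} x * w x) \<in> borel_measurable lborel"
        by (rule borel_measurable_times[OF borel_measurable_indicator[OF A] borel_measurable_integrable[OF that]])
    qed (auto simp: norm_mult indicator_def)
  qed
  \<comment> \<open>\<open>\<Phi>\<close> is left open because it will be a translate of
    \<open>f\<close>, a translate of a derivative of \<open>f\<close>, and the scalar function
    \<open>\<Theta>\<close>.\<close>
  have split: "(\<integral>x. \<Phi> (s i x) * w x \<partial>lborel) = (\<Sum>v\<in>range (s i). \<Phi> v * (\<integral>x. indicator {x. s i x = v} x * w x \<partial>lborel))"
    if "integrable lborel w" for \<Phi> :: "'w \<Rightarrow> complex" and w i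
  proof -
    have "\<Phi> (s i x) * w x = (\<Sum>v\<in>range (s i). \<Phi> v * (indicator {x. s i x = v} x * w x))" for x
    proof -
      have "(\<Sum>v\<in>range (s i). \<Phi> v * (indicator {x. s i x = v} x * w x)) = (\<Sum>v\<in>range (s i). if s i x = v then \<Phi> v * w x else 0)"
        by (intro sum.cong) (auto simp: indicator_def)
      also have "\<dots> = \<Phi> (s i x) * w x" using fin[of i] by simp
      finally show ?thesis by simp
    qed
    then have "(\<integral>x. \<Phi> (s i x) * w x \<partial>lborel) = (\<integral>x. (\<Sum>v\<in>range (s i). \<Phi> v * (indicator {x. s i x = v} x * w x)) \<partial>lborel)"
      by simp
    also have "\<dots> = (\<Sum>v\<in>range (s i). \<integral>x. \<Phi> v * (indicator {x. s i x = v} x * w x) \<partial>lborel)"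
      by (rule Bochner_Integration.integral_sum) (intro integrable_mult_right ind_int that)
    finally show ?thesis by simp
  qed
  have gi: "integrable lborel (\<lambda>x. cnj (g x))" by (intro schwartz_integrable(1) schwartz_cnj g)
  define h where "h = (\<lambda>i y. \<integral>x. f (s i x + y) * cnj (g x) \<partial>lborel)"
  have h_eq: "h i = (\<lambda>y. \<Sum>v\<in>range (s i). a i v * f (v + y))" for i
    unfolding h_def a_def using split[OF gi, of "\<lambda>v. f (v + _)" i] by (simp add: mult.commute)
  note sums = tempered_sum[OF c fin, of _ "\<lambda>v y. f (v + y)" "a _", OF schwartz_translate[OF f]]
  have h_schwartz: "h i \<in> schwartz" for i unfolding h_eq by (rule sums(1))
  \<comment> \<open>Antilinearity of \<open>c\<close> conjugates the coefficients and thereby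
    removes the conjugate from \<open>g\<close>.\<close>
  have c_h: "c (h i) = (\<integral>x. g x * \<Theta> (s i x) \<partial>lborel)" for i
  proof -
    have "cnj (a i v) = (\<integral>x. indicator {x. s i x = v} x * g x \<partial>lborel)" for v
    proof -
      have "cnj (indicator A x) = (indicator A x :: complex)" for A :: "'w set" and x
        by (simp add: indicator_def)
      then show ?thesis unfolding a_def Bochner_Integration.integral_cnj[symmetric] by simp
    qed
    then have "c (h i) = (\<Sum>v\<in>range (s i). \<Theta> v * (\<integral>x. indicator {x. s i x = v} x * g x \<partial>lborel))"
      unfolding h_eq sums(2) \<Theta>_def by (simp add: mult.commute)
    also have "\<dots> = (\<integral>x. \<Theta> (s i x) * g x \<partial>lborel)"
      by (rule split[OF schwartz_integrable(1)[OF g], symmetric])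
    finally show ?thesis by (simp add: mult.commute)
  qed
  have "(\<lambda>i. c (h i)) \<longlonglongrightarrow> (\<integral>x. g x * \<Theta> x \<partial>lborel)"
    unfolding c_h
  proof (rule integral_dominated_convergence[where w = "\<lambda>x. norm (g x) * (K * (1 + 2 * norm x) ^ M)"])
    show "integrable lborel (\<lambda>x. norm (g x) * (K * (1 + 2 * norm x) ^ M))" by (rule gint[OF K(1)]) simp
    show "AE x in lborel. (\<lambda>i. g x * \<Theta> (s i x)) \<longlonglongrightarrow> g x * \<Theta> x"
    proof (rule AE_I2)
      fix x
      have "isCont \<Theta> x" using contT by (simp add: continuous_on_eq_continuous_at)
      then show "(\<lambda>i. g x * \<Theta> (s i x)) \<longlonglongrightarrow> g x * \<Theta> x"
        by (intro tendsto_mult tendsto_const isCont_tendsto_compose[OF _ s(2)])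
    qed
    show "AE x in lborel. norm (g x * \<Theta> (s i x)) \<le> norm (g x) * (K * (1 + 2 * norm x) ^ M)" for i
    proof (rule AE_I2)
      fix x
      have "(1 + norm (s i x)) ^ M \<le> (1 + 2 * norm x) ^ M" using s(3)[of i x] by (intro power_mono) auto
      then show "norm (g x * \<Theta> (s i x)) \<le> norm (g x) * (K * (1 + 2 * norm x) ^ M)"
        unfolding norm_mult using K(1) by (intro mult_left_mono order_trans[OF K(2)]) auto
    qed
  qed measurable
  moreover have "(\<lambda>i. c (h i)) \<longlonglongrightarrow> c (corr f g)"
  proof -
    have cs: "corr f g \<in> schwartz" by (rule corr_schwartz[OF f g])
    \<comment> \<open>Derivatives act termwise on the finite sum and through
      \<open>dir_derivs_corr\<close> on the correlation. Both sides are then integrals against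
      \<open>cnj g\<close>, and their difference is controlled by the displacement
      \<open>norm (s i x - x)\<close>.\<close>
    have lim: "(\<lambda>i. schwartz_seminorm N vs (\<lambda>y. h i y - corr f g y)) \<longlonglongrightarrow> 0" for N vs
    proof -
      define L where "L = (\<Sum>b\<in>Basis. schwartz_seminorm N (b # vs) f)"
      have L: "0 \<le> L" unfolding L_def by (intro sum_nonneg schwartz_seminorm_nonneg f)
      let ?f = "dir_derivs vs f"
      have fs: "?f \<in> schwartz" by (rule schwartz_dir_derivs[OF f])
      have fbd: "norm (?f x) \<le> schwartz_seminorm 0 [] ?f" for x
        using schwartz_seminorm_ge[OF fs, of x 0 "[]"] by simp
      have [measurable]: "?f \<in> borel_measurable borel" by (rule schwartz_measurable[OF fs])
      have dh: "dir_derivs vs (h i) y = (\<integral>x. ?f (s i x + y) * cnj (g x) \<partial>lborel)" for i y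
      proof -
        have "smooth (\<lambda>y. \<Sum>v\<in>V. a i v * f (v + y)) \<and>
            dir_derivs vs (\<lambda>y. \<Sum>v\<in>V. a i v * f (v + y)) = (\<lambda>y. \<Sum>v\<in>V. a i v * ?f (v + y))" if "finite V" for V
          using that
        proof (induction V)
          case empty
          have "dir_derivs vs (\<lambda>_::'w. 0::complex) = (\<lambda>_. 0)"
            using dir_derivs_bounded_linear[OF bounded_linear_zero schwartz_smooth[OF f], of vs] by simp
          then show ?case by (simp add: smooth_const)
        next
          case (insert v V)
          have sm: "smooth (\<lambda>y. a i v * f (v + y))"
            by (intro schwartz_smooth schwartz_cmult schwartz_translate f)
          have "dir_derivs vs (\<lambda>y. a i v * f (v + y)) = (\<lambda>y. a i v * ?f (v + y))"
            using dir_derivs_bounded_linear[OF bounded_linear_mult_right smooth_translate[OF schwartz_smooth[OF f]]]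
            by (simp add: dir_derivs_translate[OF schwartz_smooth[OF f]])
          then show ?case using insert sm by (simp add: smooth_add dir_derivs_add)
        qed
        then have "dir_derivs vs (h i) y = (\<Sum>v\<in>range (s i). a i v * ?f (v + y))"
          unfolding h_eq using fin[of i] by simp
        also have "\<dots> = (\<integral>x. ?f (s i x + y) * cnj (g x) \<partial>lborel)"
          unfolding a_def using split[OF gi, of "\<lambda>v. ?f (v + y)" i] by (simp add: mult.commute)
        finally show ?thesis .
      qed
      let ?d = "\<lambda>i. \<integral>x. norm (g x) * (norm (s i x - x) * ((1 + norm (s i x) + norm x) ^ N * L)) \<partial>lborel"
      \<comment> \<open>The number 3 comes from
        \<open>norm (s i x) + norm x \<le> 3 * norm x\<close>, the additional power from absorbing
        the displacement into the weight.\<close>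
      have dom: "norm (s i x - x) * ((1 + norm (s i x) + norm x) ^ N * L) \<le> (3 * L) * (1 + 3 * norm x) ^ (Suc N)" for i x
      proof -
        have "norm (s i x - x) \<le> 3 * norm x" using norm_triangle_ineq4[of "s i x" x] s(3)[of i x] by simp
        also have "\<dots> \<le> 3 * (1 + 3 * norm x)" by simp
        finally have "norm (s i x - x) * ((1 + norm (s i x) + norm x) ^ N * L) \<le> (3 * (1 + 3 * norm x)) * ((1 + 3 * norm x) ^ N * L)"
          using s(3)[of i x] L by (intro mult_mono mult_right_mono power_mono) auto
        then show ?thesis by (simp only: power_Suc mult_ac)
      qed
      have dint: "integrable lborel (\<lambda>x. norm (g x) * (norm (s i x - x) * ((1 + norm (s i x) + norm x) ^ N * L)))" for i
        by (rule Bochner_Integration.integrable_bound[OF gint[of "3 * L" 3 "Suc N"]])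
          (use L dom[of i] order_trans[OF mult_left_mono[OF dom norm_ge_zero] abs_ge_self] in \<open>auto intro!: AE_I2 simp: abs_mult mult_left_mono\<close>)
      have "?d \<longlonglongrightarrow> (\<integral>x. 0 \<partial>(lborel :: 'w measure))"
      proof (rule integral_dominated_convergence[where w = "\<lambda>x. norm (g x) * ((3 * L) * (1 + 3 * norm x) ^ (Suc N))"])
        show "integrable lborel (\<lambda>x. norm (g x) * ((3 * L) * (1 + 3 * norm x) ^ (Suc N)))"
          by (rule gint) (use L in auto)
        show "AE x in lborel. (\<lambda>i. norm (g x) * (norm (s i x - x) * ((1 + norm (s i x) + norm x) ^ N * L))) \<longlonglongrightarrow> 0"
        proof (rule AE_I2)
          fix x
          have "(\<lambda>i. norm (g x) * (norm (s i x - x) * ((1 + norm (s i x) + norm x) ^ N * L))) \<longlonglongrightarrow>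
              norm (g x) * (norm (x - x) * ((1 + norm x + norm x) ^ N * L))"
            by (intro tendsto_intros s(2))
          then show "(\<lambda>i. norm (g x) * (norm (s i x - x) * ((1 + norm (s i x) + norm x) ^ N * L))) \<longlonglongrightarrow> 0" by simp
        qed
        show "AE x in lborel. norm (norm (g x) * (norm (s i x - x) * ((1 + norm (s i x) + norm x) ^ N * L))) \<le>
            norm (g x) * ((3 * L) * (1 + 3 * norm x) ^ (Suc N))" for i
          using dom[of i] L by (intro AE_I2) (simp add: abs_mult mult_left_mono)
      qed measurable
      then have d0: "?d \<longlonglongrightarrow> 0" by simp
      have "schwartz_seminorm N vs (\<lambda>y. h i y - corr f g y) \<le> ?d i" for i
      proof (rule schwartz_seminorm_le)
        fix y
        have int1: "integrable lborel (\<lambda>x. ?f (t x + y) * cnj (g x))" if [measurable]: "t \<in> borel_measurable borel" for t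
        proof (rule Bochner_Integration.integrable_bound[OF integrable_mult_right[OF integrable_norm[OF gi], of "schwartz_seminorm 0 [] ?f"]])
          show "(\<lambda>x. ?f (t x + y) * cnj (g x)) \<in> borel_measurable lborel" by measurable
        qed (auto intro!: AE_I2 simp: norm_mult abs_mult intro: mult_right_mono order_trans[OF fbd abs_ge_self])
        have idm: "(\<lambda>x::'w. x) \<in> borel_measurable borel" by simp
        have "dir_derivs vs (\<lambda>y. h i y - corr f g y) y = dir_derivs vs (h i) y - corr ?f g y"
        proof -
          have "dir_derivs vs (\<lambda>y. h i y + (- 1) * corr f g y) y = dir_derivs vs (h i) y + (- 1) * corr ?f g y"
            using dir_derivs_add[OF schwartz_smooth[OF h_schwartz[of i]] schwartz_smooth[OF schwartz_cmult[OF cs, of "-1"]], of vs]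
              dir_derivs_bounded_linear[OF bounded_linear_mult_right schwartz_smooth[OF cs], of vs "-1"]
            by (simp add: dir_derivs_corr[OF f g])
          then show ?thesis by simp
        qed
        also have "\<dots> = (\<integral>x. (?f (s i x + y) - ?f (x + y)) * cnj (g x) \<partial>lborel)"
          unfolding dh corr_def using Bochner_Integration.integral_diff[OF int1[OF sm[of i]] int1[OF idm]]
          by (simp only: left_diff_distrib)
        finally have eq: "dir_derivs vs (\<lambda>y. h i y - corr f g y) y = (\<integral>x. (?f (s i x + y) - ?f (x + y)) * cnj (g x) \<partial>lborel)" .
        have int2: "integrable lborel (\<lambda>x. (?f (s i x + y) - ?f (x + y)) * cnj (g x))"
          using Bochner_Integration.integrable_diff[OF int1[OF sm[of i]] int1[OF idm]] by (simp only: left_diff_distrib)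
        have "(1 + norm y) ^ N * norm (dir_derivs vs (\<lambda>y. h i y - corr f g y) y) \<le>
            (1 + norm y) ^ N * (\<integral>x. norm ((?f (s i x + y) - ?f (x + y)) * cnj (g x)) \<partial>lborel)"
          unfolding eq by (intro mult_left_mono integral_norm_bound) simp
        also have "\<dots> = (\<integral>x. (1 + norm y) ^ N * norm ((?f (s i x + y) - ?f (x + y)) * cnj (g x)) \<partial>lborel)"
          by simp
        also have "\<dots> \<le> ?d i"
        proof (rule integral_mono[OF integrable_mult_right[OF integrable_norm[OF int2]] dint])
          fix x
          have "norm (g x) * ((1 + norm y) ^ N * norm (?f (s i x + y) - ?f (x + y))) \<le>
              norm (g x) * (norm (s i x - x) * ((1 + norm (s i x) + norm x) ^ N * L))"
            unfolding L_def by (intro mult_left_mono schwartz_translate_diff_bound f) simp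
          then show "(1 + norm y) ^ N * norm ((?f (s i x + y) - ?f (x + y)) * cnj (g x)) \<le>
              norm (g x) * (norm (s i x - x) * ((1 + norm (s i x) + norm x) ^ N * L))"
            by (simp add: norm_mult mult_ac)
        qed
        finally show "(1 + norm y) ^ N * norm (dir_derivs vs (\<lambda>y. h i y - corr f g y) y) \<le> ?d i" .
      qed
      then show ?thesis
        by (intro tendsto_sandwich[OF _ _ tendsto_const d0] always_eventually allI schwartz_seminorm_nonneg schwartz_diff h_schwartz cs)
    qed
    obtain C X where X: "0 \<le> C" "finite X" "X \<subseteq> schwartz_seminorms" "\<And>f. f \<in> schwartz \<Longrightarrow> norm (c f) \<le> C * (\<Sum>p\<in>X. p f)"
      using tempered_dominated[OF c] unfolding dominated_def by auto
    have "(\<lambda>i. C * (\<Sum>p\<in>X. p (\<lambda>y. h i y - corr f g y))) \<longlonglongrightarrow> C * (\<Sum>p\<in>X. 0)"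
      using X(3) lim by (intro tendsto_mult tendsto_const tendsto_sum) auto
    then have X0: "(\<lambda>i. C * (\<Sum>p\<in>X. p (\<lambda>y. h i y - corr f g y))) \<longlonglongrightarrow> 0" by simp
    have le: "norm (c (h i) - c (corr f g)) \<le> C * (\<Sum>p\<in>X. p (\<lambda>y. h i y - corr f g y))" for i
      using X(4)[OF schwartz_diff[OF h_schwartz[of i] cs]] by (simp add: tempered_diff[OF c h_schwartz cs])
    have "(\<lambda>i. c (h i) - c (corr f g)) \<longlonglongrightarrow> 0"
      by (rule Lim_null_comparison[OF always_eventually X0]) (rule allI, rule le)
    then show ?thesis by (rule LIM_zero_cancel)
  qed
  ultimately show "c (corr f g) = (\<integral>x. g x * c (\<lambda>y. f (x + y)) \<partial>lborel)"
    unfolding \<Theta>_def by (metis LIMSEQ_unique)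
qed

section \<open>Kato's identity with a tempered distribution\<close>

context weyl_representation
begin

text \<open>Serves both (a) and (b): \<open>L\<close> is the Fourier transformation, in (b) preceded
  by multiplication with the conjugate of \<open>h\<close>. Its continuity is required in the form
  that it preserves families of Schwartz functions.\<close>

lemma smooth_operatorsI:
  fixes L :: "('w \<Rightarrow> complex) \<Rightarrow> 'w \<Rightarrow> complex"
  assumes u: "u \<in> tempered"
    and L_sv: "\<And>K. schwartz_valued Sm smooth_seminorms K \<Longrightarrow> schwartz_valued Sm smooth_seminorms (\<lambda>v. L (K v))"
    and L_add: "\<And>f g. f \<in> schwartz \<Longrightarrow> g \<in> schwartz \<Longrightarrow> L (\<lambda>x. f x + g x) = (\<lambda>x. L f x + L g x)"
    and L_cmult: "\<And>a f. f \<in> schwartz \<Longrightarrow> L (\<lambda>x. a * f x) = (\<lambda>x. a * L f x)"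
    and A: "\<And>v w. v \<in> Sm \<Longrightarrow> w \<in> Sm \<Longrightarrow> A v w = u (L (symbol w v))"
  shows "A \<in> smooth_operators \<sigma> T W"
  unfolding smooth_operators_def
proof (intro CollectI conjI ballI allI)
  have sv: "schwartz_valued Sm smooth_seminorms (\<lambda>w. L (symbol w v))" if "v \<in> Sm" for v
    by (intro L_sv schwartz_valued_symbol that)
  have mem: "L (symbol w v) \<in> schwartz" if "v \<in> Sm" "w \<in> Sm" for v w
    using schwartz_valued_mem[OF sv[OF that(1)] that(2)] .
  note sym = symbol_schwartz
  show "A v \<in> smooth_antidual \<sigma> T W" if v: "v \<in> Sm" for v
    unfolding smooth_antidual_def
  proof (intro CollectI conjI ballI allI)
    show add: "A v (w + w') = A v w + A v w'" if w: "w \<in> Sm" "w' \<in> Sm" for w w'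
      using v w by (simp add: A Sm_add symbol_add_left L_add[OF sym sym] tempered_add[OF u mem mem])
    show cmult: "A v (a *\<^sub>C w) = cnj a * A v w" if w: "w \<in> Sm" for a w
      using v w by (simp add: A Sm_scaleC symbol_scaleC_left L_cmult[OF sym] tempered_cmult[OF u mem])
    show "continuous_map (smooth_topology \<sigma> T W) euclidean (A v)"
    proof (rule continuous_smooth_functional[OF add cmult])
      have "dominated Sm smooth_seminorms (\<lambda>w (i::unit). norm (u (L (symbol w v))))"
      proof (rule dominated_compose[OF tempered_dominated[OF u]])
        fix p :: "('w \<Rightarrow> complex) \<Rightarrow> real" assume "p \<in> schwartz_seminorms"
        then obtain N vs where "p = schwartz_seminorm N vs" by blast
        then show "dominated Sm smooth_seminorms (\<lambda>w (i::unit). p (L (symbol w v)))"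
          using schwartz_valued_seminorm[OF sv[OF v]] by simp
      qed (rule mem[OF v])
      then show "dominated Sm smooth_seminorms (\<lambda>w (i::unit). norm (A v w))"
        by (rule dominated_le) (simp add: A v)
    qed
  qed
  show "A (v + v') w = A v w + A v' w" if "v \<in> Sm" "v' \<in> Sm" "w \<in> Sm" for v v' w
    using that by (simp add: A Sm_add symbol_add_right L_add[OF sym sym] tempered_add[OF u mem mem])
  show "A (a *\<^sub>C v) w = a * A v w" if "v \<in> Sm" "w \<in> Sm" for a v w
    using that by (simp add: A Sm_scaleC symbol_scaleC_right L_cmult[OF sym] tempered_cmult[OF u mem])
qed

lemma Kato_identity_distribution:
  fixes c :: "('w \<Rightarrow> complex) \<Rightarrow> complex"
  assumes b: "b \<in> schwartz" and c: "c \<in> tempered"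
  shows "tempered_function \<sigma> (conv_dist b c)"
    and "Op \<sigma> W (func_dist \<sigma> (conv_dist b c)) \<in> smooth_operators \<sigma> T W"
    and "has_weak_integral \<sigma> W (\<lambda>x \<psi> \<phi>. b x * translate_op \<sigma> T W (Op \<sigma> W c) x \<psi> \<phi>)
          (Op \<sigma> W (func_dist \<sigma> (conv_dist b c)))"
    and "has_distributional_integral W c (\<lambda>x. translate_op \<sigma> T W (Op \<sigma> W (func_dist \<sigma> b)) x)
          (Op \<sigma> W (func_dist \<sigma> (conv_dist b c)))"
proof -
  \<comment> \<open>With this reflection \<open>conv_dist b c\<close> evaluates \<open>c\<close> on
    translates of one function, so the growth and continuity results for translates apply.\<close>
  define b' where "b' = (\<lambda>z. cnj (b (- z)))"
  have b': "b' \<in> schwartz" unfolding b'_def by (intro schwartz_cnj schwartz_reflect b)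
  have conv: "conv_dist b c x = c (\<lambda>y. b' (- x + y))" for x
    by (simp add: conv_dist_def b'_def)
  obtain K M where K: "0 \<le> K" "\<And>x. norm (c (\<lambda>y. b' (x + y))) \<le> K * (1 + norm x) ^ M"
    using tempered_translates[OF c b'] by blast
  have cont: "continuous_on UNIV (\<lambda>x. c (\<lambda>y. b' (- x + y)))"
    using continuous_on_compose2[OF tempered_translates_continuous[OF c b'] continuous_on_minus[OF continuous_on_id]] by simp
  have meas [measurable]: "conv_dist b c \<in> borel_measurable borel"
    unfolding conv by (rule borel_measurable_continuous_onI[OF cont])
  have "integrable lborel (\<lambda>x. norm (conv_dist b c x) / (1 + norm x) ^ (2 * DIM('w) + M))"
  proof (rule Bochner_Integration.integrable_bound[OF integrable_mult_right[OF integrable_weight, of K]])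
    show "AE x in lborel. norm (norm (conv_dist b c x) / (1 + norm x) ^ (2 * DIM('w) + M)) \<le> norm (K * (1 / (1 + norm x) ^ (2 * DIM('w))))"
    proof (rule AE_I2)
      fix x :: 'w
      have p: "0 < (1 + norm x) ^ k" for k by (intro zero_less_power add_pos_nonneg) auto
      have "norm (conv_dist b c x) \<le> K * (1 + norm x) ^ M" unfolding conv using K(2)[of "- x"] by simp
      then have "norm (conv_dist b c x) / (1 + norm x) ^ M \<le> K" using p by (simp add: pos_divide_le_eq)
      then have "norm (conv_dist b c x) / (1 + norm x) ^ M / (1 + norm x) ^ (2 * DIM('w)) \<le> K / (1 + norm x) ^ (2 * DIM('w))"
        using p by (intro divide_right_mono less_imp_le[OF p])
      then show "norm (norm (conv_dist b c x) / (1 + norm x) ^ (2 * DIM('w) + M)) \<le> norm (K * (1 / (1 + norm x) ^ (2 * DIM('w))))"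
        using K(1) p by (simp add: power_add mult.commute abs_of_nonneg)
    qed
  qed measurable
  from tempered_functionI[OF meas this] show tf: "tempered_function \<sigma> (conv_dist b c)" by blast
  then have fd: "func_dist \<sigma> (conv_dist b c) \<in> tempered" by (simp add: tempered_function_def)
  then show "Op \<sigma> W (func_dist \<sigma> (conv_dist b c)) \<in> smooth_operators \<sigma> T W"
    by (rule smooth_operatorsI[where L = "fourier \<sigma>"])
      (simp_all add: schwartz_valued_fourier fourier_add fourier_cmult Op_eq)
  \<comment> \<open>The form in which the two integrals meet the left-hand side: there the
    translates are those of \<open>b'\<close>, whereas the integrals of the theorem translate
    \<open>G\<close> or pair \<open>c\<close> with a correlation of \<open>G\<close>.\<close>
  have main: "func_dist \<sigma> (conv_dist b c) G = c (\<lambda>y. complex_of_real haar_const * corr G b y)"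
    if G: "G \<in> schwartz" for G
  proof -
    define G' where "G' = (\<lambda>x. cnj (G (- x)))"
    have G': "G' \<in> schwartz" unfolding G'_def by (intro schwartz_cnj schwartz_reflect G)
    have [measurable]: "G \<in> borel_measurable borel" "b \<in> borel_measurable borel"
      using G b by (auto intro: schwartz_measurable)
    \<comment> \<open>Reflection together with conjugation exchanges the roles of the two
      functions.\<close>
    have "corr b' G' y = corr G b y" for y
    proof -
      have "corr b' G' y = (\<integral>x. cnj (b (- x - y)) * G (- x) \<partial>lborel)"
        by (simp add: corr_def b'_def G'_def)
      also have "\<dots> = (\<integral>x. cnj (b (x - y)) * G x \<partial>lborel)"
        using lborel_integral_reflect[of "\<lambda>x. cnj (b (x - y)) * G x" 0] by simp
      also have "\<dots> = (\<integral>x. cnj (b x) * G (y + x) \<partial>lborel)"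
        using lborel_integral_translate[of "\<lambda>x. cnj (b (x - y)) * G x" y] by simp
      finally show ?thesis by (simp add: corr_def mult.commute add.commute)
    qed
    then have "c (corr G b) = c (corr b' G')" by presburger
    also have "\<dots> = (\<integral>x. cnj (G (- x)) * c (\<lambda>y. b' (x + y)) \<partial>lborel)"
      unfolding tempered_corr(2)[OF c b' G'] by (simp add: G'_def)
    also have "\<dots> = (\<integral>x. cnj (G x) * conv_dist b c x \<partial>lborel)"
    proof -
      have m: "(\<lambda>x. cnj (G x) * conv_dist b c x) \<in> borel_measurable borel" by measurable
      have "c (\<lambda>y. b' (x + y)) = conv_dist b c (- x)" for x by (simp add: conv)
      then show ?thesis using lborel_integral_reflect[OF m, of 0] by simp
    qed
    finally show ?thesis
      by (simp add: func_dist_def integral_dsigma scaleR_conv_of_real tempered_cmult[OF c corr_schwartz[OF G b]])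
  qed
  have G: "fourier \<sigma> (symbol w v) \<in> schwartz" if "v \<in> Sm" "w \<in> Sm" for v w
    by (intro schwartz_fourier symbol_schwartz that)
  show "has_weak_integral \<sigma> W (\<lambda>x \<psi> \<phi>. b x * translate_op \<sigma> T W (Op \<sigma> W c) x \<psi> \<phi>)
      (Op \<sigma> W (func_dist \<sigma> (conv_dist b c)))"
    unfolding has_weak_integral_def
  proof (intro ballI conjI)
    fix w v assume wv: "w \<in> Sm" "v \<in> Sm"
    let ?G = "fourier \<sigma> (symbol w v)"
    show "integrable (dsigma \<sigma>) (\<lambda>x. b x * translate_op \<sigma> T W (Op \<sigma> W c) x v w)"
      unfolding translate_Op integrable_dsigma by (rule tempered_corr(1)[OF c G[OF wv(2,1)] b])
    show "Op \<sigma> W (func_dist \<sigma> (conv_dist b c)) v w = (\<integral>x. b x * translate_op \<sigma> T W (Op \<sigma> W c) x v w \<partial>dsigma \<sigma>)"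
      unfolding translate_Op integral_dsigma Op_eq main[OF G[OF wv(2,1)]]
        tempered_corr(2)[OF c G[OF wv(2,1)] b, symmetric]
      by (simp add: tempered_cmult[OF c corr_schwartz[OF G[OF wv(2,1)] b]] scaleR_conv_of_real)
  qed
  show "has_distributional_integral W c (\<lambda>x. translate_op \<sigma> T W (Op \<sigma> W (func_dist \<sigma> b)) x)
      (Op \<sigma> W (func_dist \<sigma> (conv_dist b c)))"
    unfolding has_distributional_integral_def
  proof (intro ballI)
    fix w v assume wv: "w \<in> Sm" "v \<in> Sm"
    let ?G = "fourier \<sigma> (symbol w v)"
    \<comment> \<open>The conjugated matrix element is itself a multiple of a correlation, which
      settles at once that it is a Schwartz function and what \<open>c\<close> does to it.\<close>
    have eq: "(\<lambda>x. cnj (translate_op \<sigma> T W (Op \<sigma> W (func_dist \<sigma> b)) x v w)) = (\<lambda>y. complex_of_real haar_const * corr ?G b y)"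
      unfolding translate_Op func_dist_def integral_dsigma corr_def Bochner_Integration.integral_cnj[symmetric]
      by (simp add: scaleR_conv_of_real add.commute flip: Bochner_Integration.integral_cnj)
    show "(\<lambda>x. cnj (translate_op \<sigma> T W (Op \<sigma> W (func_dist \<sigma> b)) x v w)) \<in> schwartz \<and>
        Op \<sigma> W (func_dist \<sigma> (conv_dist b c)) v w = c (\<lambda>x. cnj (translate_op \<sigma> T W (Op \<sigma> W (func_dist \<sigma> b)) x v w))"
      unfolding eq Op_eq main[OF G[OF wv(2,1)]] by (simp add: schwartz_cmult corr_schwartz[OF G[OF wv(2,1)] b])
  qed
qed

end

section \<open>Young's convolution inequality\<close>

text \<open>Concavity of the logarithm, in the form that it lies below its tangent at the weighted
  mean \<open>m\<close>.\<close>

lemma weighted_arith_geom_mean3: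
  fixes x y z :: real
  assumes "0 < x" "0 < y" "0 < z" "0 \<le> a" "0 \<le> b" "0 \<le> c" "a + b + c = 1"
  shows "x powr a * y powr b * z powr c \<le> a * x + b * y + c * z"
proof -
  define m where "m = a * x + b * y + c * z"
  have m: "0 < m"
  proof -
    have "0 < a \<or> 0 < b \<or> 0 < c" using assms by linarith
    then have "0 < a * x \<or> 0 < b * y \<or> 0 < c * z" using assms by auto
    moreover have "0 \<le> a * x" "0 \<le> b * y" "0 \<le> c * z" using assms by auto
    ultimately show ?thesis unfolding m_def by linarith
  qed
  have ln_le: "ln t \<le> ln m + (t / m - 1)" if "0 < t" for t
    using ln_le_minus_one[of "t / m"] that m by (simp add: ln_div)
  have "a * ln x + b * ln y + c * ln z \<le>
      a * (ln m + (x / m - 1)) + b * (ln m + (y / m - 1)) + c * (ln m + (z / m - 1))"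
    using assms by (intro add_mono mult_left_mono ln_le) auto
  also have "\<dots> = (a + b + c) * (ln m - 1) + (a * x + b * y + c * z) / m"
    by (simp add: algebra_simps add_divide_distrib)
  also have "\<dots> = ln m" unfolding m_def[symmetric] using assms m by simp
  finally have "exp (a * ln x + b * ln y + c * ln z) \<le> m" using m by (simp add: ln_ge_iff)
  then show ?thesis
    using assms by (simp add: powr_def exp_add m_def)
qed

text \<open>Weighted means of \<open>Y * Z / s\<close>, \<open>Y\<close> and \<open>Z\<close> with
  weights \<open>\<rho>\<close>, \<open>1 - \<gamma>\<close> and \<open>1 - \<alpha>\<close>, which
  add up to 1; the exponents of \<open>Y\<close> and \<open>Z\<close> then add up to
  \<open>\<alpha>\<close> and \<open>\<gamma>\<close>. The parameter \<open>s\<close> is free so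
  that it can later normalise the integral of the mixed term.\<close>

lemma Young_pointwise:
  fixes A c :: real
  assumes "0 \<le> A" "0 \<le> c" "0 < \<alpha>" "\<alpha> \<le> 1" "0 < \<gamma>" "\<gamma> \<le> 1" "1 \<le> \<alpha> + \<gamma>" "0 < s"
  defines "\<rho> \<equiv> \<alpha> + \<gamma> - 1"
  shows "A * c \<le> s powr \<rho> * (\<rho> * (A powr (1 / \<alpha>) * c powr (1 / \<gamma>) / s) +
    (1 - \<gamma>) * A powr (1 / \<alpha>) + (1 - \<alpha>) * c powr (1 / \<gamma>))"
proof (cases "A = 0 \<or> c = 0")
  case True
  then show ?thesis using assms by auto
next
  case False
  then have pos: "0 < A" "0 < c" using assms by auto
  define Y Z where "Y = A powr (1 / \<alpha>)" and "Z = c powr (1 / \<gamma>)"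
  have YZ: "0 < Y" "0 < Z" using pos by (simp_all add: Y_def Z_def)
  have "(Y * Z / s) powr \<rho> * Y powr (1 - \<gamma>) * Z powr (1 - \<alpha>) \<le> \<rho> * (Y * Z / s) + (1 - \<gamma>) * Y + (1 - \<alpha>) * Z"
    using assms YZ by (intro weighted_arith_geom_mean3) (auto simp: \<rho>_def)
  moreover have "(Y * Z / s) powr \<rho> * Y powr (1 - \<gamma>) * Z powr (1 - \<alpha>) = (Y powr \<rho> * Y powr (1 - \<gamma>)) * (Z powr \<rho> * Z powr (1 - \<alpha>)) / s powr \<rho>"
    using assms YZ by (simp add: powr_mult powr_divide)
  moreover have "Y powr \<rho> * Y powr (1 - \<gamma>) = A"
  proof -
    have "Y powr \<rho> * Y powr (1 - \<gamma>) = Y powr \<alpha>" by (simp add: \<rho>_def flip: powr_add)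
    then show ?thesis using assms pos by (simp add: Y_def powr_powr)
  qed
  moreover have "Z powr \<rho> * Z powr (1 - \<alpha>) = c"
  proof -
    have "Z powr \<rho> * Z powr (1 - \<alpha>) = Z powr \<gamma>" by (simp add: \<rho>_def flip: powr_add)
    then show ?thesis using assms pos by (simp add: Z_def powr_powr)
  qed
  ultimately have "A * c / s powr \<rho> \<le> \<rho> * (Y * Z / s) + (1 - \<gamma>) * Y + (1 - \<alpha>) * Z" by simp
  then show ?thesis using assms by (simp add: pos_divide_le_eq Y_def Z_def mult.commute)
qed

section \<open>Convolutions of functions in \<open>L^p\<close>\<close>

lemma integrable_lborel_translate:
  fixes f :: "'w::euclidean_space \<Rightarrow> 'b::{banach, second_countable_topology}"
  assumes "integrable lborel f"
  shows "integrable lborel (\<lambda>x. f (t + x))"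
proof -
  have "integrable (distr lborel borel ((+) t)) f" unfolding lborel_distr_plus by (rule assms)
  then show ?thesis using borel_measurable_integrable[OF assms] by (subst (asm) integrable_distr_eq) auto
qed

lemma lborel_distr_reflect: "distr lborel borel (\<lambda>y. t - y) = (lborel :: 'w::euclidean_space measure)"
  using lborel_affine[of "-1" t] by (simp add: density_1)

lemma integrable_lborel_reflect:
  fixes f :: "'w::euclidean_space \<Rightarrow> 'b::{banach, second_countable_topology}"
  assumes "integrable lborel f"
  shows "integrable lborel (\<lambda>x. f (t - x))"
proof -
  have "integrable (distr lborel borel (\<lambda>y. t - y)) f" unfolding lborel_distr_reflect by (rule assms)
  then show ?thesis using borel_measurable_integrable[OF assms] by (subst (asm) integrable_distr_eq) auto
qed

lemma integral_lborel_translate_real: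
  fixes f :: "'w::euclidean_space \<Rightarrow> real"
  assumes [measurable]: "f \<in> borel_measurable borel"
  shows "(\<integral>x. f (t + x) \<partial>lborel) = (\<integral>x. f x \<partial>lborel)" "(\<integral>x. f (t - x) \<partial>lborel) = (\<integral>x. f x \<partial>lborel)"
proof -
  show "(\<integral>x. f (t + x) \<partial>lborel) = (\<integral>x. f x \<partial>lborel)"
    by (subst (2) lborel_distr_plus[of t, symmetric]) (simp add: integral_distr)
  show "(\<integral>x. f (t - x) \<partial>lborel) = (\<integral>x. f x \<partial>lborel)"
    by (subst (2) lborel_distr_reflect[of t, symmetric]) (simp add: integral_distr)
qed

text \<open>Integrating in \<open>x\<close> first, translation invariance yields the product of the
  two integrals. Finiteness for fixed \<open>x\<close> is then obtained from Fubini almost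
  everywhere.\<close>

lemma integrable_convolution_pair:
  fixes f g :: "'w::euclidean_space \<Rightarrow> real"
  assumes f: "integrable lborel f" "\<And>x. 0 \<le> f x" and g: "integrable lborel g" "\<And>x. 0 \<le> g x"
  shows "AE x in lborel. integrable lborel (\<lambda>y. f (x - y) * g y)"
    and "integrable lborel (\<lambda>x. \<integral>y. f (x - y) * g y \<partial>lborel)"
proof -
  have [measurable]: "f \<in> borel_measurable borel" "g \<in> borel_measurable borel"
    using f g by (auto dest: borel_measurable_integrable)
  have tr: "integrable lborel (\<lambda>x. f (x - y))" "(\<integral>x. f (x - y) \<partial>lborel) = (\<integral>x. f x \<partial>lborel)" for y
    using integrable_lborel_translate[OF f(1), of "- y"] integral_lborel_translate_real(1)[of f "- y"] by simp_all
  have "integrable (lborel \<Otimes>\<^sub>M lborel) (\<lambda>(y, x). f (x - y) * g y)"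
  proof (rule lborel_pair.Fubini_integrable)
    have "(\<integral>x. norm (f (x - y) * g y) \<partial>lborel) = (\<integral>x. f x \<partial>lborel) * g y" for y
      using f(2) g(2) by (simp add: tr)
    then show "integrable lborel (\<lambda>y. \<integral>x. norm (case (y, x) of (y, x) \<Rightarrow> f (x - y) * g y) \<partial>lborel)"
      using g(1) by simp
    show "AE y in lborel. integrable lborel (\<lambda>x. case (y, x) of (y, x) \<Rightarrow> f (x - y) * g y)"
      using tr(1) by simp
  qed measurable
  from lborel_pair.AE_integrable_snd[OF this] lborel_pair.integrable_snd[OF this]
  show "AE x in lborel. integrable lborel (\<lambda>y. f (x - y) * g y)"
    "integrable lborel (\<lambda>x. \<integral>y. f (x - y) * g y \<partial>lborel)" .
qed

text \<open>The exponents are \<open>\<alpha> = 1/p\<close> and \<open>\<gamma> = 1/q\<close>, and \<open>s powr \<rho>\<close> with an integrable \<open>s\<close> is the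
  size of a function in \<open>L\<^sup>r\<close>, \<open>\<rho> = 1/r\<close>.  For finite exponents, \<open>s\<close> is \<open>|b|\<^sup>p * |c|\<^sup>q\<close> (convolution),
  made positive by an integrable weight.\<close>

lemma Young_estimate:
  fixes b c :: "'w::euclidean_space \<Rightarrow> complex"
  assumes b [measurable]: "b \<in> borel_measurable borel" and c [measurable]: "c \<in> borel_measurable borel"
    and \<alpha>: "0 \<le> \<alpha>" "\<alpha> \<le> 1" and \<gamma>: "0 \<le> \<gamma>" "\<gamma> \<le> 1" and sum: "1 \<le> \<alpha> + \<gamma>"
    and bL: "if \<alpha> = 0 then \<exists>C. AE x in lborel. norm (b x) \<le> C else integrable lborel (\<lambda>x. norm (b x) powr (1 / \<alpha>))"
    and cL: "if \<gamma> = 0 then \<exists>C. AE x in lborel. norm (c x) \<le> C else integrable lborel (\<lambda>x. norm (c x) powr (1 / \<gamma>))"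
  shows "\<exists>s D. (\<forall>x. 0 < s x) \<and> integrable lborel s \<and> 0 \<le> D \<and>
    (AE x in lborel. integrable lborel (\<lambda>y. b (x - y) * c y) \<and>
      (\<integral>y. norm (b (x - y) * c y) \<partial>lborel) \<le> D * s x powr (\<alpha> + \<gamma> - 1))"
proof -
  define w where "w = (\<lambda>x::'w. 1 / (1 + norm x) ^ (2 * DIM('w)))"
  have w: "0 < w x" "integrable lborel w" for x
    unfolding w_def by (auto intro!: divide_pos_pos zero_less_power add_pos_nonneg integrable_weight)
  have bounded_case: "integrable lborel (\<lambda>y. f y * g y)" "(\<integral>y. norm (f y * g y) \<partial>lborel) \<le> \<bar>C\<bar> * (\<integral>y. norm (g y) \<partial>lborel)"
    if f [measurable]: "f \<in> borel_measurable borel" and g: "integrable lborel (\<lambda>y. norm (g y))" "g \<in> borel_measurable borel"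
      and C: "AE y in lborel. norm (f y) \<le> C" for f g :: "'w \<Rightarrow> complex" and C
  proof -
    have [measurable]: "g \<in> borel_measurable borel" by fact
    have le: "AE y in lborel. norm (f y * g y) \<le> \<bar>C\<bar> * norm (g y)"
      using C by eventually_elim (auto simp: norm_mult intro!: mult_right_mono)
    show int: "integrable lborel (\<lambda>y. f y * g y)"
      by (rule Bochner_Integration.integrable_bound[OF integrable_mult_right[OF g(1), of "\<bar>C\<bar>"]])
        (use le in \<open>simp_all add: abs_mult\<close>)
    have "(\<integral>y. norm (f y * g y) \<partial>lborel) \<le> (\<integral>y. \<bar>C\<bar> * norm (g y) \<partial>lborel)"
      by (rule integral_mono_AE[OF integrable_norm[OF int] integrable_mult_right[OF g(1)] le])
    then show "(\<integral>y. norm (f y * g y) \<partial>lborel) \<le> \<bar>C\<bar> * (\<integral>y. norm (g y) \<partial>lborel)" by simp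
  qed
  have br [measurable]: "(\<lambda>y. b (x - y)) \<in> borel_measurable borel" for x by measurable
  \<comment> \<open>If one exponent is infinite, the condition on the sum forces the other to be
    1.\<close>
  consider "\<alpha> = 0" "\<gamma> = 1" | "\<gamma> = 0" "\<alpha> = 1" | "0 < \<alpha>" "0 < \<gamma>" using \<alpha> \<gamma> sum by linarith
  then show ?thesis
  proof cases
    case 1
    then obtain C where C: "AE x in lborel. norm (b x) \<le> C" using bL by auto
    have c1: "integrable lborel (\<lambda>x. norm (c x))" using cL 1 by simp
    have "AE y in lborel. norm (b (x - y)) \<le> C" for x
    proof -
      have "AE z in distr lborel borel (\<lambda>y. x - y). norm (b z) \<le> C" unfolding lborel_distr_reflect by (rule C)
      then show ?thesis by (subst (asm) AE_distr_iff) simp_all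
    qed
    from bounded_case[OF br c1 c this]
    \<comment> \<open>Here \<open>\<alpha> + \<gamma> - 1\<close> is 0 and \<open>w x powr 0\<close>
      is 1, so \<open>w\<close> serves merely as some positive integrable function.\<close>
    have "AE x in lborel. integrable lborel (\<lambda>y. b (x - y) * c y) \<and>
      (\<integral>y. norm (b (x - y) * c y) \<partial>lborel) \<le> (\<bar>C\<bar> * (\<integral>y. norm (c y) \<partial>lborel)) * w x powr (\<alpha> + \<gamma> - 1)"
      using 1 w(1) by (intro AE_I2) (simp add: less_imp_neq[symmetric])
    then show ?thesis using w
      by (intro exI[of _ w] exI[of _ "\<bar>C\<bar> * (\<integral>y. norm (c y) \<partial>lborel)"]) auto
  next
    case 2
    then obtain C where C: "AE x in lborel. norm (c x) \<le> C" using cL by auto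
    have b1: "integrable lborel (\<lambda>x. norm (b x))" using bL 2 by simp
    have b2: "integrable lborel (\<lambda>y. norm (b (x - y)))" "(\<integral>y. norm (b (x - y)) \<partial>lborel) = (\<integral>y. norm (b y) \<partial>lborel)" for x
      using integrable_lborel_reflect[OF b1] integral_lborel_translate_real(2)[of "\<lambda>y. norm (b y)" x] by simp_all
    have "AE x in lborel. integrable lborel (\<lambda>y. b (x - y) * c y) \<and>
      (\<integral>y. norm (b (x - y) * c y) \<partial>lborel) \<le> (\<bar>C\<bar> * (\<integral>y. norm (b y) \<partial>lborel)) * w x powr (\<alpha> + \<gamma> - 1)"
      using bounded_case[OF c b2(1) br C] 2 w(1)
      by (intro AE_I2) (simp add: less_imp_neq[symmetric] b2(2) mult.commute)
    then show ?thesis using w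
      by (intro exI[of _ w] exI[of _ "\<bar>C\<bar> * (\<integral>y. norm (b y) \<partial>lborel)"]) auto
  next
    case 3
    define \<rho> where "\<rho> = \<alpha> + \<gamma> - 1"
    have \<rho>: "0 \<le> \<rho>" "\<rho> \<le> 1" using \<alpha> \<gamma> sum by (auto simp: \<rho>_def)
    define f g where "f = (\<lambda>x. norm (b x) powr (1 / \<alpha>))" and "g = (\<lambda>x. norm (c x) powr (1 / \<gamma>))"
    have f: "integrable lborel f" "\<And>x. 0 \<le> f x" and g: "integrable lborel g" "\<And>x. 0 \<le> g x"
      using bL cL 3 by (simp_all add: f_def g_def)
    define I where "I = (\<lambda>x. \<integral>y. f (x - y) * g y \<partial>lborel)"
    \<comment> \<open>The weight keeps \<open>s\<close> positive where the convolution
      \<open>I\<close> vanishes, so the quotient \<open>I x / s x\<close> is at most 1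
      everywhere.\<close>
    define s where "s = (\<lambda>x. I x + w x)"
    \<comment> \<open>One summand for each term of the pointwise estimate: the mixed term
      contributes at most 1.\<close>
    define D where "D = 1 + (\<integral>x. f x \<partial>lborel) + (\<integral>x. g x \<partial>lborel)"
    have I0: "0 \<le> I x" for x unfolding I_def using f g by (intro integral_nonneg_AE) auto
    have s: "0 < s x" "integrable lborel s" for x
      using I0[of x] w integrable_convolution_pair(2)[OF f g] by (auto simp: s_def I_def[symmetric] intro: add_nonneg_pos)
    have F0: "0 \<le> (\<integral>x. f x \<partial>lborel)" "0 \<le> (\<integral>x. g x \<partial>lborel)"
      using f g by (auto intro!: integral_nonneg_AE)
    have fr: "integrable lborel (\<lambda>y. f (x - y))" "(\<integral>y. f (x - y) \<partial>lborel) = (\<integral>y. f y \<partial>lborel)" for x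
      using integrable_lborel_reflect[OF f(1)] integral_lborel_translate_real(2)[of f x] borel_measurable_integrable[OF f(1)] by simp_all
    have "AE x in lborel. integrable lborel (\<lambda>y. b (x - y) * c y) \<and>
      (\<integral>y. norm (b (x - y) * c y) \<partial>lborel) \<le> D * s x powr \<rho>"
      using integrable_convolution_pair(1)[OF f g]
    proof eventually_elim
      case (elim x)
      let ?h = "\<lambda>y. s x powr \<rho> * (\<rho> * (f (x - y) * g y / s x) + (1 - \<gamma>) * f (x - y) + (1 - \<alpha>) * g y)"
      have le: "norm (b (x - y) * c y) \<le> ?h y" for y
        unfolding norm_mult f_def g_def \<rho>_def using 3 \<alpha> \<gamma> sum s(1) by (intro Young_pointwise) auto
      have hint: "integrable lborel ?h"
        by (intro integrable_mult_right Bochner_Integration.integrable_add integrable_divide elim fr(1) g(1))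
      have int: "integrable lborel (\<lambda>y. b (x - y) * c y)"
      proof (rule Bochner_Integration.integrable_bound[OF hint])
        show "AE y in lborel. norm (b (x - y) * c y) \<le> norm (?h y)"
          unfolding real_norm_def by (intro AE_I2 order_trans[OF le abs_ge_self])
      qed measurable
      have "(\<integral>y. norm (b (x - y) * c y) \<partial>lborel) \<le> (\<integral>y. ?h y \<partial>lborel)"
        by (intro integral_mono integrable_norm int hint le)
      also have "\<dots> = s x powr \<rho> * (\<rho> * (I x / s x) + (1 - \<gamma>) * (\<integral>y. f y \<partial>lborel) + (1 - \<alpha>) * (\<integral>y. g y \<partial>lborel))"
        using elim fr g(1) by (simp add: I_def)
      also have "\<dots> \<le> s x powr \<rho> * D"
      proof (rule mult_left_mono)
        have "\<rho> * (I x / s x) \<le> 1 * 1" using \<rho> I0[of x] s(1)[of x] w(1)[of x]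
          by (intro mult_mono) (auto simp: s_def pos_divide_le_eq intro: less_imp_le)
        moreover have "(1 - \<gamma>) * (\<integral>y. f y \<partial>lborel) \<le> 1 * (\<integral>y. f y \<partial>lborel)"
          "(1 - \<alpha>) * (\<integral>y. g y \<partial>lborel) \<le> 1 * (\<integral>y. g y \<partial>lborel)"
          using \<alpha> \<gamma> F0 by (intro mult_right_mono; simp)+
        ultimately show "\<rho> * (I x / s x) + (1 - \<gamma>) * (\<integral>y. f y \<partial>lborel) + (1 - \<alpha>) * (\<integral>y. g y \<partial>lborel) \<le> D"
          unfolding D_def by linarith
      qed simp
      finally show ?case using int by (simp add: mult.commute)
    qed
    moreover have "0 \<le> D" using F0 by (simp add: D_def)
    ultimately show ?thesis unfolding \<rho>_def[symmetric] using s by (intro exI[of _ s] exI[of _ D]) auto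
  qed
qed

text \<open>Splits the bound \<open>s x powr \<rho>\<close> into a bounded and an integrable part,
  each of which can be paired with a Schwartz function.\<close>

lemma powr_le_one_plus:
  fixes s :: real assumes "0 < s" "0 \<le> \<rho>" "\<rho> \<le> 1" shows "s powr \<rho> \<le> 1 + s"
proof (cases "s \<le> 1")
  case True
  then have "s powr \<rho> \<le> 1" using assms powr_le1[of \<rho> s] by simp
  then show ?thesis using assms by simp
next
  case False
  then have "s powr \<rho> \<le> s powr 1" using assms by (intro powr_mono) auto
  then show ?thesis using assms by simp
qed

text \<open>Fubini, the shear \<open>z = x + y\<close>, and Fubini again. Absolute integrability is
  derived from the Young bound for \<open>?H\<close> and carried over to \<open>?H'\<close> by
  translating \<open>z\<close> for fixed \<open>y\<close>.\<close>

lemma convolution_pairing: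
  fixes b c G :: "'w::euclidean_space \<Rightarrow> complex"
  assumes b [measurable]: "b \<in> borel_measurable borel" and c [measurable]: "c \<in> borel_measurable borel"
    and G: "G \<in> schwartz" and s: "\<And>x. 0 < s x" "integrable lborel s" and D: "0 \<le> D" and \<rho>: "0 \<le> \<rho>" "\<rho> \<le> 1"
    and bc: "AE x in lborel. integrable lborel (\<lambda>y. b (x - y) * c y) \<and> (\<integral>y. norm (b (x - y) * c y) \<partial>lborel) \<le> D * s x powr \<rho>"
  shows "integrable lborel (\<lambda>x. b x * (\<integral>y. cnj (G (x + y)) * c y \<partial>lborel))"
    and "(\<integral>z. cnj (G z) * (\<integral>y. b (z - y) * c y \<partial>lborel) \<partial>lborel) = (\<integral>x. b x * (\<integral>y. cnj (G (x + y)) * c y \<partial>lborel) \<partial>lborel)"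
proof -
  have [measurable]: "G \<in> borel_measurable borel" by (rule schwartz_measurable[OF G])
  have Gbd: "norm (G z) \<le> schwartz_seminorm 0 [] G" for z
    using schwartz_seminorm_ge[OF G, of z 0 "[]"] by simp
  let ?H = "\<lambda>z y. cnj (G z) * (b (z - y) * c y)"
  have H: "integrable (lborel \<Otimes>\<^sub>M lborel) (\<lambda>(z, y). ?H z y)"
  proof (rule lborel_pair.Fubini_integrable)
    show "AE z in lborel. integrable lborel (\<lambda>y. case (z, y) of (z, y) \<Rightarrow> ?H z y)"
      using bc by eventually_elim simp
    have B: "AE z in lborel. norm (\<integral>y. norm (?H z y) \<partial>lborel) \<le> norm (D * (norm (G z) + schwartz_seminorm 0 [] G * s z))"
      using bc
    proof eventually_elim
      case (elim z)
      have "(\<integral>y. norm (?H z y) \<partial>lborel) = norm (G z) * (\<integral>y. norm (b (z - y) * c y) \<partial>lborel)"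
        by (simp add: norm_mult)
      also have "\<dots> \<le> norm (G z) * (D * (1 + s z))"
        using elim order_trans[OF _ mult_left_mono[OF powr_le_one_plus[OF s(1) \<rho>] D]] by (intro mult_left_mono) auto
      also have "\<dots> = D * (norm (G z) + norm (G z) * s z)" by (simp add: algebra_simps)
      also have "\<dots> \<le> D * (norm (G z) + schwartz_seminorm 0 [] G * s z)"
        using D Gbd[of z] s(1)[of z] by (intro mult_left_mono add_left_mono mult_right_mono) auto
      finally show ?case by (simp add: order_trans[OF _ abs_ge_self])
    qed
    have Bi: "integrable lborel (\<lambda>z. D * (norm (G z) + schwartz_seminorm 0 [] G * s z))"
      by (intro integrable_mult_right Bochner_Integration.integrable_add integrable_norm schwartz_integrable(1) G s(2))
    have "integrable lborel (\<lambda>z. \<integral>y. norm (?H z y) \<partial>lborel)"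
    proof (rule Bochner_Integration.integrable_bound[OF Bi _ B])
      show "(\<lambda>z. \<integral>y. norm (?H z y) \<partial>lborel) \<in> borel_measurable lborel" by measurable
    qed
    then show "integrable lborel (\<lambda>z. \<integral>y. norm (case (z, y) of (z, y) \<Rightarrow> ?H z y) \<partial>lborel)"
      by (simp only: prod.case)
  qed measurable
  let ?H' = "\<lambda>y x. cnj (G (x + y)) * (b x * c y)"
  have H': "integrable (lborel \<Otimes>\<^sub>M lborel) (\<lambda>(y, x). ?H' y x)"
  proof (rule lborel_pair.Fubini_integrable)
    have tr: "?H (y + x) y = ?H' y x" for x y by (simp add: add.commute)
    show "AE y in lborel. integrable lborel (\<lambda>x. case (y, x) of (y, x) \<Rightarrow> ?H' y x)"
      using lborel_pair.AE_integrable_snd[OF H]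
    proof eventually_elim
      case (elim y)
      show ?case using integrable_lborel_translate[OF elim, of y] unfolding tr by simp
    qed
    have "(\<integral>x. norm (?H' y x) \<partial>lborel) = (\<integral>z. norm (?H z y) \<partial>lborel)" for y
      using integral_lborel_translate_real(1)[of "\<lambda>z. norm (?H z y)" y] unfolding tr by simp
    moreover have "integrable lborel (\<lambda>y. \<integral>z. norm (?H z y) \<partial>lborel)"
      using lborel_pair.integrable_snd[of "\<lambda>z y. norm (?H z y)"] integrable_norm[OF H] by (simp add: case_prod_beta')
    ultimately show "integrable lborel (\<lambda>y. \<integral>x. norm (case (y, x) of (y, x) \<Rightarrow> ?H' y x) \<partial>lborel)" by simp
  qed measurable
  have inner: "(\<integral>y. ?H' y x \<partial>lborel) = b x * (\<integral>y. cnj (G (x + y)) * c y \<partial>lborel)" for x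
    by (simp add: mult.left_commute)
  show "integrable lborel (\<lambda>x. b x * (\<integral>y. cnj (G (x + y)) * c y \<partial>lborel))"
    using lborel_pair.integrable_snd[OF H'] unfolding inner .
  have "(\<integral>z. cnj (G z) * (\<integral>y. b (z - y) * c y \<partial>lborel) \<partial>lborel) = (\<integral>z. (\<integral>y. ?H z y \<partial>lborel) \<partial>lborel)" by simp
  also have "\<dots> = (\<integral>y. (\<integral>z. ?H z y \<partial>lborel) \<partial>lborel)"
    by (rule lborel_pair.Fubini_integral[OF H, symmetric])
  also have "\<dots> = (\<integral>y. (\<integral>x. ?H' y x \<partial>lborel) \<partial>lborel)"
  proof (rule Bochner_Integration.integral_cong[OF refl])
    fix y
    show "(\<integral>z. ?H z y \<partial>lborel) = (\<integral>x. ?H' y x \<partial>lborel)"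
      using lborel_integral_translate[of "\<lambda>z. ?H z y" y] by (simp add: add.commute)
  qed
  also have "\<dots> = (\<integral>x. (\<integral>y. ?H' y x \<partial>lborel) \<partial>lborel)"
    by (rule lborel_pair.Fubini_integral[OF H', symmetric])
  finally show "(\<integral>z. cnj (G z) * (\<integral>y. b (z - y) * c y \<partial>lborel) \<partial>lborel) = (\<integral>x. b x * (\<integral>y. cnj (G (x + y)) * c y \<partial>lborel) \<partial>lborel)"
    unfolding inner .
qed

section \<open>Kato's identity\<close>

lemma ennreal_exponent:
  fixes p :: ennreal
  assumes "0 < p"
  obtains "p = \<infinity>" "inverse p = ennreal 0" | P where "0 < P" "p = ennreal P" "inverse p = ennreal (1 / P)"
proof (cases p)
  case (real P)
  then have "0 < P" using assms by (simp add: ennreal_less_zero_iff)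
  then show thesis using that(2)[of P] real by (simp add: inverse_ennreal inverse_eq_divide)
next
  case top
  then show thesis using that(1) by simp
qed

text \<open>In terms of reciprocals, 0 encodes the infinite exponent and the conditions on exponents
  become linear inequalities between real numbers.\<close>

lemma (in symplectic) Lspace_iff:
  assumes "0 < p"
  defines "\<alpha> \<equiv> enn2real (inverse p)"
  shows "f \<in> Lspace \<sigma> p \<longleftrightarrow> f \<in> borel_measurable borel \<and>
    (if \<alpha> = 0 then \<exists>C. AE x in lborel. norm (f x) \<le> C else integrable lborel (\<lambda>x. norm (f x) powr (1 / \<alpha>)))"
proof -
  have m: "f \<in> borel_measurable (dsigma \<sigma>) \<longleftrightarrow> f \<in> borel_measurable borel"
    using measurable_cong_sets[OF sets_dsigma refl] by blast
  show ?thesis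
    using assms(1)
  proof (cases rule: ennreal_exponent)
    case 1
    then show ?thesis by (simp add: Lspace_def m AE_dsigma \<alpha>_def)
  next
    case (2 P)
    then show ?thesis by (simp add: Lspace_def m integrable_dsigma \<alpha>_def)
  qed
qed

context weyl_representation
begin

text \<open>On a transform of a Schwartz function two of the Fourier transformations cancel, so
  \<open>h(D)\<close> multiplies the test function by the conjugate of \<open>h\<close>.\<close>

lemma multiplier_eq:
  "g \<in> schwartz \<Longrightarrow> fourier_multiplier \<sigma> h u (fourier \<sigma> g) = u (fourier \<sigma> (\<lambda>x. cnj (h x) * g x))"
  by (simp add: fourier_multiplier_def fourier_dist_def mult_dist_def fourier_fourier)

lemma Op_multiplier:
  "v \<in> Sm \<Longrightarrow> w \<in> Sm \<Longrightarrow>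
    Op \<sigma> W (fourier_multiplier \<sigma> h u) v w = u (fourier \<sigma> (\<lambda>x. cnj (h x) * symbol w v x))"
  by (simp add: Op_eq multiplier_eq symbol_schwartz)

text \<open>Multiplication by the conjugate of \<open>h\<close> commutes with multiplication by a
  character; in other words, \<open>h(D)\<close> commutes with translations.\<close>

lemma translate_Op_multiplier:
  assumes "v \<in> Sm" "w \<in> Sm"
  shows "translate_op \<sigma> T W (Op \<sigma> W (fourier_multiplier \<sigma> h u)) x v w =
    u (\<lambda>y. fourier \<sigma> (\<lambda>z. cnj (h z) * symbol w v z) (x + y))"
proof -
  have "(\<lambda>y. exp (- \<i> * complex_of_real (\<sigma> x y))) \<in> Cpol"
    by (rule Cpol_exp[OF Cpol_mult[OF Cpol_const Cpol_linear[OF sigma_linear_right]]]) simp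
  then have "(\<lambda>y. exp (- \<i> * complex_of_real (\<sigma> x y)) * symbol w v y) \<in> schwartz"
    by (intro schwartz_mult_Cpol symbol_schwartz assms)
  then have "translate_op \<sigma> T W (Op \<sigma> W (fourier_multiplier \<sigma> h u)) x v w =
      u (fourier \<sigma> (\<lambda>y. cnj (h y) * (exp (- \<i> * complex_of_real (\<sigma> x y)) * symbol w v y)))"
    unfolding translate_op_eq Op_eq symbol_translate by (rule multiplier_eq)
  also have "\<dots> = u (fourier \<sigma> (\<lambda>y. exp (- \<i> * complex_of_real (\<sigma> x y)) * (cnj (h y) * symbol w v y)))"
    by (simp only: mult.left_commute)
  finally show ?thesis by (simp only: fourier_modulation)
qed

lemma Kato_identity_exponents:
  fixes b c :: "'w \<Rightarrow> complex"
  assumes b [measurable]: "b \<in> borel_measurable borel" and c [measurable]: "c \<in> borel_measurable borel"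
    and \<alpha>: "0 \<le> \<alpha>" "\<alpha> \<le> 1" and \<gamma>: "0 \<le> \<gamma>" "\<gamma> \<le> 1" and sum: "1 \<le> \<alpha> + \<gamma>"
    and bL: "if \<alpha> = 0 then \<exists>C. AE x in lborel. norm (b x) \<le> C else integrable lborel (\<lambda>x. norm (b x) powr (1 / \<alpha>))"
    and cL: "if \<gamma> = 0 then \<exists>C. AE x in lborel. norm (c x) \<le> C else integrable lborel (\<lambda>x. norm (c x) powr (1 / \<gamma>))"
    and h: "h \<in> Cpol"
  shows "AE x in dsigma \<sigma>. integrable (dsigma \<sigma>) (\<lambda>y. b (x - y) * c y)"
    and "conv \<sigma> b c \<in> borel_measurable borel"
    and "if \<alpha> + \<gamma> - 1 = 0 then \<exists>C. AE x in lborel. norm (conv \<sigma> b c x) \<le> C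
      else integrable lborel (\<lambda>x. norm (conv \<sigma> b c x) powr (1 / (\<alpha> + \<gamma> - 1)))"
    and "Op \<sigma> W (fourier_multiplier \<sigma> h (func_dist \<sigma> (conv \<sigma> b c))) \<in> smooth_operators \<sigma> T W"
    and "has_weak_integral \<sigma> W
        (\<lambda>x \<psi> \<phi>. b x * translate_op \<sigma> T W (Op \<sigma> W (fourier_multiplier \<sigma> h (func_dist \<sigma> c))) x \<psi> \<phi>)
        (Op \<sigma> W (fourier_multiplier \<sigma> h (func_dist \<sigma> (conv \<sigma> b c))))"
proof -
  define \<rho> where "\<rho> = \<alpha> + \<gamma> - 1"
  have \<rho>: "0 \<le> \<rho>" "\<rho> \<le> 1" using \<alpha> \<gamma> sum by (auto simp: \<rho>_def)
  obtain s D where s: "\<And>x. 0 < s x" "integrable lborel s" and D: "0 \<le> D"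
    and bc: "AE x in lborel. integrable lborel (\<lambda>y. b (x - y) * c y) \<and>
      (\<integral>y. norm (b (x - y) * c y) \<partial>lborel) \<le> D * s x powr \<rho>"
    using Young_estimate[OF b c \<alpha> \<gamma> sum bL cL] unfolding \<rho>_def by blast
  have [measurable]: "s \<in> borel_measurable borel" using s(2) by (auto dest: borel_measurable_integrable)
  have conv: "conv \<sigma> b c = (\<lambda>x. complex_of_real haar_const * (\<integral>y. b (x - y) * c y \<partial>lborel))"
    by (rule ext) (simp add: conv_def integral_dsigma scaleR_conv_of_real)
  show "AE x in dsigma \<sigma>. integrable (dsigma \<sigma>) (\<lambda>y. b (x - y) * c y)"
    unfolding AE_dsigma integrable_dsigma using bc by eventually_elim simp
  show cm [measurable]: "conv \<sigma> b c \<in> borel_measurable borel"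
    unfolding conv by measurable
  have bd: "AE x in lborel. norm (conv \<sigma> b c x) \<le> (haar_const * D) * s x powr \<rho>"
    using bc
  proof eventually_elim
    case (elim x)
    have "norm (\<integral>y. b (x - y) * c y \<partial>lborel) \<le> D * s x powr \<rho>"
      using elim integral_norm_bound[of lborel "\<lambda>y. b (x - y) * c y"] by linarith
    then have "haar_const * norm (\<integral>y. b (x - y) * c y \<partial>lborel) \<le> haar_const * (D * s x powr \<rho>)"
      using haar_const(1) by (intro mult_left_mono) auto
    then show ?case using haar_const(1) by (simp add: conv norm_mult mult.assoc)
  qed
  have kD: "0 \<le> haar_const * D" using haar_const(1) D by simp
  show "if \<alpha> + \<gamma> - 1 = 0 then \<exists>C. AE x in lborel. norm (conv \<sigma> b c x) \<le> C
      else integrable lborel (\<lambda>x. norm (conv \<sigma> b c x) powr (1 / (\<alpha> + \<gamma> - 1)))"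
    unfolding \<rho>_def[symmetric]
  proof (cases "\<rho> = 0")
    case True
    \<comment> \<open>Positivity of \<open>s\<close> matters even for exponent 0:
      \<open>s x powr 0\<close> is 1, whereas \<open>0 powr 0\<close> is 0.\<close>
    have "AE x in lborel. norm (conv \<sigma> b c x) \<le> haar_const * D"
      using bd by eventually_elim (use s(1) True in \<open>simp add: less_imp_neq[symmetric]\<close>)
    then show "if \<rho> = 0 then \<exists>C. AE x in lborel. norm (conv \<sigma> b c x) \<le> C
      else integrable lborel (\<lambda>x. norm (conv \<sigma> b c x) powr (1 / \<rho>))" using True by auto
  next
    case False
    then have \<rho>0: "0 < \<rho>" using \<rho> by simp
    have "integrable lborel (\<lambda>x. norm (conv \<sigma> b c x) powr (1 / \<rho>))"
    proof (rule Bochner_Integration.integrable_bound[OF integrable_mult_right[OF s(2), of "(haar_const * D) powr (1 / \<rho>)"]])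
      show "AE x in lborel. norm (norm (conv \<sigma> b c x) powr (1 / \<rho>)) \<le> norm ((haar_const * D) powr (1 / \<rho>) * s x)"
        using bd
      proof eventually_elim
        case (elim x)
        \<comment> \<open>The power \<open>1 / \<rho>\<close> turns the bound into a multiple of the
          integrable function \<open>s\<close>.\<close>
        have "norm (conv \<sigma> b c x) powr (1 / \<rho>) \<le> ((haar_const * D) * s x powr \<rho>) powr (1 / \<rho>)"
          using elim \<rho>0 by (intro powr_mono2) auto
        also have "\<dots> = (haar_const * D) powr (1 / \<rho>) * s x"
          using kD s(1)[of x] \<rho>0 by (simp add: powr_mult powr_powr)
        finally show ?case by (simp add: order_trans[OF _ abs_ge_self])
      qed
    qed measurable
    then show "if \<rho> = 0 then \<exists>C. AE x in lborel. norm (conv \<sigma> b c x) \<le> C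
      else integrable lborel (\<lambda>x. norm (conv \<sigma> b c x) powr (1 / \<rho>))" using False by simp
  qed
  \<comment> \<open>The convolution is bounded by a multiple of \<open>1 + s\<close>, which is
    integrable after division by the weight; hence it defines a tempered distribution.\<close>
  have "integrable lborel (\<lambda>x. norm (conv \<sigma> b c x) / (1 + norm x) ^ (2 * DIM('w)))"
  proof (rule Bochner_Integration.integrable_bound)
    show "integrable lborel (\<lambda>x::'w. (haar_const * D) * (1 / (1 + norm x) ^ (2 * DIM('w)) + s x))"
      by (intro integrable_mult_right Bochner_Integration.integrable_add integrable_weight s(2))
    show "AE x in lborel. norm (norm (conv \<sigma> b c x) / (1 + norm x) ^ (2 * DIM('w))) \<le>
        norm ((haar_const * D) * (1 / (1 + norm x) ^ (2 * DIM('w)) + s x))"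
      using bd
    proof eventually_elim
      case (elim x)
      let ?m = "(1 + norm x) ^ (2 * DIM('w))"
      have m: "1 \<le> ?m" by (intro one_le_power) simp
      have "norm (conv \<sigma> b c x) / ?m \<le> ((haar_const * D) * (1 + s x)) / ?m"
        using order_trans[OF elim mult_left_mono[OF powr_le_one_plus[OF s(1) \<rho>] kD]] m
        by (intro divide_right_mono) auto
      also have "\<dots> = (haar_const * D) * (1 / ?m + s x / ?m)" by (simp only: add_divide_distrib[symmetric] times_divide_eq_right)
      also have "\<dots> \<le> (haar_const * D) * (1 / ?m + s x)"
      proof -
        have p: "0 < ?m" using m by linarith
        have "s x * 1 \<le> s x * ?m" using m s(1)[of x] by (intro mult_left_mono) auto
        then have "s x / ?m \<le> s x" using p by (simp add: pos_divide_le_eq)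
        then show ?thesis using kD by (intro mult_left_mono) auto
      qed
      finally have "norm (conv \<sigma> b c x) / ?m \<le> (haar_const * D) * (1 / ?m + s x)" .
      moreover have "norm (norm (conv \<sigma> b c x) / ?m) = norm (conv \<sigma> b c x) / ?m" using m by simp
      ultimately show ?case by (simp only: real_norm_def order_trans[OF _ abs_ge_self])
    qed
  qed measurable
  from tempered_functionI(1)[OF cm this] have conv_t: "func_dist \<sigma> (conv \<sigma> b c) \<in> tempered"
    by (simp add: tempered_function_def)
  have hc: "(\<lambda>x. cnj (h x)) \<in> Cpol" by (rule Cpol_cnj[OF h])
  show "Op \<sigma> W (fourier_multiplier \<sigma> h (func_dist \<sigma> (conv \<sigma> b c))) \<in> smooth_operators \<sigma> T W"
  proof (rule smooth_operatorsI[OF conv_t, where L = "\<lambda>g. fourier \<sigma> (\<lambda>x. cnj (h x) * g x)"])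
    show "schwartz_valued Sm smooth_seminorms (\<lambda>v. fourier \<sigma> (\<lambda>x. cnj (h x) * K v x))"
      if "schwartz_valued Sm smooth_seminorms K" for K
      by (intro schwartz_valued_fourier schwartz_valued_mult_Cpol that hc)
    show "fourier \<sigma> (\<lambda>x. cnj (h x) * (f x + g x)) = (\<lambda>x. fourier \<sigma> (\<lambda>x. cnj (h x) * f x) x + fourier \<sigma> (\<lambda>x. cnj (h x) * g x) x)"
      if "f \<in> schwartz" "g \<in> schwartz" for f g
      using fourier_add[OF schwartz_mult_Cpol[OF that(1) hc] schwartz_mult_Cpol[OF that(2) hc]] by (simp only: distrib_left)
    show "fourier \<sigma> (\<lambda>x. cnj (h x) * (a * f x)) = (\<lambda>x. a * fourier \<sigma> (\<lambda>x. cnj (h x) * f x) x)" for a f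
      using fourier_cmult[of a "\<lambda>x. cnj (h x) * f x"] by (simp only: mult.left_commute)
  qed (rule Op_multiplier)
  show "has_weak_integral \<sigma> W
        (\<lambda>x \<psi> \<phi>. b x * translate_op \<sigma> T W (Op \<sigma> W (fourier_multiplier \<sigma> h (func_dist \<sigma> c))) x \<psi> \<phi>)
        (Op \<sigma> W (fourier_multiplier \<sigma> h (func_dist \<sigma> (conv \<sigma> b c))))"
    unfolding has_weak_integral_def
  proof (intro ballI)
    fix w v assume wv: "w \<in> Sm" "v \<in> Sm"
    define G where "G = fourier \<sigma> (\<lambda>x. cnj (h x) * symbol w v x)"
    have G: "G \<in> schwartz" unfolding G_def by (intro schwartz_fourier schwartz_mult_Cpol symbol_schwartz wv hc)
    note pairing = convolution_pairing[OF b c G s D \<rho> bc]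
    have tr: "b x * translate_op \<sigma> T W (Op \<sigma> W (fourier_multiplier \<sigma> h (func_dist \<sigma> c))) x v w =
        complex_of_real haar_const * (b x * (\<integral>y. cnj (G (x + y)) * c y \<partial>lborel))" for x
      by (simp add: translate_Op_multiplier[OF wv(2,1)] G_def[symmetric] func_dist_def integral_dsigma scaleR_conv_of_real)
    have "Op \<sigma> W (fourier_multiplier \<sigma> h (func_dist \<sigma> (conv \<sigma> b c))) v w =
        haar_const *\<^sub>R (\<integral>z. complex_of_real haar_const * (cnj (G z) * (\<integral>y. b (z - y) * c y \<partial>lborel)) \<partial>lborel)"
      by (simp only: Op_multiplier[OF wv(2,1)] G_def[symmetric] func_dist_def integral_dsigma conv mult.left_commute)
    also have "\<dots> = haar_const *\<^sub>R (complex_of_real haar_const * (\<integral>x. b x * (\<integral>y. cnj (G (x + y)) * c y \<partial>lborel) \<partial>lborel))"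
      by (simp only: integral_mult_right_zero pairing(2))
    finally show "integrable (dsigma \<sigma>) (\<lambda>x. b x * translate_op \<sigma> T W (Op \<sigma> W (fourier_multiplier \<sigma> h (func_dist \<sigma> c))) x v w) \<and>
        Op \<sigma> W (fourier_multiplier \<sigma> h (func_dist \<sigma> (conv \<sigma> b c))) v w =
        (\<integral>x. b x * translate_op \<sigma> T W (Op \<sigma> W (fourier_multiplier \<sigma> h (func_dist \<sigma> c))) x v w \<partial>dsigma \<sigma>)"
      unfolding tr integrable_dsigma integral_dsigma integral_mult_right_zero
      using integrable_mult_right[OF pairing(1)] by simp
  qed
qed

lemma Kato_identity_Lspace:
  fixes p q r :: ennreal
  assumes h: "h \<in> Cpol" and pq: "1 \<le> p" "1 \<le> q" "1 \<le> inverse p + inverse q"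
    and r: "inverse r = inverse p + inverse q - 1" and b: "b \<in> Lspace \<sigma> p" and c: "c \<in> Lspace \<sigma> q"
  shows "(AE x in dsigma \<sigma>. integrable (dsigma \<sigma>) (\<lambda>y. b (x - y) * c y)) \<and>
    conv \<sigma> b c \<in> Lspace \<sigma> r \<and>
    Op \<sigma> W (fourier_multiplier \<sigma> h (func_dist \<sigma> (conv \<sigma> b c))) \<in> smooth_operators \<sigma> T W \<and>
    has_weak_integral \<sigma> W
      (\<lambda>x \<psi> \<phi>. b x * translate_op \<sigma> T W (Op \<sigma> W (fourier_multiplier \<sigma> h (func_dist \<sigma> c))) x \<psi> \<phi>)
      (Op \<sigma> W (fourier_multiplier \<sigma> h (func_dist \<sigma> (conv \<sigma> b c))))"
proof -
  have unit: "\<exists>a. 0 \<le> a \<and> a \<le> 1 \<and> inverse t = ennreal a" if "1 \<le> t" for t :: ennreal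
  proof -
    have "0 < t" using that by (rule less_le_trans[OF zero_less_one])
    then show ?thesis
    proof (cases rule: ennreal_exponent)
      case 1
      then show ?thesis by (intro exI[of _ 0]) simp
    next
      case (2 P)
      then show ?thesis using that by (intro exI[of _ "1 / P"]) auto
    qed
  qed
  obtain \<alpha> where \<alpha>: "0 \<le> \<alpha>" "\<alpha> \<le> 1" "inverse p = ennreal \<alpha>" using unit[OF pq(1)] by blast
  obtain \<gamma> where \<gamma>: "0 \<le> \<gamma>" "\<gamma> \<le> 1" "inverse q = ennreal \<gamma>" using unit[OF pq(2)] by blast
  \<comment> \<open>The inequality is brought to the reals first: subtraction of
    \<open>ennreal\<close> numbers is truncated, and the reciprocal of \<open>r\<close> has to be
    the true difference.\<close>
  have "ennreal 1 \<le> ennreal (\<alpha> + \<gamma>)" using pq(3) \<alpha> \<gamma> by (simp add: ennreal_plus)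
  then have sum: "1 \<le> \<alpha> + \<gamma>" using \<alpha> \<gamma> by (subst (asm) ennreal_le_iff) auto
  have ir: "inverse r = ennreal (\<alpha> + \<gamma> - 1)"
    using sum \<alpha> \<gamma> by (simp add: r ennreal_minus[symmetric] ennreal_plus)
  \<comment> \<open>If \<open>r\<close> were 0, its reciprocal would be infinite, but it is the
    image of a real number.\<close>
  have r0: "0 < r"
  proof (rule ccontr)
    assume "\<not> 0 < r"
    then have "r = 0" by simp
    then show False using ir by simp
  qed
  have pos: "0 < p" "0 < q" using pq by (auto intro: less_le_trans[OF zero_less_one])
  have e: "enn2real (inverse p) = \<alpha>" "enn2real (inverse q) = \<gamma>" "enn2real (inverse r) = \<alpha> + \<gamma> - 1"
    using \<alpha> \<gamma> ir sum by simp_all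
  note b' = b[unfolded Lspace_iff[OF pos(1)] e] and c' = c[unfolded Lspace_iff[OF pos(2)] e]
  note main = Kato_identity_exponents[OF conjunct1[OF b'] conjunct1[OF c'] \<alpha>(1,2) \<gamma>(1,2) sum conjunct2[OF b'] conjunct2[OF c'] h]
  have "conv \<sigma> b c \<in> Lspace \<sigma> r"
    unfolding Lspace_iff[OF r0] e using main(2,3) by blast
  with main(1,4,5) show ?thesis by blast
qed

end

theorem theorem8p2:
  fixes \<sigma> :: "'w::euclidean_space \<Rightarrow> 'w \<Rightarrow> real"
    and T :: "'w \<Rightarrow> 'w"
    and W :: "'w \<Rightarrow> 'h::complex_hilbert \<Rightarrow> 'h"
  assumes "symplectic_form \<sigma>"
    and "linear T"
    and "bij (sym_part \<sigma> T)"
    and "omega_representation \<sigma> T W"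
  shows "(\<forall>b\<in>schwartz. \<forall>c\<in>tempered.
            tempered_function \<sigma> (conv_dist b c) \<and>
            Op \<sigma> W (func_dist \<sigma> (conv_dist b c)) \<in> smooth_operators \<sigma> T W \<and>
            has_weak_integral \<sigma> W
              (\<lambda>x \<psi> \<phi>. b x * translate_op \<sigma> T W (Op \<sigma> W c) x \<psi> \<phi>)
              (Op \<sigma> W (func_dist \<sigma> (conv_dist b c))) \<and>
            has_distributional_integral W c
              (\<lambda>x. translate_op \<sigma> T W (Op \<sigma> W (func_dist \<sigma> b)) x)
              (Op \<sigma> W (func_dist \<sigma> (conv_dist b c))))
       \<and> (\<forall>h\<in>Cpol. \<forall>p q r :: ennreal.
            1 \<le> p \<and> 1 \<le> q \<and> 1 \<le> inverse p + inverse q \<and>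
            inverse r = inverse p + inverse q - 1 \<longrightarrow>
            (\<forall>b\<in>Lspace \<sigma> p. \<forall>c\<in>Lspace \<sigma> q.
              (AE x in dsigma \<sigma>. integrable (dsigma \<sigma>) (\<lambda>y. b (x - y) * c y)) \<and>
              conv \<sigma> b c \<in> Lspace \<sigma> r \<and>
              Op \<sigma> W (fourier_multiplier \<sigma> h (func_dist \<sigma> (conv \<sigma> b c))) \<in> smooth_operators \<sigma> T W \<and>
              has_weak_integral \<sigma> W
                (\<lambda>x \<psi> \<phi>. b x *
                   translate_op \<sigma> T W (Op \<sigma> W (fourier_multiplier \<sigma> h (func_dist \<sigma> c))) x \<psi> \<phi>)
                (Op \<sigma> W (fourier_multiplier \<sigma> h (func_dist \<sigma> (conv \<sigma> b c))))))"
proof -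
  interpret weyl_representation \<sigma> T W
    by (intro weyl_representation.intro symplectic.intro weyl_representation_axioms.intro assms)
  show ?thesis
  proof (intro conjI ballI allI impI)
    fix b :: "'w \<Rightarrow> complex" and c :: "('w \<Rightarrow> complex) \<Rightarrow> complex"
    assume "b \<in> schwartz" "c \<in> tempered"
    note a = Kato_identity_distribution[OF this]
    show "tempered_function \<sigma> (conv_dist b c)" by (rule a)
    show "Op \<sigma> W (func_dist \<sigma> (conv_dist b c)) \<in> smooth_operators \<sigma> T W" by (rule a)
    show "has_weak_integral \<sigma> W (\<lambda>x \<psi> \<phi>. b x * translate_op \<sigma> T W (Op \<sigma> W c) x \<psi> \<phi>)
        (Op \<sigma> W (func_dist \<sigma> (conv_dist b c)))" by (rule a)
    show "has_distributional_integral W c (\<lambda>x. translate_op \<sigma> T W (Op \<sigma> W (func_dist \<sigma> b)) x)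
        (Op \<sigma> W (func_dist \<sigma> (conv_dist b c)))" by (rule a)
  next
    fix h b c :: "'w \<Rightarrow> complex" and p q r :: ennreal
    assume h: "h \<in> Cpol" and b: "b \<in> Lspace \<sigma> p" and c: "c \<in> Lspace \<sigma> q"
      and pqr: "1 \<le> p \<and> 1 \<le> q \<and> 1 \<le> inverse p + inverse q \<and> inverse r = inverse p + inverse q - 1"
    have "1 \<le> p" "1 \<le> q" "1 \<le> inverse p + inverse q" "inverse r = inverse p + inverse q - 1"
      using pqr by blast+
    note b = Kato_identity_Lspace[OF h this b c]
    show "AE x in dsigma \<sigma>. integrable (dsigma \<sigma>) (\<lambda>y. b (x - y) * c y)" using b by blast
    show "conv \<sigma> b c \<in> Lspace \<sigma> r" using b by blast
    show "Op \<sigma> W (fourier_multiplier \<sigma> h (func_dist \<sigma> (conv \<sigma> b c))) \<in> smooth_operators \<sigma> T W" using b by blast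
    show "has_weak_integral \<sigma> W
        (\<lambda>x \<psi> \<phi>. b x * translate_op \<sigma> T W (Op \<sigma> W (fourier_multiplier \<sigma> h (func_dist \<sigma> c))) x \<psi> \<phi>)
        (Op \<sigma> W (fourier_multiplier \<sigma> h (func_dist \<sigma> (conv \<sigma> b c))))" using b by blast
  qed
qed

end
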